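(* The group $\mathrm{Shr}^\omega(\mathbb R^2,0)$ satisfies property (ICP). More precisely: let $\phi\in\mathrm{Shr}^\omega(\mathbb R^2,0)$ be not involutive (i.e. $\phi\circ\phi\neq\mathrm{Id}$ as germs), and let $\gamma\subset\mathbb R^2$ be a $\phi$-invariant germ of curve at $0$ (with $0\in\gamma$) of the form $\gamma=\{y=f(x)\}$ for some continuous function $f$ defined near $0\in\mathbb R$. Then $\gamma\setminus\{0\}$ is real-analytic (i.e. $f$ is real-analytic on a punctured neighborhood of $0$); moreover, $\gamma$ is uniquely determined by $\phi$, i.e. any two such germs of $\phi$-invariant continuous graphs through $0$ coincide.
   Context: $\mathrm{Diff}^\omega(\mathbb R^2,0)$ (resp. $\mathrm{Diff}^\omega(\mathbb R,0)$) is the group of germs at $0$ of real-analytic maps of $\mathbb R^2$ (resp. $\mathbb R$) fixing $0$ with non-zero Jacobian determinant (resp. derivative) at $0$. $\mathrm{Shr}^\omega(\mathbb R^2,0)\leq\mathrm{Diff}^\omega(\mathbb R^2,0)$ is the subgroup of analytic shears, i.e. germs of the form $\psi(x,y)=(\phi_0(x),\,y+h(x))$ with $\phi_0\in\mathrm{Diff}^\omega(\mathbb R,0)$ and $h$ a germ at $0$ of real-analytic function with $h(0)=0$. A curve of class $C^\infty$ around $0$ is a closed $1$-dimensional $C^\infty$ submanifold $\lambda$ of an open neighborhood of $0$ in $\mathbb R^2$ with $0\in\lambda$. A curve (smooth, or a continuous graph) $\lambda$ through $0$ is invariant under a germ $g$ if $g(q)\in\lambda$ for all $q\in\lambda$ close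 enough to $0$. A subgroup $\mathcal G\leq\mathrm{Diff}^\omega(\mathbb R^2,0)$ satisfies (ICP) if for every $g\in\mathcal G$ with $g\circ g\neq\mathrm{Id}$ and every curve $\lambda$ of class $C^\infty$ around $0$ invariant under $g$, there is a neighborhood $N$ of $0$ such that every $p\in\lambda\cap N$, $p\neq0$, has a neighborhood $U$ for which $\lambda\cap U$ is a real-analytic curve. *)

theory Defs
  imports "HOL-Analysis.Analysis" "HOL-Algebra.Group"
begin

text \<open>Real-analyticity at a point: equal, on a neighbourhood, to the sum of a convergent
  power series.\<close>

definition real_analytic_at :: "(real \<Rightarrow> real) \<Rightarrow> real \<Rightarrow> bool" where
  "real_analytic_at f a \<longleftrightarrow>
     (\<exists>c :: nat \<Rightarrow> real. \<exists>r>0. \<forall>x. \<bar>x\<bar> < r \<longrightarrow> (\<lambda>n. c n * x ^ n) sums f (a + x))"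

definition real_analytic2_at :: "(real \<times> real \<Rightarrow> real) \<Rightarrow> real \<times> real \<Rightarrow> bool" where
  "real_analytic2_at F p \<longleftrightarrow>
     (\<exists>c :: nat \<Rightarrow> nat \<Rightarrow> real. \<exists>r>0. \<forall>x y. \<bar>x\<bar> < r \<and> \<bar>y\<bar> < r \<longrightarrow>
        ((\<lambda>(i, j). c i j * x ^ i * y ^ j) has_sum F (p + (x, y))) UNIV)"

text \<open>A germ at 0 is the class of all total functions that agree with a given one near 0.\<close>

definition germ0 :: "('a::{topological_space,zero} \<Rightarrow> 'b) \<Rightarrow> ('a \<Rightarrow> 'b) set" where
  "germ0 f = {g. \<forall>\<^sub>F p in nhds 0. g p = f p}"

text \<open>The next two predicates describe the representatives of elements of
  \<open>Diff\<^sup>\<omega>(\<real>, 0)\<close> and \<open>Diff\<^sup>\<omega>(\<real>\<^sup>2, 0)\<close>.\<close>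

definition analytic_diffeo1 :: "(real \<Rightarrow> real) \<Rightarrow> bool" where
  "analytic_diffeo1 f \<longleftrightarrow> f 0 = 0 \<and> real_analytic_at f 0 \<and> deriv f 0 \<noteq> 0"

definition jacobian_det0 :: "(real \<times> real \<Rightarrow> real \<times> real) \<Rightarrow> real" where
  "jacobian_det0 g =
     deriv (\<lambda>x. fst (g (x, 0))) 0 * deriv (\<lambda>y. snd (g (0, y))) 0
   - deriv (\<lambda>y. fst (g (0, y))) 0 * deriv (\<lambda>x. snd (g (x, 0))) 0"

definition analytic_diffeo2 :: "(real \<times> real \<Rightarrow> real \<times> real) \<Rightarrow> bool" where
  "analytic_diffeo2 g \<longleftrightarrow> g 0 = 0 \<and>
     real_analytic2_at (\<lambda>p. fst (g p)) 0 \<and> real_analytic2_at (\<lambda>p. snd (g p)) 0 \<and>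
     jacobian_det0 g \<noteq> 0"

text \<open>The group \<open>Diff\<^sup>\<omega>(\<real>\<^sup>2, 0)\<close>. The product of two germs consists of
  all maps that agree near 0 with a composition of representatives; the class so obtained does
  not depend on the representatives, since these are continuous at 0 and fix 0.\<close>

definition Diff2 :: "(real \<times> real \<Rightarrow> real \<times> real) set monoid" where
  "Diff2 = \<lparr>carrier = germ0 ` {g. analytic_diffeo2 g},
            mult = (\<lambda>A B. {k. \<exists>f\<in>A. \<exists>g\<in>B. k \<in> germ0 (f \<circ> g)}),
            one = germ0 id\<rparr>"

definition Shr2 :: "(real \<times> real \<Rightarrow> real \<times> real) set set" where
  "Shr2 = {germ0 (\<lambda>(x, y). (\<phi>\<^sub>0 x, y + h x)) | \<phi>\<^sub>0 h.
             analytic_diffeo1 \<phi>\<^sub>0 \<and> real_analytic_at h 0 \<and> h 0 = 0}"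

definition smooth_on_line :: "real set \<Rightarrow> (real \<Rightarrow> real) \<Rightarrow> bool" where
  "smooth_on_line I f \<longleftrightarrow> (\<forall>n. \<forall>t\<in>I. (deriv ^^ n) f differentiable (at t))"

definition analytic_on_line :: "real set \<Rightarrow> (real \<Rightarrow> real) \<Rightarrow> bool" where
  "analytic_on_line I f \<longleftrightarrow> (\<forall>t\<in>I. real_analytic_at f t)"

text \<open>One-dimensional embedded submanifolds of the plane, given by regular local
  parametrizations \<open>c\<close> that are homeomorphisms from an open interval onto a relatively open
  piece. The argument \<open>C\<close> is the regularity class, \<open>C I f\<close> meaning that \<open>f\<close> is of
  class \<open>C\<close> on the open set \<open>I\<close>.\<close>

definition submanifold1 :: "(real set \<Rightarrow> (real \<Rightarrow> real) \<Rightarrow> bool) \<Rightarrow> (real \<times> real) set \<Rightarrow> bool" where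
  "submanifold1 C S \<longleftrightarrow>
     (\<forall>p\<in>S. \<exists>U I c c'. open U \<and> p \<in> U \<and> open I \<and> connected I \<and>
        C I (\<lambda>t. fst (c t)) \<and> C I (\<lambda>t. snd (c t)) \<and>
        (\<forall>t\<in>I. (deriv (\<lambda>s. fst (c s)) t, deriv (\<lambda>s. snd (c s)) t) \<noteq> (0, 0)) \<and>
        homeomorphism I (S \<inter> U) c c')"

definition smooth_curve_around0 :: "(real \<times> real) set \<Rightarrow> bool" where
  "smooth_curve_around0 L \<longleftrightarrow> 0 \<in> L \<and> submanifold1 smooth_on_line L \<and>
     (\<exists>\<Omega>. open \<Omega> \<and> 0 \<in> \<Omega> \<and> closedin (top_of_set \<Omega>) L)"

definition germ_invariant :: "(real \<times> real \<Rightarrow> real \<times> real) \<Rightarrow> (real \<times> real) set \<Rightarrow> bool" where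
  "germ_invariant g L \<longleftrightarrow> (\<forall>\<^sub>F q in nhds 0. q \<in> L \<longrightarrow> g q \<in> L)"

definition ICP :: "(real \<times> real \<Rightarrow> real \<times> real) set set \<Rightarrow> bool" where
  "ICP \<G> \<longleftrightarrow> subgroup \<G> Diff2 \<and>
     (\<forall>g L. germ0 g \<in> \<G> \<and> germ0 (g \<circ> g) \<noteq> germ0 id \<and>
        smooth_curve_around0 L \<and> germ_invariant g L \<longrightarrow>
        (\<exists>N. open N \<and> 0 \<in> N \<and>
          (\<forall>p \<in> L \<inter> N - {0}. \<exists>U. open U \<and> p \<in> U \<and> submanifold1 analytic_on_line (L \<inter> U))))"

text \<open>The germ at 0 of the set \<open>\<gamma>\<close> is the graph \<open>y = f x\<close> of a function that is
  continuous near 0. The values of \<open>f\<close> away from 0 are irrelevant.\<close>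

definition continuous_graph_germ :: "(real \<times> real) set \<Rightarrow> (real \<Rightarrow> real) \<Rightarrow> bool" where
  "continuous_graph_germ \<gamma> f \<longleftrightarrow> (\<exists>r>0. continuous_on {-r<..<r} f) \<and>
     (\<forall>\<^sub>F p in nhds 0. p \<in> \<gamma> \<longleftrightarrow> snd p = f (fst p))"

end

theory Submission
  imports Defs "HOL-Complex_Analysis.Complex_Analysis"
begin

text \<open>Let \<open>\<phi>(x, y) = (\<phi>\<^sub>0 x, y + h x)\<close>. The graph of \<open>f\<close> is invariant iff
  \<open>f \<circ> \<phi>\<^sub>0 = f + h\<close>, and if \<open>\<phi>\<^sub>0\<close> were an involution this equation would make
  \<open>\<phi>\<close> one too. Replacing \<open>\<phi>\<close> by its square we may assume that
  \<open>\<phi>\<^sub>0\<close> preserves orientation; on each side of 0 it, or its inverse, is then attracting, so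
  that \<open>f = - (\<Sum>n. h \<circ> \<phi>\<^sub>0\<^sup>n)\<close> there. This gives uniqueness. For analyticity the series must
  converge uniformly on complex discs. In the hyperbolic case this is geometric convergence. In the
  parabolic case \<open>\<phi>\<^sub>0\<close> maps the disc of radius \<open>\<rho> x\<close> about \<open>x\<close> into the disc of
  radius \<open>\<rho> \<phi>\<^sub>0(x)\<close> about \<open>\<phi>\<^sub>0(x)\<close>, and \<open>|h|\<close> on such a disc is comparable to its
  value at the centre. The terms at the centres have constant sign and a convergent sum, because
  \<open>f\<close> exists and is continuous.

  A smooth invariant curve with vertical tangent is a graph \<open>x = u(y)\<close> with \<open>u'(0) = 0\<close>, and
  \<open>u (y + h (u y)) = \<phi>\<^sub>0 (u y)\<close>. Then \<open>u = 0\<close>: the flatness of \<open>u\<close> excludes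
  \<open>h = O(\<phi>\<^sub>0 - id)\<close>, and otherwise \<open>\<phi>\<^sub>0(x) - x = O(x h(x))\<close>, so that along an orbit the
  variation of \<open>ln |x|\<close> is bounded by that of \<open>y\<close>. An orbit with \<open>x \<noteq> 0\<close> starting near
  the origin therefore cannot converge, and when it leaves it makes \<open>u\<close> arbitrarily small at a
  fixed height.\<close>

section \<open>Real-analytic functions of one variable\<close>

text \<open>The same coefficients define a complex power series; it converges at \<open>z\<close>
  because the real series converges at an offset \<open>t\<close> with
  \<open>norm (z - of_real a) < t < r\<close>. As the coefficients are real, \<open>F\<close>
  commutes with conjugation, which later shows that a complex local inverse is real on the real
  axis.\<close>

lemma real_analytic_at_extend:
  assumes "real_analytic_at f a"
  obtains F r where "r > 0" "F holomorphic_on ball (of_real a) r"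
    "\<And>x. \<bar>x - a\<bar> < r \<Longrightarrow> F (of_real x) = of_real (f x)"
    "\<And>z. z \<in> ball (of_real a) r \<Longrightarrow> F (cnj z) = cnj (F z)"
proof -
  obtain c r where r: "r > 0" and c: "\<And>x. \<bar>x\<bar> < r \<Longrightarrow> (\<lambda>n. c n * x ^ n) sums f (a + x)"
    using assms unfolding real_analytic_at_def by blast
  define F where "F z = (\<Sum>n. of_real (c n) * (z - of_real a) ^ n)" for z :: complex
  have F: "(\<lambda>n. of_real (c n) * (z - of_real a) ^ n) sums F z" if z: "z \<in> ball (of_real a) r" for z
  proof -
    have "norm (z - of_real a) < r"
      using z by (simp add: dist_norm norm_minus_commute)
    then obtain t where t: "norm (z - of_real a) < t" "t < r"
      using dense by blast
    then have t0: "t > 0"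
      using norm_ge_zero le_less_trans by blast
    have "(\<lambda>n. complex_of_real (c n * t ^ n)) sums of_real (f (a + t))"
      by (rule sums_of_real, rule c) (use t t0 in auto)
    then have "summable (\<lambda>n. complex_of_real (c n) * of_real t ^ n)"
      by (simp add: sums_iff)
    then have "summable (\<lambda>n. complex_of_real (c n) * (z - of_real a) ^ n)"
      by (rule powser_inside) (use t t0 in auto)
    then show ?thesis
      unfolding F_def by (rule summable_sums)
  qed
  show ?thesis
  proof
    show "r > 0" by fact
    show "F holomorphic_on ball (of_real a) r"
      using F by (rule power_series_holomorphic)
  next
    fix x :: real assume x: "\<bar>x - a\<bar> < r"
    have "(\<lambda>n. complex_of_real (c n * (x - a) ^ n)) sums of_real (f (a + (x - a)))"
      using c[OF x] sums_of_real by blast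
    moreover have "(\<lambda>n. of_real (c n) * (of_real x - of_real a) ^ n) sums F (of_real x)"
      using x by (intro F) (simp add: dist_norm norm_minus_commute flip: of_real_diff)
    ultimately show "F (of_real x) = of_real (f x)"
      by (simp add: sums_iff)
  next
    fix z :: complex assume z: "z \<in> ball (of_real a) r"
    have cz: "cnj z \<in> ball (of_real a) r"
      using z complex_mod_cnj[of "of_real a - z"] by (simp add: dist_norm)
    have "(\<lambda>n. cnj (of_real (c n) * (z - of_real a) ^ n)) sums cnj (F z)"
      using F[OF z] by (simp only: sums_cnj)
    with F[OF cz] show "F (cnj z) = cnj (F z)"
      by (simp add: sums_iff)
  qed
qed

text \<open>Conversely, the Taylor series of \<open>F\<close> at the real centre sums to
  \<open>f\<close> on the real axis. Passing to real parts of the coefficients avoids a separate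
  proof that they are real. With this pair of lemmas the closure properties reduce to those of
  holomorphic functions.\<close>

lemma real_analytic_at_restrict:
  assumes "r > 0" "F holomorphic_on ball (of_real a) r"
    and F: "\<And>x. \<bar>x - a\<bar> < r \<Longrightarrow> F (of_real x) = of_real (f x)"
  shows "real_analytic_at f a"
proof -
  define c where "c n = (deriv ^^ n) F (of_real a) / fact n" for n
  have "(\<lambda>n. Re (c n) * x ^ n) sums f (a + x)" if x: "\<bar>x\<bar> < r" for x
  proof -
    have "(\<lambda>n. c n * (of_real (a + x) - of_real a) ^ n) sums F (of_real (a + x))"
      unfolding c_def using assms(2) by (rule holomorphic_power_series) (use x in \<open>simp add: dist_norm\<close>)
    then have "(\<lambda>n. c n * of_real (x ^ n)) sums of_real (f (a + x))"
      using F[of "a + x"] x by simp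
    then have "(\<lambda>n. Re (c n * of_real (x ^ n))) sums Re (of_real (f (a + x)))"
      by (rule sums_Re)
    then show ?thesis
      by (simp del: of_real_power)
  qed
  with \<open>r > 0\<close> show ?thesis
    unfolding real_analytic_at_def by (intro exI[of _ "\<lambda>n. Re (c n)"] exI[of _ r]) auto
qed

lemma real_analytic_at_const [simp]: "real_analytic_at (\<lambda>x. k) a"
  by (rule real_analytic_at_restrict[of 1 "\<lambda>z. of_real k"]) auto

lemma real_analytic_at_ident [simp]: "real_analytic_at (\<lambda>x. x) a"
  by (rule real_analytic_at_restrict[of 1 "\<lambda>z. z"]) auto

lemma real_analytic_at_add:
  assumes "real_analytic_at f a" "real_analytic_at g a"
  shows "real_analytic_at (\<lambda>x. f x + g x) a"
proof -
  obtain F r where F: "r > 0" "F holomorphic_on ball (of_real a) r"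
    "\<And>x. \<bar>x - a\<bar> < r \<Longrightarrow> F (of_real x) = of_real (f x)"
    using real_analytic_at_extend[OF assms(1)] by metis
  obtain G s where G: "s > 0" "G holomorphic_on ball (of_real a) s"
    "\<And>x. \<bar>x - a\<bar> < s \<Longrightarrow> G (of_real x) = of_real (g x)"
    using real_analytic_at_extend[OF assms(2)] by metis
  show ?thesis
  proof (rule real_analytic_at_restrict)
    show "min r s > 0" using F G by simp
    show "(\<lambda>z. F z + G z) holomorphic_on ball (of_real a) (min r s)"
      by (intro holomorphic_intros holomorphic_on_subset[OF F(2)] holomorphic_on_subset[OF G(2)]) auto
  qed (use F G in auto)
qed

lemma real_analytic_at_mult:
  assumes "real_analytic_at f a" "real_analytic_at g a"
  shows "real_analytic_at (\<lambda>x. f x * g x) a"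
proof -
  obtain F r where F: "r > 0" "F holomorphic_on ball (of_real a) r"
    "\<And>x. \<bar>x - a\<bar> < r \<Longrightarrow> F (of_real x) = of_real (f x)"
    using real_analytic_at_extend[OF assms(1)] by metis
  obtain G s where G: "s > 0" "G holomorphic_on ball (of_real a) s"
    "\<And>x. \<bar>x - a\<bar> < s \<Longrightarrow> G (of_real x) = of_real (g x)"
    using real_analytic_at_extend[OF assms(2)] by metis
  show ?thesis
  proof (rule real_analytic_at_restrict)
    show "min r s > 0" using F G by simp
    show "(\<lambda>z. F z * G z) holomorphic_on ball (of_real a) (min r s)"
      by (intro holomorphic_intros holomorphic_on_subset[OF F(2)] holomorphic_on_subset[OF G(2)]) auto
  qed (use F G in auto)
qed

lemma real_analytic_at_uminus:
  assumes "real_analytic_at f a"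
  shows "real_analytic_at (\<lambda>x. - f x) a"
  using real_analytic_at_mult[OF real_analytic_at_const[of "-1"] assms] by simp

lemma real_analytic_at_diff:
  assumes "real_analytic_at f a" "real_analytic_at g a"
  shows "real_analytic_at (\<lambda>x. f x - g x) a"
  using real_analytic_at_add[OF assms(1) real_analytic_at_uminus[OF assms(2)]] by simp

lemma real_analytic_at_compose:
  assumes "real_analytic_at f a" "real_analytic_at g (f a)"
  shows "real_analytic_at (\<lambda>x. g (f x)) a"
proof -
  obtain F r where F: "r > 0" "F holomorphic_on ball (of_real a) r"
    "\<And>x. \<bar>x - a\<bar> < r \<Longrightarrow> F (of_real x) = of_real (f x)"
    using real_analytic_at_extend[OF assms(1)] by metis
  obtain G s where G: "s > 0" "G holomorphic_on ball (of_real (f a)) s"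
    "\<And>x. \<bar>x - f a\<bar> < s \<Longrightarrow> G (of_real x) = of_real (g x)"
    using real_analytic_at_extend[OF assms(2)] by metis
  have "isCont F (of_real a)"
    using F(1,2) by (metis centre_in_ball continuous_on_eq_continuous_at holomorphic_on_imp_continuous_on open_ball)
  then obtain d where d: "d > 0" "\<And>z. dist z (of_real a) < d \<Longrightarrow> dist (F z) (F (of_real a)) < s"
    using G(1) unfolding continuous_at_eps_delta by metis
  have sub: "F ` ball (of_real a) (min r d) \<subseteq> ball (of_real (f a)) s"
    using d(2) F(1) F(3)[of a] by (auto simp: dist_commute)
  show ?thesis
  proof (rule real_analytic_at_restrict)
    show "min r d > 0" using F d by simp
    have "F holomorphic_on ball (of_real a) (min r d)"
      by (rule holomorphic_on_subset[OF F(2)]) auto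
    then have "(G \<circ> F) holomorphic_on ball (of_real a) (min r d)"
      using sub by (rule holomorphic_on_compose_gen[OF _ G(2)])
    then show "(\<lambda>z. G (F z)) holomorphic_on ball (of_real a) (min r d)"
      by (simp add: o_def)
  next
    fix x assume x: "\<bar>x - a\<bar> < min r d"
    then have "of_real x \<in> ball (complex_of_real a) (min r d)"
      by (simp add: dist_real_def abs_minus_commute)
    then have "F (of_real x) \<in> ball (of_real (f a)) s"
      using sub by blast
    then have "\<bar>f x - f a\<bar> < s"
      using x F(3)[of x] by (simp add: dist_real_def abs_minus_commute)
    then show "G (F (of_real x)) = of_real (g (f x))"
      using x F(3) G(3) by simp
  qed
qed

lemma real_analytic_at_DERIV:
  assumes "real_analytic_at f a"
  shows "(f has_real_derivative deriv f a) (at a)"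
proof -
  obtain F r where F: "r > 0" "F holomorphic_on ball (of_real a) r"
    "\<And>x. \<bar>x - a\<bar> < r \<Longrightarrow> F (of_real x) = of_real (f x)"
    using real_analytic_at_extend[OF assms(1)] by metis
  have "(F has_field_derivative deriv F (of_real a)) (at (of_real a))"
    using F by (intro holomorphic_derivI) auto
  then have "((\<lambda>x. F (of_real x)) has_vector_derivative deriv F (of_real a)) (at a)"
    by (rule has_vector_derivative_real_field)
  then have "((\<lambda>x. Re (F (of_real x))) has_vector_derivative Re (deriv F (of_real a))) (at a)"
    by (rule bounded_linear.has_vector_derivative[OF bounded_linear_Re])
  then have "((\<lambda>x. Re (F (of_real x))) has_real_derivative Re (deriv F (of_real a))) (at a)"
    by (simp add: has_real_derivative_iff_has_vector_derivative)
  then have "(f has_real_derivative Re (deriv F (of_real a))) (at a)"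
    by (rule has_field_derivative_transform_within[where d = r])
       (use F in \<open>auto simp: dist_real_def\<close>)
  then show ?thesis
    by (simp add: DERIV_imp_deriv)
qed

lemma real_analytic_at_isCont: "real_analytic_at f a \<Longrightarrow> isCont f a"
  using real_analytic_at_DERIV DERIV_isCont by blast

lemma real_analytic_at_eventually:
  assumes "real_analytic_at f a"
  shows "\<forall>\<^sub>F x in nhds a. real_analytic_at f x"
proof -
  obtain F r where F: "r > 0" "F holomorphic_on ball (of_real a) r"
    "\<And>x. \<bar>x - a\<bar> < r \<Longrightarrow> F (of_real x) = of_real (f x)"
    using real_analytic_at_extend[OF assms(1)] by metis
  have "real_analytic_at f x" if "dist x a < r" for x
  proof (rule real_analytic_at_restrict)
    show "r - dist x a > 0" using that by simp
    show "F holomorphic_on ball (of_real x) (r - dist x a)"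
    proof (rule holomorphic_on_subset[OF F(2)])
      show "ball (complex_of_real x) (r - dist x a) \<subseteq> ball (of_real a) r"
      proof
        fix z assume "z \<in> ball (complex_of_real x) (r - dist x a)"
        moreover have "dist (of_real a) z \<le> dist (complex_of_real a) (of_real x) + dist (of_real x) z"
          by (rule dist_triangle)
        ultimately show "z \<in> ball (of_real a) r"
          by (simp add: dist_of_real dist_commute)
      qed
    qed
  qed (use F(3) in \<open>simp add: dist_real_def\<close>)
  then show ?thesis
    using F(1) unfolding eventually_nhds_metric by blast
qed

section \<open>Order of vanishing and local inverses\<close>

text \<open>The exponent is the index of the first non-zero coefficient, and shifting the series by
  it gives the cofactor. All local estimates below come from this dichotomy between a zero germ and
  a germ of finite order.\<close>

lemma real_analytic_at_0_cases:
  assumes "real_analytic_at f 0"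
  obtains (zero) "\<forall>\<^sub>F x in nhds 0. f x = 0"
  | (factor) n g where "real_analytic_at g 0" "g 0 \<noteq> 0" "\<forall>\<^sub>F x in nhds 0. f x = x ^ n * g x"
proof -
  obtain c r where r: "r > 0" and c: "\<And>x. \<bar>x\<bar> < r \<Longrightarrow> (\<lambda>n. c n * x ^ n) sums f x"
    using assms unfolding real_analytic_at_def by auto
  show ?thesis
  proof (cases "\<forall>n. c n = 0")
    case True
    then have "f x = 0" if "\<bar>x\<bar> < r" for x
      using c[OF that] by (simp add: sums_iff)
    then show ?thesis
      using r zero unfolding eventually_nhds_metric dist_real_def by auto
  next
    case False
    define n where "n = (LEAST n. c n \<noteq> 0)"
    have n: "c n \<noteq> 0"
      unfolding n_def using False by (rule_tac LeastI_ex) blast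
    have c0: "c i = 0" if "i < n" for i
      using not_less_Least[of i "\<lambda>n. c n \<noteq> 0"] that unfolding n_def by blast
    define g where "g x = (if x = 0 then c n else f x / x ^ n)" for x
    have g: "(\<lambda>i. c (i + n) * x ^ i) sums g x" if "\<bar>x\<bar> < r" for x
    proof (cases "x = 0")
      case True
      then show ?thesis
        using powser_sums_zero[of "\<lambda>i. c (i + n)"] by (simp add: g_def)
    next
      case False
      have "(\<lambda>i. c (i + n) * x ^ (i + n)) sums (f x - (\<Sum>i<n. c i * x ^ i))"
        using c[OF that] by (rule sums_split_initial_segment)
      then have "(\<lambda>i. c (i + n) * x ^ (i + n)) sums f x"
        by (simp add: c0)
      then have "(\<lambda>i. c (i + n) * x ^ (i + n) / x ^ n) sums (f x / x ^ n)"
        by (rule sums_divide)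
      then show ?thesis
        using False by (simp add: g_def power_add)
    qed
    \<comment> \<open>At 0 the cofactor is not a quotient, so the factorization is checked
      separately; for \<open>n = 0\<close> both sides are the constant coefficient.\<close>
    have f0: "f 0 = 0 ^ n * c n"
    proof -
      have "(\<lambda>n. c n * 0 ^ n) sums f 0" using r by (intro c) simp
      then have "f 0 = c 0" using powser_sums_zero sums_unique2 by blast
      then show ?thesis using c0[of 0] by (cases n) auto
    qed
    show ?thesis
    proof (rule factor)
      show "real_analytic_at g 0"
        unfolding real_analytic_at_def using g r by (auto intro!: exI[of _ "\<lambda>i. c (i + n)"] exI[of _ r])
      show "g 0 \<noteq> 0" by (simp add: g_def n)
      show "\<forall>\<^sub>F x in nhds 0. f x = x ^ n * g x"
        using f0 by (intro always_eventually allI) (auto simp: g_def)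
    qed
  qed
qed

text \<open>The holomorphic extension has a holomorphic local inverse. It takes real values on the
  real axis because the extension is injective and commutes with conjugation, so its restriction is
  the real-analytic inverse.\<close>

lemma real_analytic_inverse:
  assumes f: "real_analytic_at f 0" and f0: "f 0 = 0" and d: "deriv f 0 \<noteq> 0"
  obtains g where "real_analytic_at g 0" "g 0 = 0" "deriv g 0 = 1 / deriv f 0"
    "\<forall>\<^sub>F x in nhds 0. f (g x) = x" "\<forall>\<^sub>F x in nhds 0. g (f x) = x"
proof -
  obtain F r where F: "r > 0" "F holomorphic_on ball 0 r"
    "\<And>x. \<bar>x\<bar> < r \<Longrightarrow> F (of_real x) = of_real (f x)"
    "\<And>z. z \<in> ball 0 r \<Longrightarrow> F (cnj z) = cnj (F z)"
    using real_analytic_at_extend[OF f] by (metis diff_zero of_real_0)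
  have F0: "F 0 = 0" using F(3)[of 0] f0 F(1) by simp
  \<comment> \<open>The complex derivative at 0 is computed along the real axis, where
    \<open>F\<close> is \<open>f\<close>; hence it is non-zero.\<close>
  have "((\<lambda>x. F (of_real x)) has_vector_derivative deriv F (of_real 0)) (at 0)"
    using F by (intro has_vector_derivative_real_field holomorphic_derivI[of _ "ball 0 r"]) auto
  moreover have "((\<lambda>x. F (of_real x)) has_vector_derivative of_real (deriv f 0)) (at 0)"
  proof -
    have "((\<lambda>x. of_real (f x)) has_vector_derivative complex_of_real (deriv f 0)) (at 0)"
      using real_analytic_at_DERIV[OF f]
      by (rule has_vector_derivative_of_real)
    then show ?thesis
      by (rule has_vector_derivative_transform_within[where d = r]) (use F in auto)
  qed
  ultimately have "deriv F (of_real 0) = of_real (deriv f 0)"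
    by (rule vector_derivative_unique_at)
  then have dF: "deriv F 0 = of_real (deriv f 0)"
    by simp
  obtain s where s: "s > 0" "ball (0::complex) s \<subseteq> ball 0 r" "open (F ` ball 0 s)" "inj_on F (ball 0 s)"
    using has_complex_derivative_locally_invertible[OF F(2), of 0] F(1) d dF
    by (metis centre_in_ball of_real_eq_0_iff open_ball)
  have hol: "F holomorphic_on ball 0 s"
    using F(2) s(2) holomorphic_on_subset by blast
  obtain G where G: "G holomorphic_on F ` ball 0 s" "\<And>z. z \<in> ball 0 s \<Longrightarrow> G (F z) = z"
    using holomorphic_has_inverse[OF hol open_ball s(4)] by metis
  obtain t where t: "t > 0" "ball 0 t \<subseteq> F ` ball 0 s"
  proof -
    have "0 \<in> F ` ball 0 s" using F0 s(1) by force
    then show ?thesis using s(3) that open_contains_ball by blast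
  qed
  define g where "g x = Re (G (of_real x))" for x
  have Gg: "G (of_real x) = of_real (g x) \<and> F (of_real (g x)) = of_real x \<and> \<bar>g x\<bar> < s" if x: "\<bar>x\<bar> < t" for x
  proof -
    have "of_real x \<in> F ` ball 0 s" using t x by (intro subsetD[OF t(2)]) auto
    then obtain z where z: "z \<in> ball 0 s" "of_real x = F z" by blast
    \<comment> \<open>Both \<open>z\<close> and \<open>cnj z\<close> lie in \<open>ball 0 s\<close>
      and are sent to the real number \<open>x\<close>, so injectivity makes \<open>z\<close>
      real.\<close>
    have "F (cnj z) = F z"
      using F(4)[of z] z s(2) by (metis complex_cnj_complex_of_real subsetD)
    then have "cnj z = z"
      using s(4) z by (auto dest!: inj_onD)
    then have "z = of_real (Re z)"
      by (metis Reals_cnj_iff of_real_Re)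
    moreover have "G (of_real x) = z" using z G(2) by simp
    moreover have "\<bar>Re z\<bar> < s" using z(1) abs_Re_le_cmod[of z] by simp
    ultimately show ?thesis using z by (simp add: g_def)
  qed
  have fg: "f (g x) = x" if x: "\<bar>x\<bar> < t" for x
  proof -
    have "\<bar>g x\<bar> < s" using Gg x by blast
    then have "complex_of_real (g x) \<in> ball 0 r"
      using s(2) by (metis mem_ball_0 norm_of_real real_norm_def subsetD)
    then have "F (of_real (g x)) = of_real (f (g x))"
      using F(3) by simp
    then show ?thesis using Gg[OF x] by simp
  qed
  have gana: "real_analytic_at g 0"
  proof (rule real_analytic_at_restrict)
    show "t > 0" by fact
    show "G holomorphic_on ball (of_real 0) t"
      using G(1) t(2) holomorphic_on_subset by auto
  qed (use Gg in auto)
  have g0: "g 0 = 0"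
    using G(2)[of 0] F0 s(1) by (simp add: g_def)
  have efg: "\<forall>\<^sub>F x in nhds 0. f (g x) = x"
    unfolding eventually_nhds_metric using fg t(1) by (auto simp: dist_real_def)
  have gf: "g (f x) = x" if x: "\<bar>x\<bar> < s" for x
  proof -
    have *: "complex_of_real x \<in> ball 0 s" using x by simp
    then have "complex_of_real x \<in> ball 0 r" using s(2) by blast
    then have "F (of_real x) = of_real (f x)" using F(3) by simp
    then show ?thesis using G(2)[OF *] by (simp add: g_def)
  qed
  have egf: "\<forall>\<^sub>F x in nhds 0. g (f x) = x"
    unfolding eventually_nhds_metric using gf s(1) by (auto simp: dist_real_def)
  have "((\<lambda>x. f (g x)) has_real_derivative deriv f 0 * deriv g 0) (at 0)"
    using real_analytic_at_DERIV[OF f] real_analytic_at_DERIV[OF gana] g0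
    by (intro DERIV_chain2) auto
  then have "((\<lambda>x. x) has_real_derivative deriv f 0 * deriv g 0) (at 0)"
    by (rule has_field_derivative_transform_within[where d = t])
       (use t fg g0 in \<open>auto simp: dist_real_def\<close>)
  then have "deriv f 0 * deriv g 0 = 1"
    using DERIV_unique DERIV_ident by blast
  then have "deriv g 0 = 1 / deriv f 0"
    using d by (simp add: field_simps)
  then show ?thesis
    using that gana g0 efg egf by blast
qed

section \<open>The group of analytic shears\<close>

definition shear :: "(real \<Rightarrow> real) \<Rightarrow> (real \<Rightarrow> real) \<Rightarrow> real \<times> real \<Rightarrow> real \<times> real" where
  "shear \<phi>\<^sub>0 h = (\<lambda>(x, y). (\<phi>\<^sub>0 x, y + h x))"

lemma shear_apply [simp]: "shear \<phi>\<^sub>0 h (x, y) = (\<phi>\<^sub>0 x, y + h x)"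
  by (simp add: shear_def)

definition shear_data :: "(real \<Rightarrow> real) \<Rightarrow> (real \<Rightarrow> real) \<Rightarrow> bool" where
  "shear_data \<phi>\<^sub>0 h \<longleftrightarrow> analytic_diffeo1 \<phi>\<^sub>0 \<and> real_analytic_at h 0 \<and> h 0 = 0"

lemma Shr2_iff: "A \<in> Shr2 \<longleftrightarrow> (\<exists>\<phi>\<^sub>0 h. shear_data \<phi>\<^sub>0 h \<and> A = germ0 (shear \<phi>\<^sub>0 h))"
  unfolding Shr2_def shear_def shear_data_def by auto

lemma germ0_eq_iff: "germ0 f = germ0 g \<longleftrightarrow> (\<forall>\<^sub>F p in nhds 0. f p = g p)"
proof
  assume "germ0 f = germ0 g"
  moreover have "f \<in> germ0 f" by (simp add: germ0_def)
  ultimately show "\<forall>\<^sub>F p in nhds 0. f p = g p" by (simp add: germ0_def)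
next
  assume *: "\<forall>\<^sub>F p in nhds 0. f p = g p"
  have "(\<forall>\<^sub>F p in nhds 0. k p = f p) \<longleftrightarrow> (\<forall>\<^sub>F p in nhds 0. k p = g p)" for k
    by (rule eventually_subst, rule eventually_mono[OF *]) simp
  then show "germ0 f = germ0 g"
    by (simp add: germ0_def)
qed

lemma germ0_self: "f \<in> germ0 f"
  by (simp add: germ0_def)

lemma shear_data_isCont:
  assumes "shear_data \<phi>\<^sub>0 h"
  shows "isCont \<phi>\<^sub>0 0" "isCont h 0" "\<phi>\<^sub>0 0 = 0" "h 0 = 0"
  using assms unfolding shear_data_def analytic_diffeo1_def
  by (auto intro: real_analytic_at_isCont)

lemma fst_tendsto_0: "filterlim fst (nhds (0 :: real)) (nhds (0 :: real \<times> real))"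
  using tendsto_fst[OF filterlim_ident, of "0 :: real \<times> real"] by (simp add: zero_prod_def)

lemma snd_tendsto_0: "filterlim snd (nhds (0 :: real)) (nhds (0 :: real \<times> real))"
  using tendsto_snd[OF filterlim_ident, of "0 :: real \<times> real"] by (simp add: zero_prod_def)

lemma shear_tendsto_0:
  assumes "shear_data \<phi>\<^sub>0 h"
  shows "filterlim (shear \<phi>\<^sub>0 h) (nhds 0) (nhds 0)"
proof -
  have "((\<lambda>p. (\<phi>\<^sub>0 (fst p), snd p + h (fst p))) \<longlongrightarrow> (\<phi>\<^sub>0 0, 0 + h 0)) (nhds (0 :: real \<times> real))"
    using shear_data_isCont[OF assms] fst_tendsto_0 snd_tendsto_0
    by (intro tendsto_Pair tendsto_add isCont_tendsto_compose[of _ \<phi>\<^sub>0] isCont_tendsto_compose[of _ h]) auto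
  moreover have "shear \<phi>\<^sub>0 h = (\<lambda>p. (\<phi>\<^sub>0 (fst p), snd p + h (fst p)))"
    by (auto simp: shear_def)
  ultimately show ?thesis
    using shear_data_isCont[OF assms] by (simp add: zero_prod_def)
qed

text \<open>Agreement of \<open>f'\<close> and \<open>f\<close> near 0 yields agreement at
  \<open>g p\<close> for \<open>p\<close> near 0, because \<open>g\<close> tends to 0 there.\<close>

lemma germ0_comp:
  assumes "f' \<in> germ0 f" "g' \<in> germ0 g" "filterlim g (nhds 0) (nhds 0)"
  shows "germ0 (f' \<circ> g') = germ0 (f \<circ> g)"
proof -
  have "\<forall>\<^sub>F p in nhds 0. f' (g p) = f (g p)"
    using assms(1,3) by (auto simp: germ0_def filterlim_iff)
  moreover have "\<forall>\<^sub>F p in nhds 0. g' p = g p"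
    using assms(2) by (simp add: germ0_def)
  ultimately show ?thesis
    unfolding germ0_eq_iff by eventually_elim simp
qed

text \<open>By \<open>germ0_comp\<close> all choices of representatives give the same germ, so the
  union in the definition of the product is a single class. The outer map is arbitrary, which allows
  an unknown left inverse in \<open>Diff2_inv_shear\<close>.\<close>

lemma Diff2_mult_germ0:
  assumes "filterlim g (nhds 0) (nhds 0)"
  shows "germ0 f \<otimes>\<^bsub>Diff2\<^esub> germ0 g = germ0 (f \<circ> g)"
proof -
  have "germ0 (f' \<circ> g') = germ0 (f \<circ> g)" if "f' \<in> germ0 f" "g' \<in> germ0 g" for f' g'
    using germ0_comp[OF that assms] .
  then have "(\<exists>f'\<in>germ0 f. \<exists>g'\<in>germ0 g. k \<in> germ0 (f' \<circ> g')) \<longleftrightarrow> k \<in> germ0 (f \<circ> g)" for k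
    using germ0_self[of f] germ0_self[of g] by metis
  then show ?thesis
    by (simp add: Diff2_def)
qed

lemma shear_comp: "shear \<phi> h \<circ> shear \<psi> k = shear (\<lambda>x. \<phi> (\<psi> x)) (\<lambda>x. k x + h (\<psi> x))"
  by (auto simp: shear_def)

lemma deriv_comp_0:
  assumes "real_analytic_at \<phi> 0" "real_analytic_at \<psi> 0" "\<psi> 0 = 0"
  shows "deriv (\<lambda>x. \<phi> (\<psi> x)) 0 = deriv \<phi> 0 * deriv \<psi> 0"
  using real_analytic_at_DERIV[OF assms(1)] real_analytic_at_DERIV[OF assms(2)] assms(3)
  by (intro DERIV_imp_deriv DERIV_chain2) auto

lemma shear_data_comp:
  assumes "shear_data \<phi> h" "shear_data \<psi> k"
  shows "shear_data (\<lambda>x. \<phi> (\<psi> x)) (\<lambda>x. k x + h (\<psi> x))"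
  using assms deriv_comp_0[of \<phi> \<psi>]
  by (auto simp: shear_data_def analytic_diffeo1_def
      intro!: real_analytic_at_add real_analytic_at_compose[of \<psi>])

text \<open>Solving \<open>(\<phi> x, y + h x) = (x', y')\<close> gives \<open>x = \<psi> x'\<close>
  and \<open>y = y' - h (\<psi> x')\<close>, again a shear.\<close>

lemma shear_data_inverse:
  assumes "shear_data \<phi> h"
  obtains \<psi> k where "shear_data \<psi> k"
    "germ0 (shear \<phi> h \<circ> shear \<psi> k) = germ0 id" "germ0 (shear \<psi> k \<circ> shear \<phi> h) = germ0 id"
proof -
  have \<phi>: "real_analytic_at \<phi> 0" "\<phi> 0 = 0" "deriv \<phi> 0 \<noteq> 0" and h: "real_analytic_at h 0" "h 0 = 0"
    using assms by (auto simp: shear_data_def analytic_diffeo1_def)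
  obtain \<psi> where \<psi>: "real_analytic_at \<psi> 0" "\<psi> 0 = 0" "deriv \<psi> 0 = 1 / deriv \<phi> 0"
    "\<forall>\<^sub>F x in nhds 0. \<phi> (\<psi> x) = x" "\<forall>\<^sub>F x in nhds 0. \<psi> (\<phi> x) = x"
    using real_analytic_inverse[OF \<phi>] by blast
  define k where "k x = - h (\<psi> x)" for x
  have sd: "shear_data \<psi> k"
    unfolding shear_data_def analytic_diffeo1_def k_def
    using \<psi> \<phi> h by (auto intro!: real_analytic_at_uminus real_analytic_at_compose[of \<psi>])
  have 1: "germ0 (shear \<phi> h \<circ> shear \<psi> k) = germ0 id"
    unfolding germ0_eq_iff using filterlim_iff[THEN iffD1, OF fst_tendsto_0, rule_format, OF \<psi>(4)]
    by eventually_elim (auto simp: k_def shear_def split: prod.splits)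
  have 2: "germ0 (shear \<psi> k \<circ> shear \<phi> h) = germ0 id"
    unfolding germ0_eq_iff using filterlim_iff[THEN iffD1, OF fst_tendsto_0, rule_format, OF \<psi>(5)]
    by eventually_elim (auto simp: k_def shear_def split: prod.splits)
  show ?thesis
    using that sd 1 2 by blast
qed

section \<open>Shears as a subgroup of the germs of the plane\<close>

text \<open>The one-variable coefficients are placed in the column \<open>j = 0\<close>. Since
  \<open>has_sum\<close> is unconditional, absolute convergence is needed; it follows from
  convergence at a point \<open>t\<close> strictly between \<open>\<bar>x\<bar>\<close> and
  \<open>r\<close>.\<close>

lemma real_analytic2_at_fst:
  assumes "real_analytic_at f 0"
  shows "real_analytic2_at (\<lambda>p. f (fst p)) 0"
proof -
  obtain c r where r: "r > 0" and c: "\<And>x. \<bar>x\<bar> < r \<Longrightarrow> (\<lambda>n. c n * x ^ n) sums f x"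
    using assms unfolding real_analytic_at_def by auto
  define d where "d i j = (if j = 0 then c i else 0)" for i j :: nat
  have "((\<lambda>(i, j). d i j * x ^ i * y ^ j) has_sum f x) UNIV" if x: "\<bar>x\<bar> < r" for x y
  proof -
    obtain t where t: "\<bar>x\<bar> < t" "t < r" using x dense by blast
    have "summable (\<lambda>n. c n * t ^ n)"
      using c[of t] t by (simp add: sums_iff)
    then have "summable (\<lambda>n. norm (c n * x ^ n))"
      using t by (intro powser_insidea) auto
    then have "((\<lambda>n. c n * x ^ n) has_sum f x) UNIV"
      using c[OF x] by (rule norm_summable_imp_has_sum)
    then have "((\<lambda>(i, j). d i j * x ^ i * y ^ j) has_sum f x) ((\<lambda>i. (i, 0)) ` UNIV)"
      by (subst has_sum_reindex) (auto simp: inj_on_def o_def d_def)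
    then show ?thesis
      by (rule has_sum_cong_neutral[THEN iffD1, rotated -1]) (auto simp: d_def image_iff)
  qed
  then show ?thesis
    unfolding real_analytic2_at_def using r by (intro exI[of _ d] exI[of _ r]) auto
qed

lemma real_analytic2_at_snd: "real_analytic2_at snd 0"
proof -
  define d where "d i j = (if i = 0 \<and> j = 1 then 1 else 0 :: real)" for i j :: nat
  have "((\<lambda>(i, j). d i j * x ^ i * y ^ j) has_sum y) UNIV" for x y
  proof -
    have "((\<lambda>(i, j). d i j * x ^ i * y ^ j) has_sum (\<Sum>(i, j)\<in>{(0, 1)}. d i j * x ^ i * y ^ j)) {(0, 1)}"
      by (rule has_sum_finite) simp
    then have "((\<lambda>(i, j). d i j * x ^ i * y ^ j) has_sum y) {(0, 1)}"
      by (simp add: d_def)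
    then show ?thesis
      by (rule has_sum_cong_neutral[THEN iffD1, rotated -1]) (auto simp: d_def split: if_splits)
  qed
  then show ?thesis
    unfolding real_analytic2_at_def by (intro exI[of _ d] exI[of _ 1]) auto
qed

lemma real_analytic2_at_add:
  assumes "real_analytic2_at F p" "real_analytic2_at G p"
  shows "real_analytic2_at (\<lambda>q. F q + G q) p"
proof -
  obtain c r where r: "r > 0" and c: "\<And>x y. \<bar>x\<bar> < r \<Longrightarrow> \<bar>y\<bar> < r \<Longrightarrow>
      ((\<lambda>(i, j). c i j * x ^ i * y ^ j) has_sum F (p + (x, y))) UNIV"
    using assms(1) unfolding real_analytic2_at_def by blast
  obtain d s where s: "s > 0" and d: "\<And>x y. \<bar>x\<bar> < s \<Longrightarrow> \<bar>y\<bar> < s \<Longrightarrow>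
      ((\<lambda>(i, j). d i j * x ^ i * y ^ j) has_sum G (p + (x, y))) UNIV"
    using assms(2) unfolding real_analytic2_at_def by blast
  have "((\<lambda>(i, j). (c i j + d i j) * x ^ i * y ^ j) has_sum F (p + (x, y)) + G (p + (x, y))) UNIV"
    if "\<bar>x\<bar> < min r s" "\<bar>y\<bar> < min r s" for x y
    using has_sum_add[OF c[of x y] d[of x y]] that
    by (simp add: case_prod_unfold distrib_right)
  then show ?thesis
    unfolding real_analytic2_at_def using r s
    by (intro exI[of _ "\<lambda>i j. c i j + d i j"] exI[of _ "min r s"]) auto
qed

lemma analytic_diffeo2_shear:
  assumes "shear_data \<phi> h"
  shows "analytic_diffeo2 (shear \<phi> h)"
proof -
  have \<phi>: "real_analytic_at \<phi> 0" "\<phi> 0 = 0" "deriv \<phi> 0 \<noteq> 0" and h: "real_analytic_at h 0" "h 0 = 0"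
    using assms by (auto simp: shear_data_def analytic_diffeo1_def)
  have "real_analytic2_at (\<lambda>p. snd p + h (fst p)) 0"
    using real_analytic2_at_add[OF real_analytic2_at_snd real_analytic2_at_fst[OF h(1)]] .
  moreover have "deriv (\<lambda>y :: real. y) 0 = 1"
    by (intro DERIV_imp_deriv DERIV_ident)
  ultimately show ?thesis
    using \<phi> h real_analytic2_at_fst[OF \<phi>(1)]
    by (simp add: analytic_diffeo2_def jacobian_det0_def zero_prod_def shear_def case_prod_unfold)
qed

text \<open>The inverse is a definite description, so its uniqueness has to be proved: if
  \<open>B\<close> is a left inverse of the shear, composing on the right with the known right
  inverse gives \<open>B\<close>.\<close>

lemma Diff2_inv_shear:
  assumes "shear_data \<phi> h" "shear_data \<psi> k"
    and "germ0 (shear \<phi> h \<circ> shear \<psi> k) = germ0 id" "germ0 (shear \<psi> k \<circ> shear \<phi> h) = germ0 id"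
  shows "inv\<^bsub>Diff2\<^esub> (germ0 (shear \<phi> h)) = germ0 (shear \<psi> k)"
  unfolding m_inv_def
proof (rule the_equality)
  show "germ0 (shear \<psi> k) \<in> carrier Diff2 \<and>
      germ0 (shear \<phi> h) \<otimes>\<^bsub>Diff2\<^esub> germ0 (shear \<psi> k) = \<one>\<^bsub>Diff2\<^esub> \<and>
      germ0 (shear \<psi> k) \<otimes>\<^bsub>Diff2\<^esub> germ0 (shear \<phi> h) = \<one>\<^bsub>Diff2\<^esub>"
    using assms(3,4) analytic_diffeo2_shear[OF assms(2)]
    by (simp add: Diff2_mult_germ0 shear_tendsto_0 assms(1,2)) (simp add: Diff2_def)
next
  fix B assume B: "B \<in> carrier Diff2 \<and>
      germ0 (shear \<phi> h) \<otimes>\<^bsub>Diff2\<^esub> B = \<one>\<^bsub>Diff2\<^esub> \<and> B \<otimes>\<^bsub>Diff2\<^esub> germ0 (shear \<phi> h) = \<one>\<^bsub>Diff2\<^esub>"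
  then obtain g where g: "B = germ0 g"
    by (auto simp: Diff2_def)
  have "germ0 (g \<circ> shear \<phi> h) = germ0 id"
    using B by (simp add: g Diff2_mult_germ0 shear_tendsto_0 assms(1)) (simp add: Diff2_def)
  then have "\<forall>\<^sub>F p in nhds 0. g (shear \<phi> h p) = p"
    by (simp add: germ0_eq_iff)
  then have "\<forall>\<^sub>F p in nhds 0. g (shear \<phi> h (shear \<psi> k p)) = shear \<psi> k p"
    using shear_tendsto_0[OF assms(2)] by (auto simp: filterlim_iff)
  moreover have "\<forall>\<^sub>F p in nhds 0. shear \<phi> h (shear \<psi> k p) = p"
    using assms(3) by (simp add: germ0_eq_iff)
  ultimately have "\<forall>\<^sub>F p in nhds 0. g p = shear \<psi> k p"
    by eventually_elim simp
  then show "B = germ0 (shear \<psi> k)"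
    by (simp add: g germ0_eq_iff)
qed

lemma subgroup_Shr2: "subgroup Shr2 Diff2"
proof
  show "Shr2 \<subseteq> carrier Diff2"
    using analytic_diffeo2_shear by (auto simp: Shr2_iff Diff2_def)
next
  fix A B assume "A \<in> Shr2" "B \<in> Shr2"
  then obtain \<phi> h \<psi> k where "shear_data \<phi> h" "A = germ0 (shear \<phi> h)" "shear_data \<psi> k" "B = germ0 (shear \<psi> k)"
    by (auto simp: Shr2_iff)
  then show "A \<otimes>\<^bsub>Diff2\<^esub> B \<in> Shr2"
    using shear_data_comp[of \<phi> h \<psi> k]
    unfolding Shr2_iff by (auto simp: Diff2_mult_germ0 shear_tendsto_0 shear_comp)
next
  have "shear_data (\<lambda>x. x) (\<lambda>x. 0)"
    by (simp add: shear_data_def analytic_diffeo1_def)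
  moreover have "shear (\<lambda>x. x) (\<lambda>x. 0) = id"
    by (auto simp: shear_def)
  ultimately have "germ0 id \<in> Shr2"
    unfolding Shr2_iff by metis
  then show "\<one>\<^bsub>Diff2\<^esub> \<in> Shr2"
    by (simp add: Diff2_def)
next
  fix A assume "A \<in> Shr2"
  then obtain \<phi> h where A: "shear_data \<phi> h" "A = germ0 (shear \<phi> h)"
    by (auto simp: Shr2_iff)
  from shear_data_inverse[OF A(1)] obtain \<psi> k where *: "shear_data \<psi> k"
    "germ0 (shear \<phi> h \<circ> shear \<psi> k) = germ0 id" "germ0 (shear \<psi> k \<circ> shear \<phi> h) = germ0 id"
    by metis
  show "inv\<^bsub>Diff2\<^esub> A \<in> Shr2"
    using Diff2_inv_shear[OF A(1) *] * A(2) by (auto simp: Shr2_iff)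
qed

section \<open>The cohomological equation on the attracting side\<close>

text \<open>The complexified series converges uniformly on the disc by the Weierstrass test, hence
  has a holomorphic sum, and on the real axis this sum is \<open>- f\<close>. What remains in each
  application is to keep the iterates of the disc in \<open>A\<close> and to find the majorant
  \<open>M\<close>.\<close>

lemma real_analytic_at_iterated_series:
  fixes \<Phi> H :: "complex \<Rightarrow> complex"
  assumes "r > 0" and hol: "\<Phi> holomorphic_on A" "H holomorphic_on A"
    and iter: "\<And>n z. z \<in> ball (of_real x0) r \<Longrightarrow> (\<Phi> ^^ n) z \<in> A"
    and bound: "\<And>n z. z \<in> ball (of_real x0) r \<Longrightarrow> norm (H ((\<Phi> ^^ n) z)) \<le> M n"
    and M: "summable M"
    and ext: "\<And>x. of_real x \<in> A \<Longrightarrow> \<Phi> (of_real x) = of_real (\<psi> x)"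
      "\<And>x. of_real x \<in> A \<Longrightarrow> H (of_real x) = of_real (h x)"
    and sums: "\<And>x. \<bar>x - x0\<bar> < r \<Longrightarrow> (\<lambda>n. h ((\<psi> ^^ n) x)) sums - f x"
  shows "real_analytic_at f x0"
proof -
  let ?B = "ball (complex_of_real x0) r"
  have hol_iter: "(\<Phi> ^^ n) holomorphic_on ?B" for n
  proof (induction n)
    case 0
    then show ?case by (simp add: id_def)
  next
    case (Suc n)
    have "(\<Phi> \<circ> \<Phi> ^^ n) holomorphic_on ?B"
      by (rule holomorphic_on_compose_gen[OF Suc hol(1)]) (use iter in blast)
    then show ?case by (simp add: o_def)
  qed
  have hol_H: "(\<lambda>z. H ((\<Phi> ^^ n) z)) holomorphic_on ?B" for n
    using holomorphic_on_compose_gen[OF hol_iter hol(2)] iter by (force simp: o_def)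
  have lim: "uniform_limit ?B (\<lambda>n z. \<Sum>i<n. H ((\<Phi> ^^ i) z)) (\<lambda>z. \<Sum>i. H ((\<Phi> ^^ i) z)) sequentially"
    using bound M by (rule Weierstrass_m_test)
  have "(\<lambda>z. \<Sum>i. H ((\<Phi> ^^ i) z)) holomorphic_on ?B"
  proof (rule holomorphic_uniform_sequence)
    show "(\<lambda>z. \<Sum>i<n. H ((\<Phi> ^^ i) z)) holomorphic_on ?B" for n
      by (intro holomorphic_intros hol_H)
    fix z assume "z \<in> ?B"
    then obtain d where "d > 0" "cball z d \<subseteq> ?B"
      using open_contains_cball by blast
    then show "\<exists>d>0. cball z d \<subseteq> ?B \<and>
        uniform_limit (cball z d) (\<lambda>n z. \<Sum>i<n. H ((\<Phi> ^^ i) z)) (\<lambda>z. \<Sum>i. H ((\<Phi> ^^ i) z)) sequentially"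
      using uniform_limit_on_subset[OF lim] by blast
  qed auto
  then have "(\<lambda>z. - (\<Sum>i. H ((\<Phi> ^^ i) z))) holomorphic_on ?B"
    by (intro holomorphic_intros)
  with \<open>r > 0\<close> show ?thesis
  proof (rule real_analytic_at_restrict)
    fix x :: real assume x: "\<bar>x - x0\<bar> < r"
    then have xB: "of_real x \<in> ?B"
      by (simp add: dist_real_def abs_minus_commute)
    have it: "(\<Phi> ^^ n) (of_real x) = of_real ((\<psi> ^^ n) x)" for n
    proof (induction n)
      case (Suc n)
      then show ?case using iter[OF xB, of n] ext(1) by simp
    qed simp
    have "H ((\<Phi> ^^ n) (of_real x)) = of_real (h ((\<psi> ^^ n) x))" for n
      using iter[OF xB, of n] ext(2) by (simp add: it)
    moreover have "(\<lambda>n. complex_of_real (h ((\<psi> ^^ n) x))) sums of_real (- f x)"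
      using sums[OF x] by (rule sums_of_real)
    ultimately show "- (\<Sum>i. H ((\<Phi> ^^ i) (of_real x))) = of_real (f x)"
      by (simp add: sums_iff)
  qed
qed

lemma decreasing_iterates:
  fixes \<psi> :: "real \<Rightarrow> real"
  assumes dec: "\<And>x. 0 < x \<Longrightarrow> x < \<delta> \<Longrightarrow> 0 < \<psi> x \<and> \<psi> x < x"
    and x: "0 < x" "x < \<delta>"
  shows "0 < (\<psi> ^^ n) x \<and> (\<psi> ^^ n) x \<le> x"
proof (induction n)
  case (Suc n)
  then show ?case using dec[of "(\<psi> ^^ n) x"] x by simp
qed (use x in simp)

text \<open>The iterates decrease to a limit that is fixed by continuity if it is positive; but
  \<open>\<psi>\<close> has no positive fixed point below \<open>\<delta>\<close>.\<close>

lemma decreasing_iterates_tendsto_0: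
  fixes \<psi> :: "real \<Rightarrow> real"
  assumes dec: "\<And>x. 0 < x \<Longrightarrow> x < \<delta> \<Longrightarrow> 0 < \<psi> x \<and> \<psi> x < x"
    and cont: "\<And>x. 0 < x \<Longrightarrow> x < \<delta> \<Longrightarrow> isCont \<psi> x"
    and x: "0 < x" "x < \<delta>"
  shows "(\<lambda>n. (\<psi> ^^ n) x) \<longlonglongrightarrow> 0"
proof -
  let ?X = "\<lambda>n. (\<psi> ^^ n) x"
  have X: "0 < ?X n \<and> ?X n \<le> x" for n
    using decreasing_iterates[OF dec x] by blast
  have "decseq ?X"
    using X dec x by (intro decseq_SucI) (smt (verit) comp_apply funpow.simps(2))
  then obtain l where l: "?X \<longlonglongrightarrow> l" "\<And>n. l \<le> ?X n"
    using decseq_convergent[of ?X 0] X less_imp_le by metis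
  have "l \<ge> 0"
    using LIMSEQ_le_const[OF l(1)] X less_imp_le by blast
  moreover have "\<not> l > 0"
  proof
    assume "l > 0"
    moreover have "l < \<delta>" using l(2)[of 0] x by simp
    ultimately have "(\<lambda>n. \<psi> (?X n)) \<longlonglongrightarrow> \<psi> l" "\<psi> l < l"
      using cont dec isCont_tendsto_compose l(1) by blast+
    moreover have "(\<lambda>n. ?X (Suc n)) \<longlonglongrightarrow> l"
      using l(1) by (rule LIMSEQ_Suc)
    ultimately show False
      using LIMSEQ_unique by fastforce
  qed
  ultimately show ?thesis using l by simp
qed

text \<open>The partial sums telescope to \<open>f ((\<psi> ^^ n) x) - f x\<close>, and the first
  term tends to \<open>f 0 = 0\<close>.\<close>

lemma cohomological_equation_sums:
  fixes \<psi> f h :: "real \<Rightarrow> real"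
  assumes dec: "\<And>x. 0 < x \<Longrightarrow> x < \<delta> \<Longrightarrow> 0 < \<psi> x \<and> \<psi> x < x"
    and cont: "\<And>x. 0 < x \<Longrightarrow> x < \<delta> \<Longrightarrow> isCont \<psi> x"
    and eq: "\<And>x. 0 < x \<Longrightarrow> x < \<delta> \<Longrightarrow> f (\<psi> x) = f x + h x"
    and f: "isCont f 0" "f 0 = 0"
    and x: "0 < x" "x < \<delta>"
  shows "(\<lambda>n. h ((\<psi> ^^ n) x)) sums - f x"
proof -
  let ?X = "\<lambda>n. (\<psi> ^^ n) x"
  have X: "0 < ?X n \<and> ?X n \<le> x" for n
    using decreasing_iterates[OF dec x] by blast
  have "(\<Sum>i<n. h (?X i)) = f (?X n) - f x" for n
  proof (induction n)
    case (Suc n)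
    then show ?case using eq[of "?X n"] X[of n] x by simp
  qed simp
  moreover have "(\<lambda>n. f (?X n) - f x) \<longlonglongrightarrow> 0 - f x"
    using isCont_tendsto_compose[OF f(1) decreasing_iterates_tendsto_0[OF dec cont x]] f(2)
    by (intro tendsto_intros) auto
  ultimately show ?thesis by (simp add: sums_def)
qed

lemma real_analytic_at_extend_0:
  assumes "real_analytic_at f 0"
  obtains F r where "r > 0" "F holomorphic_on ball 0 r" "isCont F 0" "F 0 = of_real (f 0)"
    "\<And>x. \<bar>x\<bar> < r \<Longrightarrow> F (of_real x) = of_real (f x)"
proof -
  obtain F r where F: "r > 0" "F holomorphic_on ball 0 r"
    "\<And>x. \<bar>x\<bar> < r \<Longrightarrow> F (of_real x) = of_real (f x)"
    using real_analytic_at_extend[OF assms] by (metis diff_zero of_real_0)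
  moreover have "isCont F 0"
    using F(1,2) by (metis centre_in_ball continuous_on_eq_continuous_at holomorphic_on_imp_continuous_on open_ball)
  ultimately show ?thesis using that F(3)[of 0] by simp
qed

section \<open>Estimates on complex discs\<close>

text \<open>Write \<open>h x = x ^ m * b x\<close> with \<open>b 0 \<noteq> 0\<close>. Near 0 the
  cofactor is within half of \<open>b 0\<close>, so the extension at \<open>z\<close> has size about
  \<open>norm z ^ m\<close>, comparable to \<open>h x\<close> when
  \<open>norm z \<le> 2 * x\<close>. The linear bound uses \<open>m > 0\<close>. The constant sign
  \<open>\<sigma>\<close> on the right of 0 will turn convergence of a series of values of
  \<open>h\<close> into absolute convergence.\<close>

lemma real_analytic_extension_bounds:
  assumes h: "real_analytic_at h 0" "h 0 = 0"
  obtains H r C L \<sigma> where "r > 0" "H holomorphic_on ball 0 r" "C \<ge> 0" "L \<ge> 0"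
    "\<And>x. \<bar>x\<bar> < r \<Longrightarrow> H (of_real x) = of_real (h x)"
    "\<And>x z. 0 < x \<Longrightarrow> x < r \<Longrightarrow> norm z \<le> 2 * x \<Longrightarrow> norm z < r \<Longrightarrow> norm (H z) \<le> C * \<bar>h x\<bar>"
    "\<And>z. norm z < r \<Longrightarrow> norm (H z) \<le> L * norm z"
    "\<And>x. 0 < x \<Longrightarrow> x < r \<Longrightarrow> \<bar>h x\<bar> = \<sigma> * h x"
  using h(1)
proof (cases rule: real_analytic_at_0_cases)
  case zero
  then obtain r where "r > 0" "\<And>x. \<bar>x\<bar> < r \<Longrightarrow> h x = 0"
    unfolding eventually_nhds_metric dist_real_def by auto
  then show ?thesis
    using that[of r "\<lambda>z. 0" 0 0 1] by simp
next
  case (factor m b)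
  obtain B s where B: "s > 0" "B holomorphic_on ball 0 s" "isCont B 0" "B 0 = of_real (b 0)"
    "\<And>x. \<bar>x\<bar> < s \<Longrightarrow> B (of_real x) = of_real (b x)"
    using real_analytic_at_extend_0[OF factor(1)] by metis
  obtain t where t: "t > 0" "\<And>x. \<bar>x\<bar> < t \<Longrightarrow> h x = x ^ m * b x"
    using factor(3) unfolding eventually_nhds_metric dist_real_def by auto
  obtain u where u: "u > 0" "\<And>z. norm z < u \<Longrightarrow> norm (B z - of_real (b 0)) < \<bar>b 0\<bar> / 2"
    using B(3,4) factor(2) unfolding continuous_at_eps_delta dist_norm
    by (metis diff_zero half_gt_zero zero_less_abs_iff)
  \<comment> \<open>The bound 1 makes \<open>norm z ^ m \<le> norm z\<close> on the disc.\<close>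
  define r where "r = Min {s, t, u, 1}"
  have r: "r > 0" "r \<le> s" "r \<le> t" "r \<le> u" "r \<le> 1"
    using B(1) t(1) u(1) by (auto simp: r_def)
  have m: "m > 0"
    using t(2)[of 0] t(1) h(2) factor(2) by (cases m) auto
  have upper: "norm (B z) \<le> 2 * \<bar>b 0\<bar>" if "norm z < r" for z
    using norm_triangle_ineq2[of "B z" "of_real (b 0)"] u(2)[of z] that r by simp
  have close: "\<bar>b x - b 0\<bar> < \<bar>b 0\<bar> / 2" if "\<bar>x\<bar> < r" for x
  proof -
    have "norm (B (of_real x) - of_real (b 0)) < \<bar>b 0\<bar> / 2"
      using u(2)[of "of_real x"] that r by simp
    then show ?thesis
      using B(5)[of x] that r by (metis norm_of_real of_real_diff order_less_le_trans real_norm_def)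
  qed
  define H where "H z = z ^ m * B z" for z
  show ?thesis
  proof (rule that[of r H "4 * 2 ^ m" "2 * \<bar>b 0\<bar>" "sgn (b 0)"])
    show "H holomorphic_on ball 0 r"
      unfolding H_def by (intro holomorphic_intros holomorphic_on_subset[OF B(2)]) (use r in auto)
    show "H (of_real x) = of_real (h x)" if "\<bar>x\<bar> < r" for x
      using B(5)[of x] t(2)[of x] that r by (simp add: H_def)
  next
    fix x and z :: complex assume x: "0 < x" "x < r" and z: "norm z \<le> 2 * x" "norm z < r"
    have "norm (H z) \<le> (2 * x) ^ m * (2 * \<bar>b 0\<bar>)"
      unfolding H_def norm_mult norm_power using upper[OF z(2)] z x
      by (intro mult_mono power_mono) auto
    \<comment> \<open>The cofactor at the centre has size at least
      \<open>\<bar>b 0\<bar> / 2\<close>, hence the factor 4.\<close>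
    also have "\<dots> \<le> (2 * x) ^ m * (4 * \<bar>b x\<bar>)"
      using close[of x] x by (intro mult_left_mono) (auto simp: abs_if split: if_splits)
    also have "\<dots> = 4 * 2 ^ m * \<bar>h x\<bar>"
      using t(2)[of x] x r by (simp add: abs_mult power_mult_distrib power_abs)
    finally show "norm (H z) \<le> 4 * 2 ^ m * \<bar>h x\<bar>" .
  next
    fix z :: complex assume z: "norm z < r"
    have "norm z ^ m \<le> norm z"
      using m z r power_decreasing[of 1 m "norm z"] by simp
    then show "norm (H z) \<le> 2 * \<bar>b 0\<bar> * norm z"
      unfolding H_def norm_mult norm_power
      using mult_mono[OF _ upper[OF z], of "norm z ^ m" "norm z"] by (simp add: mult_ac)
  next
    fix x assume x: "0 < x" "x < r"
    have "\<bar>b x\<bar> = sgn (b 0) * b x"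
      using close[of x] x factor(2) by (auto simp: sgn_real_def abs_if split: if_splits)
    then show "\<bar>h x\<bar> = sgn (b 0) * h x"
      using t(2)[of x] x r by (simp add: abs_mult)
  qed (use r in auto)
qed

text \<open>The derivative on the disc is at most about \<open>1 - n a x^(n - 1)\<close> with \<open>a = - g 0\<close>, while
  the centre shrinks by the factor \<open>1 - a x^(n - 1)\<close> only; since \<open>n \<ge> 2\<close> there is room for
  the errors.\<close>

lemma parabolic_disc:
  fixes G :: "complex \<Rightarrow> complex" and g :: "real \<Rightarrow> real"
  assumes s: "s > 0" and G: "G holomorphic_on ball 0 s" "isCont G 0" "G 0 = of_real (g 0)"
    and g: "isCont g 0" "g 0 < 0" and n: "n \<ge> 2"
  obtains \<rho> \<delta> where "0 < \<rho>" "\<rho> \<le> 1" "\<delta> > 0" "2 * \<delta> \<le> s"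
    "\<And>x z. 0 < x \<Longrightarrow> x < \<delta> \<Longrightarrow> G (of_real x) = of_real (g x) \<Longrightarrow> norm (z - of_real x) \<le> \<rho> * x \<Longrightarrow>
      norm (z + z ^ n * G z - of_real (x + x ^ n * g x)) \<le> \<rho> * (x + x ^ n * g x)"
proof -
  define a where "a = - g 0"
  have a: "a > 0" using g by (simp add: a_def)
  define k where "k = n - 1"
  have k: "n = Suc k" "k \<ge> 1" using n by (auto simp: k_def)
  \<comment> \<open>The derivative of \<open>z + z ^ n * G z\<close> is
    \<open>1 + z ^ k * D z\<close>, where \<open>D\<close> is continuous with
    \<open>D 0 = - n * a\<close>.\<close>
  define D where "D z = of_nat n * G z + z * deriv G z" for z
  have D: "((\<lambda>z. z + z ^ n * G z) has_field_derivative 1 + z ^ k * D z) (at z)" if "z \<in> ball 0 s" for z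
  proof -
    have "((\<lambda>z. z ^ n) has_field_derivative of_nat n * z ^ k) (at z)"
      using DERIV_power[OF DERIV_ident, of n z UNIV] by (simp add: k(1))
    then have "((\<lambda>z. z + z ^ n * G z) has_field_derivative
        1 + (of_nat n * z ^ k * G z + deriv G z * z ^ n)) (at z)"
      by (intro DERIV_add DERIV_mult DERIV_ident holomorphic_derivI[OF G(1) open_ball that])
    then show ?thesis by (simp add: D_def k(1) algebra_simps)
  qed
  have "D holomorphic_on ball 0 s"
    unfolding D_def by (intro holomorphic_intros G(1) open_ball)
  then have Dcont: "isCont D 0"
    using s by (metis centre_in_ball continuous_on_eq_continuous_at holomorphic_on_imp_continuous_on open_ball)
  have D0: "D 0 = - of_real (n * a)"
    by (simp add: D_def G(3) a_def)
  \<comment> \<open>Putting \<open>w = x * (1 + \<zeta>)\<close> gives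
    \<open>w ^ k * D w = x ^ k * q (\<zeta>, w)\<close>. A single continuity statement at the origin
    then controls both the relative displacement \<open>\<zeta>\<close>, bounded by
    \<open>\<rho>\<close>, and the size of \<open>w\<close>, bounded by
    \<open>2 * \<delta>\<close>.\<close>
  define q where "q p = (1 + fst p) ^ k * D (snd p)" for p :: "complex \<times> complex"
  have "isCont q (0, 0)"
    unfolding q_def using Dcont by (intro continuous_intros isCont_o2[of _ snd D]) auto
  moreover have "q (0, 0) = - of_real (n * a)"
    by (simp add: q_def D0)
  ultimately obtain e where e: "e > 0" "\<And>p. dist p (0, 0) < e \<Longrightarrow> dist (q p) (- of_real (n * a)) < a / 4"
    using a unfolding continuous_at_eps_delta by (metis zero_less_divide_iff zero_less_numeral)
  obtain d where d: "d > 0" "\<And>x. \<bar>x\<bar> < d \<Longrightarrow> \<bar>g x + a\<bar> < a / 2"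
    using g(1) a unfolding continuous_at_eps_delta dist_real_def a_def
    by (metis diff_minus_eq_add diff_zero half_gt_zero minus_minus)
  \<comment> \<open>With \<open>\<rho> \<le> e / 3\<close> and \<open>\<delta> \<le> e / 5\<close>
    the pair \<open>(\<zeta>, w)\<close> has norm below
    \<open>e / 3 + 2 * e / 5 < e\<close>.\<close>
  define \<rho> where "\<rho> = min (e / 3) 1"
  have \<rho>: "0 < \<rho>" "\<rho> \<le> 1" "\<rho> \<le> e / 3" using e(1) by (auto simp: \<rho>_def)
  define \<delta> where "\<delta> = Min {s / 2, e / 5, d, 1, 1 / (n * a)}"
  have \<delta>: "\<delta> > 0" "\<delta> \<le> s / 2" "\<delta> \<le> e / 5" "\<delta> \<le> d" "\<delta> \<le> 1" "\<delta> \<le> 1 / (n * a)"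
    using s e(1) d(1) a n by (auto simp: \<delta>_def)
  show ?thesis
  proof (rule that[OF \<rho>(1,2) \<delta>(1)])
    show "2 * \<delta> \<le> s" using \<delta>(2) by simp
  next
    fix x and z :: complex assume x: "0 < x" "x < \<delta>" and Gx: "G (of_real x) = of_real (g x)"
      and z: "norm (z - of_real x) \<le> \<rho> * x"
    let ?\<Phi> = "\<lambda>z. z + z ^ n * G z"
    define c where "c = a * x ^ k"
    have xk: "0 < x ^ k" "x ^ k \<le> x"
      using x \<delta>(5) k power_decreasing[of 1 k x] by auto
    then have c: "c > 0" using a by (simp add: c_def)
    \<comment> \<open>This makes \<open>1 - n * c\<close> non-negative, so it equals its absolute
      value in the bound of the derivative.\<close>
    have nc: "n * c \<le> 1"
    proof -
      have "n * c \<le> n * a * x" using mult_left_mono[OF xk(2), of "n * a"] a by (simp add: c_def)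
      also have "\<dots> \<le> n * a * (1 / (n * a))"
        using x \<delta>(6) a by (intro mult_left_mono) auto
      also have "\<dots> = 1" using a n by simp
      finally show ?thesis .
    qed
    \<comment> \<open>The main term is \<open>1 - n * c \<le> 1 - 2 * c\<close> as
      \<open>n \<ge> 2\<close>, and the error is at most \<open>c / 4\<close>.\<close>
    have bound: "norm (1 + w ^ k * D w) \<le> 1 - 3 / 2 * c" if w: "w \<in> cball (of_real x) (\<rho> * x)" for w
    proof -
      define \<zeta> where "\<zeta> = (w - of_real x) / of_real x"
      have w': "norm (w - of_real x) \<le> \<rho> * x"
        using w by (simp add: dist_norm norm_minus_commute)
      then have \<zeta>: "norm \<zeta> \<le> \<rho>"
        using x by (simp add: \<zeta>_def norm_divide divide_le_eq)
      have "norm w \<le> norm (w - of_real x) + norm (complex_of_real x)"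
        using norm_triangle_ineq[of "w - of_real x" "of_real x"] by simp
      also have "\<dots> \<le> 2 * x"
      proof -
        have "\<rho> * x \<le> x" using \<rho>(2) x by simp
        moreover have "norm (complex_of_real x) = x" using x by simp
        ultimately show ?thesis using w' by linarith
      qed
      finally have "norm w < 2 * (e / 5)" using x \<delta>(3) by simp
      moreover have "dist (\<zeta>, w) (0, 0) \<le> norm \<zeta> + norm w"
        using sqrt_sum_squares_le_sum[of "norm \<zeta>" "norm w"] by (simp add: dist_Pair_Pair)
      ultimately have "dist (\<zeta>, w) (0, 0) < e" using \<zeta> \<rho>(3) e(1) by simp
      then have q: "norm (q (\<zeta>, w) + of_real (n * a)) < a / 4"
        using e(2) by (simp add: dist_norm)
      have "w = of_real x * (1 + \<zeta>)" using x by (simp add: \<zeta>_def field_simps)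
      then have "w ^ k * D w = of_real (x ^ k) * q (\<zeta>, w)"
        by (simp add: q_def power_mult_distrib)
      then have "1 + w ^ k * D w = of_real (1 - n * c) + of_real (x ^ k) * (q (\<zeta>, w) + of_real (n * a))"
        by (simp add: c_def algebra_simps)
      then have "norm (1 + w ^ k * D w) \<le> \<bar>1 - n * c\<bar> + x ^ k * norm (q (\<zeta>, w) + of_real (n * a))"
        using norm_triangle_ineq[of "of_real (1 - n * c)" "of_real (x ^ k) * (q (\<zeta>, w) + of_real (n * a))"] x
        by (simp add: norm_mult norm_power del: of_real_diff)
      also have "\<dots> \<le> (1 - n * c) + x ^ k * (a / 4)"
        using nc q xk by (intro add_mono mult_left_mono) auto
      also have "\<dots> \<le> 1 - 3 / 2 * c"
      proof -
        have "2 * c \<le> n * c" using n c by simp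
        moreover have "x ^ k * (a / 4) = c / 4" by (simp add: c_def)
        ultimately show ?thesis using c by linarith
      qed
      finally show ?thesis .
    qed
    have sub: "cball (of_real x) (\<rho> * x) \<subseteq> ball (0 :: complex) s"
    proof
      fix w :: complex assume "w \<in> cball (of_real x) (\<rho> * x)"
      then have "norm (w - of_real x) \<le> \<rho> * x" by (simp add: dist_norm norm_minus_commute)
      moreover have "norm w \<le> norm (w - of_real x) + norm (complex_of_real x)"
        using norm_triangle_ineq[of "w - of_real x" "of_real x"] by simp
      moreover have "\<rho> * x \<le> x" using \<rho> x by simp
      moreover have "norm (complex_of_real x) = x" using x by simp
      ultimately have "norm w \<le> 2 * x" by linarith
      then show "w \<in> ball 0 s" using x \<delta>(2) by simp
    qed
    have x0: "of_real x \<in> cball (complex_of_real x) (\<rho> * x)" using \<rho> x by simp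
    have "norm (?\<Phi> z - ?\<Phi> (of_real x)) \<le> (1 - 3 / 2 * c) * norm (z - of_real x)"
    proof (rule field_differentiable_bound[OF convex_cball])
      show "(?\<Phi> has_field_derivative 1 + w ^ k * D w) (at w within cball (of_real x) (\<rho> * x))"
        if "w \<in> cball (of_real x) (\<rho> * x)" for w
        using D sub that by (blast intro: has_field_derivative_at_within)
      show "z \<in> cball (of_real x) (\<rho> * x)"
        using z by (simp add: dist_norm norm_minus_commute)
    qed (use bound x0 in auto)
    also have "\<dots> \<le> (1 - 3 / 2 * c) * (\<rho> * x)"
      using order_trans[OF norm_ge_zero bound[OF x0]] z by (intro mult_left_mono)
    also have "\<dots> = \<rho> * (x - x ^ k * (3 / 2 * a) * x)"
      by (simp add: c_def algebra_simps)
    \<comment> \<open>The centre shrinks at most by the factor \<open>1 - 3 / 2 * c\<close>, because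
      \<open>- g x \<le> 3 / 2 * a\<close>; so the image disc still fits.\<close>
    also have "\<dots> \<le> \<rho> * (x + x ^ k * g x * x)"
    proof -
      have "\<bar>g x + a\<bar> < a / 2" using d(2)[of x] x \<delta>(4) by simp
      then have "- g x \<le> 3 / 2 * a" by arith
      then have "x ^ k * (- g x) * x \<le> x ^ k * (3 / 2 * a) * x"
        using xk x by (intro mult_left_mono mult_right_mono) auto
      then show ?thesis using \<rho> by (intro mult_left_mono) auto
    qed
    finally show "norm (?\<Phi> z - of_real (x + x ^ n * g x)) \<le> \<rho> * (x + x ^ n * g x)"
      by (simp add: Gx k mult_ac)
  qed
qed

section \<open>Analyticity and uniqueness on the attracting side\<close>

text \<open>The order \<open>n\<close> of \<open>\<psi> x - x\<close> at 0 separates the contracting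
  case \<open>n = 1\<close> from the parabolic case \<open>n \<ge> 2\<close>; the zero germ
  contradicts \<open>\<psi> x < x\<close>. The majorant required by
  \<open>real_analytic_at_iterated_series\<close> is a geometric series in the first case and the
  values of \<open>h\<close> on the orbit of the centre in the second.\<close>

lemma real_analytic_cohomological_attracting:
  fixes \<psi> f h :: "real \<Rightarrow> real"
  assumes \<psi>: "real_analytic_at \<psi> 0" "\<psi> 0 = 0" and h: "real_analytic_at h 0" "h 0 = 0"
    and dec: "\<forall>\<^sub>F x in at_right 0. 0 < \<psi> x \<and> \<psi> x < x"
    and eq: "\<forall>\<^sub>F x in at_right 0. f (\<psi> x) = f x + h x"
    and f: "isCont f 0" "f 0 = 0"
  shows "\<forall>\<^sub>F x in at_right 0. real_analytic_at f x"
proof -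
  have "\<forall>\<^sub>F x in nhds 0. isCont \<psi> x"
    using real_analytic_at_eventually[OF \<psi>(1)] by eventually_elim (rule real_analytic_at_isCont)
  then have "\<forall>\<^sub>F x in at_right 0. isCont \<psi> x"
    by (simp add: eventually_nhds_conv_at eventually_at_split)
  with dec eq have "\<forall>\<^sub>F x in at_right 0. 0 < \<psi> x \<and> \<psi> x < x \<and> f (\<psi> x) = f x + h x \<and> isCont \<psi> x"
    by eventually_elim simp
  then obtain \<epsilon> where \<epsilon>: "\<epsilon> > 0"
    "\<And>x. 0 < x \<Longrightarrow> x < \<epsilon> \<Longrightarrow> 0 < \<psi> x \<and> \<psi> x < x"
    "\<And>x. 0 < x \<Longrightarrow> x < \<epsilon> \<Longrightarrow> f (\<psi> x) = f x + h x"
    "\<And>x. 0 < x \<Longrightarrow> x < \<epsilon> \<Longrightarrow> isCont \<psi> x"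
    unfolding eventually_at_right_field by auto
  obtain H r C L \<sigma> where H: "r > 0" "H holomorphic_on ball 0 r" "C \<ge> 0" "L \<ge> 0"
    "\<And>x. \<bar>x\<bar> < r \<Longrightarrow> H (of_real x) = of_real (h x)"
    "\<And>x z. 0 < x \<Longrightarrow> x < r \<Longrightarrow> norm z \<le> 2 * x \<Longrightarrow> norm z < r \<Longrightarrow> norm (H z) \<le> C * \<bar>h x\<bar>"
    "\<And>z. norm z < r \<Longrightarrow> norm (H z) \<le> L * norm z"
    "\<And>x. 0 < x \<Longrightarrow> x < r \<Longrightarrow> \<bar>h x\<bar> = \<sigma> * h x"
    using real_analytic_extension_bounds[OF h] by metis
  have "real_analytic_at (\<lambda>x. \<psi> x - x) 0"
    by (intro real_analytic_at_diff \<psi>) simp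
  then show ?thesis
  proof (cases rule: real_analytic_at_0_cases)
    case zero
    then obtain d where "d > 0" "\<And>x. \<bar>x\<bar> < d \<Longrightarrow> \<psi> x = x"
      unfolding eventually_nhds_metric dist_real_def by auto
    moreover from this obtain x where "0 < x" "x < min \<epsilon> d"
      using dense[of 0 "min \<epsilon> d"] \<epsilon>(1) by auto
    ultimately show ?thesis using \<epsilon>(2)[of x] by simp
  next
    case (factor n g)
    obtain d where d: "d > 0" "\<And>x. \<bar>x\<bar> < d \<Longrightarrow> \<psi> x = x + x ^ n * g x"
      using factor(3) unfolding eventually_nhds_metric dist_real_def by (auto simp: algebra_simps)
    obtain G s where G: "s > 0" "G holomorphic_on ball 0 s" "isCont G 0" "G 0 = of_real (g 0)"
      "\<And>x. \<bar>x\<bar> < s \<Longrightarrow> G (of_real x) = of_real (g x)"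
      using real_analytic_at_extend_0[OF factor(1)] by metis
    have n: "n \<noteq> 0"
      using d(2)[of 0] d(1) \<psi>(2) factor(2) by (cases n) auto
    define \<Phi> where "\<Phi> z = z + z ^ n * G z" for z
    \<comment> \<open>The sign of \<open>\<psi> x - x = x ^ n * g x\<close> on the right of 0 passes
      to the limit; with \<open>g 0 \<noteq> 0\<close> it becomes strict.\<close>
    have g0: "g 0 \<le> 0"
    proof (rule tendsto_upperbound)
      show "(g \<longlongrightarrow> g 0) (at_right 0)"
        using real_analytic_at_isCont[OF factor(1)] unfolding isCont_def
        by (rule filterlim_mono) (auto simp: at_le)
      have "g x \<le> 0" if "0 < x" "x < min \<epsilon> d" for x
        using \<epsilon>(2)[of x] d(2)[of x] that by (simp add: mult_less_0_iff)
      then show "\<forall>\<^sub>F x in at_right 0. g x \<le> 0"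
        unfolding eventually_at_right_field using \<epsilon>(1) d(1) by (intro exI[of _ "min \<epsilon> d"]) auto
    qed simp
    show ?thesis
    proof (cases "n = 1")
      case True
      have "g 0 \<ge> -1"
      proof (rule tendsto_lowerbound)
        show "(g \<longlongrightarrow> g 0) (at_right 0)"
          using real_analytic_at_isCont[OF factor(1)] unfolding isCont_def
          by (rule filterlim_mono) (auto simp: at_le)
        have "g x \<ge> -1" if x: "0 < x" "x < min \<epsilon> d" for x
        proof -
          have "0 < x * (1 + g x)"
            using \<epsilon>(2)[of x] d(2)[of x] x True by (simp add: algebra_simps)
          then show ?thesis using x by (simp add: zero_less_mult_iff)
        qed
        then show "\<forall>\<^sub>F x in at_right 0. -1 \<le> g x"
          unfolding eventually_at_right_field using \<epsilon>(1) d(1) by (intro exI[of _ "min \<epsilon> d"]) auto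
      qed simp
      \<comment> \<open>A contraction rate strictly between the multiplier \<open>1 + g 0\<close>,
        which lies in [0, 1), and 1.\<close>
      define \<mu> where "\<mu> = 1 + g 0 / 2"
      have \<mu>: "0 < \<mu>" "\<mu> < 1" "norm (1 + G 0) < \<mu>"
      proof -
        have "1 + G 0 = of_real (1 + g 0)" by (simp add: G(4))
        then have "norm (1 + G 0) = 1 + g 0"
          using \<open>g 0 \<ge> -1\<close> by (simp only: norm_of_real)
        then show "0 < \<mu>" "\<mu> < 1" "norm (1 + G 0) < \<mu>"
          using \<open>g 0 \<ge> -1\<close> g0 factor(2) by (auto simp: \<mu>_def)
      qed
      have "((\<lambda>z. norm (1 + G z)) \<longlongrightarrow> norm (1 + G 0)) (nhds 0)"
        using G(3) by (intro tendsto_intros) (simp add: continuous_within tendsto_at_iff_tendsto_nhds)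
      then have "\<forall>\<^sub>F z in nhds 0. norm (1 + G z) < \<mu>"
        using \<mu>(3) by (rule order_tendstoD)
      then obtain t where t: "t > 0" "\<And>z. norm z < t \<Longrightarrow> norm (1 + G z) < \<mu>"
        unfolding eventually_nhds_metric by auto
      define \<delta> where "\<delta> = Min {\<epsilon>, r, d, s, t}"
      have \<delta>: "\<delta> > 0" "\<delta> \<le> \<epsilon>" "\<delta> \<le> r" "\<delta> \<le> d" "\<delta> \<le> s" "\<delta> \<le> t"
        using \<epsilon>(1) H(1) d(1) G(1) t(1) by (auto simp: \<delta>_def)
      have contr: "norm (\<Phi> z) \<le> \<mu> * norm z" if "norm z < \<delta>" for z
      proof -
        have "\<Phi> z = (1 + G z) * z" by (simp add: \<Phi>_def True algebra_simps)
        then show ?thesis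
          using t(2)[of z] that \<delta>(6) by (simp add: norm_mult mult_right_mono)
      qed
      have iter: "norm ((\<Phi> ^^ i) z) \<le> \<mu> ^ i * norm z" if z: "norm z < \<delta>" for i z
      proof (induction i)
        case (Suc i)
        have "\<mu> ^ i * norm z \<le> norm z"
          using \<mu> by (intro mult_left_le_one_le) (auto intro: power_le_one)
        with Suc have "norm ((\<Phi> ^^ i) z) < \<delta>" using z by simp
        then have "norm (\<Phi> ((\<Phi> ^^ i) z)) \<le> \<mu> * norm ((\<Phi> ^^ i) z)" by (rule contr)
        also have "\<dots> \<le> \<mu> * (\<mu> ^ i * norm z)" using Suc \<mu> by (intro mult_left_mono) auto
        finally show ?case by simp
      qed simp
      have iter': "norm ((\<Phi> ^^ i) z) < \<delta>" if z: "norm z < \<delta>" for i z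
      proof -
        have "\<mu> ^ i * norm z \<le> norm z"
          using \<mu> by (intro mult_left_le_one_le) (auto intro: power_le_one)
        with iter[OF z, of i] z show ?thesis by simp
      qed
      \<comment> \<open>The radius keeps the disc inside \<open>ball 0 \<delta>\<close> and its real
        points positive, so that the series for \<open>f\<close> is available there.\<close>
      have "real_analytic_at f x0" if x0: "0 < x0" "x0 < \<delta>" for x0
      proof (rule real_analytic_at_iterated_series[where A = "ball 0 \<delta>" and \<Phi> = \<Phi> and H = H
            and \<psi> = \<psi> and h = h and r = "min x0 (\<delta> - x0)" and M = "\<lambda>i. L * (\<mu> ^ i * \<delta>)"])
        show "0 < min x0 (\<delta> - x0)" using x0 by simp
        show "\<Phi> holomorphic_on ball 0 \<delta>"
          unfolding \<Phi>_def by (intro holomorphic_intros holomorphic_on_subset[OF G(2)]) (use \<delta> in auto)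
        show "H holomorphic_on ball 0 \<delta>"
          by (rule holomorphic_on_subset[OF H(2)]) (use \<delta> in auto)
        have ball: "norm z < \<delta>" if "z \<in> ball (of_real x0) (min x0 (\<delta> - x0))" for z :: complex
          using that norm_triangle_ineq[of "z - of_real x0" "of_real x0"] x0
          by (simp add: dist_norm norm_minus_commute)
        show "(\<Phi> ^^ i) z \<in> ball 0 \<delta>" if "z \<in> ball (of_real x0) (min x0 (\<delta> - x0))" for i z
          using iter'[OF ball[OF that]] by simp
        show "norm (H ((\<Phi> ^^ i) z)) \<le> L * (\<mu> ^ i * \<delta>)"
          if "z \<in> ball (of_real x0) (min x0 (\<delta> - x0))" for i z
        proof -
          have "norm (H ((\<Phi> ^^ i) z)) \<le> L * norm ((\<Phi> ^^ i) z)"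
            using iter'[OF ball[OF that], of i] \<delta>(3) by (intro H(7)) auto
          also have "\<dots> \<le> L * (\<mu> ^ i * norm z)"
            using iter[OF ball[OF that]] H(4) by (rule mult_left_mono)
          also have "\<dots> \<le> L * (\<mu> ^ i * \<delta>)"
            using ball[OF that] \<mu> H(4) by (intro mult_left_mono) auto
          finally show ?thesis .
        qed
        show "summable (\<lambda>i. L * (\<mu> ^ i * \<delta>))"
          using \<mu> by (intro summable_mult summable_mult2 summable_geometric) auto
        show "\<Phi> (of_real x) = of_real (\<psi> x)" if "of_real x \<in> ball (0 :: complex) \<delta>" for x
          using that d(2)[of x] G(5)[of x] \<delta> by (simp add: \<Phi>_def)
        show "H (of_real x) = of_real (h x)" if "of_real x \<in> ball (0 :: complex) \<delta>" for x
          using that H(5)[of x] \<delta> by simp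
        show "(\<lambda>i. h ((\<psi> ^^ i) x)) sums - f x" if "\<bar>x - x0\<bar> < min x0 (\<delta> - x0)" for x
          using \<epsilon> f that \<delta>(2) by (intro cohomological_equation_sums[where \<delta> = \<epsilon>]) auto
      qed
      then show ?thesis
        unfolding eventually_at_right_field using \<delta>(1) by blast
    next
      case False
      obtain \<rho> t where \<rho>: "0 < \<rho>" "\<rho> \<le> 1" and t: "t > 0" "2 * t \<le> s"
        "\<And>x z. 0 < x \<Longrightarrow> x < t \<Longrightarrow> G (of_real x) = of_real (g x) \<Longrightarrow> norm (z - of_real x) \<le> \<rho> * x \<Longrightarrow>
          norm (z + z ^ n * G z - of_real (x + x ^ n * g x)) \<le> \<rho> * (x + x ^ n * g x)"
      proof -
        have "g 0 < 0" "n \<ge> 2" using g0 factor(2) n False by auto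
        from parabolic_disc[OF G(1-4) real_analytic_at_isCont[OF factor(1)] this] that
        show ?thesis by metis
      qed
      \<comment> \<open>A disc of radius \<open>\<rho> * x \<le> x\<close> about \<open>x\<close>
        reaches up to norm \<open>2 * x\<close>; this is why the extensions are considered on
        \<open>ball 0 (2 * \<delta>)\<close>.\<close>
      define \<delta> where "\<delta> = Min {\<epsilon>, r / 2, d / 2, s, t}"
      have \<delta>: "\<delta> > 0" "\<delta> \<le> \<epsilon>" "2 * \<delta> \<le> r" "2 * \<delta> \<le> d" "\<delta> \<le> s" "\<delta> \<le> t"
        using \<epsilon>(1) H(1) d(1) G(1) t(1) by (auto simp: \<delta>_def min_def)
      have iterx: "0 < (\<psi> ^^ i) x \<and> (\<psi> ^^ i) x \<le> x" if "0 < x" "x < \<delta>" for i x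
        using that \<delta>(2) \<epsilon>(2) by (intro decreasing_iterates[where \<delta> = \<epsilon>]) auto
      \<comment> \<open>Induction along the orbit of the centre: each disc of relative radius
        \<open>\<rho>\<close> is mapped into the next one.\<close>
      have iter: "norm ((\<Phi> ^^ i) z - of_real ((\<psi> ^^ i) x)) \<le> \<rho> * (\<psi> ^^ i) x"
        if x: "0 < x" "x < \<delta>" and z: "norm (z - of_real x) \<le> \<rho> * x" for i x z
      proof (induction i)
        case (Suc i)
        have X: "0 < (\<psi> ^^ i) x" "(\<psi> ^^ i) x < \<delta>" using iterx[OF x, of i] x by auto
        have "\<psi> ((\<psi> ^^ i) x) = (\<psi> ^^ i) x + ((\<psi> ^^ i) x) ^ n * g ((\<psi> ^^ i) x)"
          using d(2) X \<delta>(4) by simp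
        then show ?case
          using t(3)[OF X(1) _ _ Suc] X \<delta> G(5)[of "(\<psi> ^^ i) x"] by (simp add: \<Phi>_def)
      qed (use z in simp)
      have iter': "norm ((\<Phi> ^^ i) z) \<le> 2 * (\<psi> ^^ i) x"
        if x: "0 < x" "x < \<delta>" and z: "norm (z - of_real x) \<le> \<rho> * x" for i x z
      proof -
        have X: "0 < (\<psi> ^^ i) x" using iterx[OF x, of i] by auto
        then have "\<rho> * (\<psi> ^^ i) x \<le> (\<psi> ^^ i) x" using \<rho> by simp
        moreover have "norm ((\<Phi> ^^ i) z) \<le> norm ((\<Phi> ^^ i) z - of_real ((\<psi> ^^ i) x)) + (\<psi> ^^ i) x"
          using norm_triangle_ineq[of "(\<Phi> ^^ i) z - of_real ((\<psi> ^^ i) x)" "of_real ((\<psi> ^^ i) x)"] X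
          by simp
        ultimately show ?thesis
          using iter[OF x z, of i] by linarith
      qed
      \<comment> \<open>The disc about \<open>x0\<close> lies in the first disc of relative radius
        \<open>\<rho>\<close>, so all its points are compared with the single orbit of
        \<open>x0\<close>; this makes the majorant independent of \<open>z\<close>.\<close>
      have "real_analytic_at f x0" if x0: "0 < x0" "x0 < \<delta>" for x0
      proof (rule real_analytic_at_iterated_series[where A = "ball 0 (2 * \<delta>)" and \<Phi> = \<Phi> and H = H
            and \<psi> = \<psi> and h = h and r = "Min {x0, \<rho> * x0, \<delta> - x0}" and M = "\<lambda>i. C * \<bar>h ((\<psi> ^^ i) x0)\<bar>"])
        show "0 < Min {x0, \<rho> * x0, \<delta> - x0}" using x0 \<rho> by simp
        show "\<Phi> holomorphic_on ball 0 (2 * \<delta>)"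
          unfolding \<Phi>_def by (intro holomorphic_intros holomorphic_on_subset[OF G(2)]) (use \<delta> t in auto)
        show "H holomorphic_on ball 0 (2 * \<delta>)"
          by (rule holomorphic_on_subset[OF H(2)]) (use \<delta> in auto)
        have ball: "norm (z - of_real x0) \<le> \<rho> * x0"
          if "z \<in> ball (of_real x0) (Min {x0, \<rho> * x0, \<delta> - x0})" for z :: complex
          using that by (simp add: dist_norm norm_minus_commute)
        have small: "norm ((\<Phi> ^^ i) z) \<le> 2 * (\<psi> ^^ i) x0 \<and> norm ((\<Phi> ^^ i) z) < 2 * \<delta>"
          if "z \<in> ball (of_real x0) (Min {x0, \<rho> * x0, \<delta> - x0})" for i z
          using iter'[OF x0 ball[OF that], of i] iterx[OF x0, of i] x0 by simp
        show "(\<Phi> ^^ i) z \<in> ball 0 (2 * \<delta>)" if "z \<in> ball (of_real x0) (Min {x0, \<rho> * x0, \<delta> - x0})" for i z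
          using small[OF that] by simp
        show "norm (H ((\<Phi> ^^ i) z)) \<le> C * \<bar>h ((\<psi> ^^ i) x0)\<bar>"
          if "z \<in> ball (of_real x0) (Min {x0, \<rho> * x0, \<delta> - x0})" for i z
          using small[OF that, of i] iterx[OF x0, of i] x0 \<delta>(1,3) by (intro H(6)) auto
        \<comment> \<open>In the parabolic case convergence comes from the given solution
          \<open>f\<close>, and becomes absolute by the constant sign of \<open>h\<close>.\<close>
        have "summable (\<lambda>i. h ((\<psi> ^^ i) x0))"
          using cohomological_equation_sums[where \<delta> = \<epsilon> and \<psi> = \<psi> and f = f and h = h and x = x0] \<epsilon> f x0 \<delta>(2)
          by (auto intro: sums_summable)
        then have "summable (\<lambda>i. C * (\<sigma> * h ((\<psi> ^^ i) x0)))"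
          by (intro summable_mult)
        moreover have "\<bar>h ((\<psi> ^^ i) x0)\<bar> = \<sigma> * h ((\<psi> ^^ i) x0)" for i
          using iterx[OF x0, of i] x0 \<delta>(1,3) by (intro H(8)) auto
        ultimately show "summable (\<lambda>i. C * \<bar>h ((\<psi> ^^ i) x0)\<bar>)"
          by simp
        show "\<Phi> (of_real x) = of_real (\<psi> x)" if "of_real x \<in> ball (0 :: complex) (2 * \<delta>)" for x
          using that d(2)[of x] G(5)[of x] \<delta> t(2) by (simp add: \<Phi>_def)
        show "H (of_real x) = of_real (h x)" if "of_real x \<in> ball (0 :: complex) (2 * \<delta>)" for x
          using that H(5)[of x] \<delta> by simp
        show "(\<lambda>i. h ((\<psi> ^^ i) x)) sums - f x" if "\<bar>x - x0\<bar> < Min {x0, \<rho> * x0, \<delta> - x0}" for x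
          using \<epsilon> f that \<delta>(2) by (intro cohomological_equation_sums[where \<delta> = \<epsilon>]) auto
      qed
      then show ?thesis
        unfolding eventually_at_right_field using \<delta>(1) by blast
    qed
  qed
qed

text \<open>The difference of two solutions of the cohomological equation has this property. The
  telescoped series with zero right-hand side has sum \<open>- f x\<close>, so
  \<open>f x = 0\<close>.\<close>

lemma invariant_attracting_zero:
  fixes \<psi> f :: "real \<Rightarrow> real"
  assumes \<psi>: "real_analytic_at \<psi> 0"
    and dec: "\<forall>\<^sub>F x in at_right 0. 0 < \<psi> x \<and> \<psi> x < x"
    and eq: "\<forall>\<^sub>F x in at_right 0. f (\<psi> x) = f x"
    and f: "isCont f 0" "f 0 = 0"
  shows "\<forall>\<^sub>F x in at_right 0. f x = 0"
proof -
  have "\<forall>\<^sub>F x in nhds 0. isCont \<psi> x"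
    using real_analytic_at_eventually[OF \<psi>] by eventually_elim (rule real_analytic_at_isCont)
  then have "\<forall>\<^sub>F x in at_right 0. isCont \<psi> x"
    by (simp add: eventually_nhds_conv_at eventually_at_split)
  with dec eq have "\<forall>\<^sub>F x in at_right 0. 0 < \<psi> x \<and> \<psi> x < x \<and> f (\<psi> x) = f x \<and> isCont \<psi> x"
    by eventually_elim simp
  then obtain \<epsilon> where \<epsilon>: "\<epsilon> > 0"
    "\<And>x. 0 < x \<Longrightarrow> x < \<epsilon> \<Longrightarrow> 0 < \<psi> x \<and> \<psi> x < x"
    "\<And>x. 0 < x \<Longrightarrow> x < \<epsilon> \<Longrightarrow> f (\<psi> x) = f x + 0"
    "\<And>x. 0 < x \<Longrightarrow> x < \<epsilon> \<Longrightarrow> isCont \<psi> x"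
    unfolding eventually_at_right_field by auto
  have "f x = 0" if "0 < x" "x < \<epsilon>" for x
    using cohomological_equation_sums[OF \<epsilon>(2,4,3) f that] sums_unique2[OF _ sums_zero, of "- f x"]
    by simp
  then show ?thesis
    unfolding eventually_at_right_field using \<epsilon>(1) by blast
qed

section \<open>Invariant continuous graphs\<close>

lemma eventually_nhds_0_uminus:
  fixes P :: "real \<Rightarrow> bool"
  assumes "\<forall>\<^sub>F x in nhds 0. P x"
  shows "\<forall>\<^sub>F x in nhds 0. P (- x)"
proof -
  have "filterlim uminus (nhds 0) (nhds (0 :: real))"
    using tendsto_minus[OF filterlim_ident, of "0 :: real"] by simp
  with assms show ?thesis by (simp add: filterlim_iff)
qed

lemma isCont_tendsto_nhds: "isCont f a \<Longrightarrow> (f \<longlongrightarrow> f a) (nhds a)"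
  by (simp add: isCont_def tendsto_at_iff_tendsto_nhds)

lemma eventually_at_right_nhds: "eventually P (nhds (a :: real)) \<Longrightarrow> eventually P (at_right a)"
  by (simp add: eventually_nhds_conv_at eventually_at_split)

lemma increasing_germ_at_right:
  assumes "real_analytic_at \<psi> 0" "\<psi> 0 = 0" "deriv \<psi> 0 > 0"
  shows "\<forall>\<^sub>F x in at_right 0. \<psi> x > 0"
proof -
  obtain d where "d > 0" "\<And>x. 0 < x \<Longrightarrow> x < d \<Longrightarrow> \<psi> 0 < \<psi> (0 + x)"
    using DERIV_pos_inc_right[OF real_analytic_at_DERIV[OF assms(1)] assms(3)] by blast
  then show ?thesis
    unfolding eventually_at_right_field using assms(2) by (intro exI[of _ d]) auto
qed

text \<open>The sign of the leading coefficient \<open>g 0\<close> of \<open>\<psi> x - x\<close>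
  decides; positivity of \<open>\<psi>\<close> comes from its positive derivative.\<close>

lemma germ_right_cases:
  assumes \<psi>: "real_analytic_at \<psi> 0" "\<psi> 0 = 0" "deriv \<psi> 0 > 0"
    and nontriv: "\<not> (\<forall>\<^sub>F x in nhds 0. \<psi> x = x)"
  obtains (attracting) "\<forall>\<^sub>F x in at_right 0. 0 < \<psi> x \<and> \<psi> x < x"
  | (repelling) "\<forall>\<^sub>F x in at_right 0. x < \<psi> x"
proof -
  have "real_analytic_at (\<lambda>x. \<psi> x - x) 0"
    by (intro real_analytic_at_diff \<psi>) simp
  then show ?thesis
  proof (cases rule: real_analytic_at_0_cases)
    case zero
    then show ?thesis using nontriv by simp
  next
    case (factor n g)
    have lim: "(g \<longlongrightarrow> g 0) (nhds 0)"
      using isCont_tendsto_nhds[OF real_analytic_at_isCont[OF factor(1)]] .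
    have pos: "\<forall>\<^sub>F x in at_right 0. (x :: real) > 0"
      by (simp add: eventually_at_right_less)
    show ?thesis
    proof (cases "g 0 < 0")
      case True
      have "\<forall>\<^sub>F x in nhds 0. g x < 0"
        using order_tendstoD(2)[OF lim True] .
      then have "\<forall>\<^sub>F x in at_right 0. g x < 0 \<and> \<psi> x - x = x ^ n * g x"
        using factor(3) by (intro eventually_at_right_nhds eventually_conj)
      then have "\<forall>\<^sub>F x in at_right 0. 0 < \<psi> x \<and> \<psi> x < x"
        using pos increasing_germ_at_right[OF \<psi>]
      proof eventually_elim
        case (elim x)
        then have "x ^ n * g x < 0" by (simp add: mult_pos_neg)
        with elim show ?case by simp
      qed
      then show ?thesis by (rule attracting)
    next
      case False
      then have "g 0 > 0" using factor(2) by simp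
      then have "\<forall>\<^sub>F x in nhds 0. g x > 0"
        using order_tendstoD(1)[OF lim] by blast
      then have "\<forall>\<^sub>F x in at_right 0. g x > 0 \<and> \<psi> x - x = x ^ n * g x"
        using factor(3) by (intro eventually_at_right_nhds eventually_conj)
      then have "\<forall>\<^sub>F x in at_right 0. x < \<psi> x"
        using pos
      proof eventually_elim
        case (elim x)
        then have "\<psi> x - x > 0" by simp
        then show ?case by simp
      qed
      then show ?thesis by (rule repelling)
    qed
  qed
qed

text \<open>A repelling germ is replaced by its inverse, which changes
  \<open>f (\<psi> x) = f x + h x\<close> into \<open>f (\<theta> x) = f x - h (\<theta> x)\<close>.
  The conclusions are stated for every \<open>f\<close>, so that one \<open>\<theta>\<close> serves
  both analyticity and uniqueness.\<close>

lemma attracting_germ_right: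
  assumes \<psi>: "real_analytic_at \<psi> 0" "\<psi> 0 = 0" "deriv \<psi> 0 > 0"
    and nontriv: "\<not> (\<forall>\<^sub>F x in nhds 0. \<psi> x = x)"
  obtains \<theta> where "real_analytic_at \<theta> 0" "\<theta> 0 = 0" "\<forall>\<^sub>F x in at_right 0. 0 < \<theta> x \<and> \<theta> x < x"
    "\<And>f h. real_analytic_at h 0 \<Longrightarrow> h 0 = 0 \<Longrightarrow> \<forall>\<^sub>F x in nhds 0. f (\<psi> x) = f x + h x \<Longrightarrow>
       \<exists>k. real_analytic_at k 0 \<and> k 0 = 0 \<and> (\<forall>\<^sub>F x in nhds 0. f (\<theta> x) = f x + k x)"
    "\<And>f. \<forall>\<^sub>F x in nhds 0. f (\<psi> x) = f x \<Longrightarrow> \<forall>\<^sub>F x in nhds 0. f (\<theta> x) = (f x :: real)"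
  using \<psi> nontriv
proof (cases rule: germ_right_cases)
  case attracting
  show ?thesis
    by (rule that[OF \<psi>(1,2) attracting]) auto
next
  case repelling
  obtain \<theta> where \<theta>: "real_analytic_at \<theta> 0" "\<theta> 0 = 0" "deriv \<theta> 0 = 1 / deriv \<psi> 0"
    "\<forall>\<^sub>F x in nhds 0. \<psi> (\<theta> x) = x"
    using real_analytic_inverse[OF \<psi>(1,2)] \<psi>(3) by (metis less_irrefl)
  have lim: "filterlim \<theta> (nhds 0) (nhds 0)"
    using isCont_tendsto_nhds[OF real_analytic_at_isCont[OF \<theta>(1)]] \<theta>(2) by simp
  have pos: "\<forall>\<^sub>F x in at_right 0. \<theta> x > 0"
    using \<theta> \<psi>(3) by (intro increasing_germ_at_right) auto
  have "(\<theta> \<longlongrightarrow> 0) (at_right 0)"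
    using lim by (rule filterlim_mono) (auto simp: at_within_def)
  \<comment> \<open>The inequality \<open>x < \<psi> x\<close> is known only for positive
    \<open>x\<close>, so \<open>\<theta>\<close> must approach 0 from the right before it can be
    substituted.\<close>
  then have "filterlim \<theta> (at_right 0) (at_right 0)"
    using pos by (auto simp: filterlim_at elim: eventually_mono)
  then have "\<forall>\<^sub>F x in at_right 0. \<theta> x < \<psi> (\<theta> x)"
    by (rule eventually_compose_filterlim[OF repelling])
  then have dec: "\<forall>\<^sub>F x in at_right 0. 0 < \<theta> x \<and> \<theta> x < x"
    using pos eventually_at_right_nhds[OF \<theta>(4)] by eventually_elim simp
  have eq: "\<forall>\<^sub>F x in nhds 0. f (\<theta> x) = f x + - h (\<theta> x)"
    if "\<forall>\<^sub>F x in nhds 0. f (\<psi> x) = f x + h x" for f h :: "real \<Rightarrow> real"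
  proof -
    have "\<forall>\<^sub>F x in nhds 0. f (\<psi> (\<theta> x)) = f (\<theta> x) + h (\<theta> x)"
      using that lim by (rule eventually_compose_filterlim)
    with \<theta>(4) show ?thesis by eventually_elim simp
  qed
  show ?thesis
  proof (rule that[OF \<theta>(1,2) dec])
    fix f h :: "real \<Rightarrow> real"
    assume h: "real_analytic_at h 0" "h 0 = 0" and "\<forall>\<^sub>F x in nhds 0. f (\<psi> x) = f x + h x"
    then have "\<forall>\<^sub>F x in nhds 0. f (\<theta> x) = f x + - h (\<theta> x)" by (intro eq)
    moreover have "real_analytic_at (\<lambda>x. - h (\<theta> x)) 0" "- h (\<theta> 0) = 0"
      using h \<theta>(1,2) by (auto intro!: real_analytic_at_uminus real_analytic_at_compose[of \<theta>])
    ultimately show "\<exists>k. real_analytic_at k 0 \<and> k 0 = 0 \<and> (\<forall>\<^sub>F x in nhds 0. f (\<theta> x) = f x + k x)"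
      by (intro exI[of _ "\<lambda>x. - h (\<theta> x)"]) auto
  next
    fix f :: "real \<Rightarrow> real" assume "\<forall>\<^sub>F x in nhds 0. f (\<psi> x) = f x"
    then show "\<forall>\<^sub>F x in nhds 0. f (\<theta> x) = f x"
      using eq[of f "\<lambda>x. 0"] by simp
  qed
qed

section \<open>From the right of 0 to both sides\<close>

text \<open>Conjugation by \<open>x \<mapsto> - x\<close> exchanges the sides of 0 and keeps the
  multiplier, so the statements on the left follow from those on the right.\<close>

lemma reflected_germ:
  assumes "real_analytic_at \<psi> 0" "\<psi> 0 = 0"
  shows "real_analytic_at (\<lambda>x. - \<psi> (- x)) 0" "deriv (\<lambda>x. - \<psi> (- x)) 0 = deriv \<psi> 0"
proof -
  have m: "real_analytic_at (\<lambda>x. - x) 0"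
    by (intro real_analytic_at_uminus real_analytic_at_ident)
  show "real_analytic_at (\<lambda>x. - \<psi> (- x)) 0"
    using assms by (intro real_analytic_at_uminus real_analytic_at_compose[OF m]) simp
  have "((\<lambda>x. - \<psi> (- x)) has_real_derivative - (deriv \<psi> 0 * - 1)) (at 0)"
    using real_analytic_at_DERIV[OF assms(1)]
    by (intro DERIV_minus DERIV_chain2[of \<psi>]) (auto intro!: derivative_eq_intros)
  then show "deriv (\<lambda>x. - \<psi> (- x)) 0 = deriv \<psi> 0"
    by (simp add: DERIV_imp_deriv)
qed

lemma reflected_germ_nontrivial:
  assumes "\<not> (\<forall>\<^sub>F x in nhds 0. \<psi> x = (x :: real))"
  shows "\<not> (\<forall>\<^sub>F x in nhds 0. - \<psi> (- x) = x)"
proof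
  assume "\<forall>\<^sub>F x in nhds 0. - \<psi> (- x) = x"
  from eventually_nhds_0_uminus[OF this] have "\<forall>\<^sub>F x in nhds 0. \<psi> x = x"
    by eventually_elim simp
  with assms show False by simp
qed

lemma isCont_0_reflect: "isCont f 0 \<Longrightarrow> isCont (\<lambda>x :: real. f (- x)) 0"
  by (rule isCont_o2[where f = uminus and g = f]) auto

lemma real_analytic_cohomological_right:
  fixes \<psi> f h :: "real \<Rightarrow> real"
  assumes "real_analytic_at \<psi> 0" "\<psi> 0 = 0" "deriv \<psi> 0 > 0" "\<not> (\<forall>\<^sub>F x in nhds 0. \<psi> x = x)"
    and "real_analytic_at h 0" "h 0 = 0" "\<forall>\<^sub>F x in nhds 0. f (\<psi> x) = f x + h x"
    and "isCont f 0" "f 0 = 0"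
  shows "\<forall>\<^sub>F x in at_right 0. real_analytic_at f x"
  using assms(1-4)
proof (cases rule: attracting_germ_right)
  case (1 \<theta>)
  then obtain k where "real_analytic_at k 0" "k 0 = 0" "\<forall>\<^sub>F x in nhds 0. f (\<theta> x) = f x + k x"
    using 1(4)[OF assms(5,6,7)] by blast
  then show ?thesis
    using 1(1-3) assms(8,9)
    by (intro real_analytic_cohomological_attracting[of \<theta> k f] eventually_at_right_nhds[of "\<lambda>x. f (\<theta> x) = f x + k x"])
qed

lemma real_analytic_cohomological:
  fixes \<psi> f h :: "real \<Rightarrow> real"
  assumes \<psi>: "real_analytic_at \<psi> 0" "\<psi> 0 = 0" "deriv \<psi> 0 > 0" "\<not> (\<forall>\<^sub>F x in nhds 0. \<psi> x = x)"
    and h: "real_analytic_at h 0" "h 0 = 0" and eq: "\<forall>\<^sub>F x in nhds 0. f (\<psi> x) = f x + h x"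
    and f: "isCont f 0" "f 0 = 0"
  shows "\<forall>\<^sub>F x in at 0. real_analytic_at f x"
proof -
  have m: "real_analytic_at (\<lambda>x. - x) x" for x
    by (intro real_analytic_at_uminus real_analytic_at_ident)
  have "\<forall>\<^sub>F x in at_right 0. real_analytic_at (\<lambda>x. f (- x)) x"
  proof (rule real_analytic_cohomological_right)
    show "real_analytic_at (\<lambda>x. - \<psi> (- x)) 0" "deriv (\<lambda>x. - \<psi> (- x)) 0 > 0"
      "\<not> (\<forall>\<^sub>F x in nhds 0. - \<psi> (- x) = x)"
      using reflected_germ[OF \<psi>(1,2)] reflected_germ_nontrivial[OF \<psi>(4)] \<psi>(3) by auto
    show "real_analytic_at (\<lambda>x. h (- x)) 0"
      using h by (intro real_analytic_at_compose[OF m]) simp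
    show "\<forall>\<^sub>F x in nhds 0. f (- (- \<psi> (- x))) = f (- x) + h (- x)"
      using eventually_nhds_0_uminus[OF eq] by simp
  qed (use \<psi> h f isCont_0_reflect in auto)
  then have "\<forall>\<^sub>F x in at_right 0. real_analytic_at f (- x)"
  proof eventually_elim
    case (elim x)
    then show ?case
      using real_analytic_at_compose[OF m[of "- x"], of "\<lambda>x. f (- x)"] by simp
  qed
  then have "\<forall>\<^sub>F x in at_left 0. real_analytic_at f x"
    by (subst eventually_at_left_to_right) simp
  with real_analytic_cohomological_right[OF assms] show ?thesis
    by (simp add: eventually_at_split)
qed

lemma invariant_continuous_germ_zero_right:
  fixes \<psi> f :: "real \<Rightarrow> real"
  assumes "real_analytic_at \<psi> 0" "\<psi> 0 = 0" "deriv \<psi> 0 > 0" "\<not> (\<forall>\<^sub>F x in nhds 0. \<psi> x = x)"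
    and "\<forall>\<^sub>F x in nhds 0. f (\<psi> x) = f x" and "isCont f 0" "f 0 = 0"
  shows "\<forall>\<^sub>F x in at_right 0. f x = 0"
  using assms(1-4)
proof (cases rule: attracting_germ_right)
  case (1 \<theta>)
  then show ?thesis
    using 1(5)[OF assms(5)] assms(6,7)
    by (intro invariant_attracting_zero[of \<theta> f] eventually_at_right_nhds[of "\<lambda>x. f (\<theta> x) = f x"])
qed

lemma invariant_continuous_germ_zero:
  fixes \<psi> f :: "real \<Rightarrow> real"
  assumes \<psi>: "real_analytic_at \<psi> 0" "\<psi> 0 = 0" "deriv \<psi> 0 > 0" "\<not> (\<forall>\<^sub>F x in nhds 0. \<psi> x = x)"
    and eq: "\<forall>\<^sub>F x in nhds 0. f (\<psi> x) = f x" and f: "isCont f 0" "f 0 = 0"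
  shows "\<forall>\<^sub>F x in nhds 0. f x = 0"
proof -
  have "\<forall>\<^sub>F x in at_right 0. f (- x) = 0"
  proof (rule invariant_continuous_germ_zero_right)
    show "real_analytic_at (\<lambda>x. - \<psi> (- x)) 0" "deriv (\<lambda>x. - \<psi> (- x)) 0 > 0"
      "\<not> (\<forall>\<^sub>F x in nhds 0. - \<psi> (- x) = x)"
      using reflected_germ[OF \<psi>(1,2)] reflected_germ_nontrivial[OF \<psi>(4)] \<psi>(3) by auto
    show "\<forall>\<^sub>F x in nhds 0. f (- (- \<psi> (- x))) = f (- x)"
      using eventually_nhds_0_uminus[OF eq] by simp
  qed (use \<psi> f isCont_0_reflect in auto)
  then have "\<forall>\<^sub>F x in at_left 0. f x = 0"
    by (subst eventually_at_left_to_right) simp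
  with invariant_continuous_germ_zero_right[OF assms] f(2) show ?thesis
    by (simp add: eventually_at_split eventually_nhds_conv_at)
qed

section \<open>Invariant graphs of a shear and of its square\<close>

text \<open>The functional equation says that the image \<open>(\<phi> x, f x + h x)\<close> of a
  point of the graph lies on the graph. Continuity is asked only at 0, the limit of the
  orbits.\<close>

definition shear_invariant :: "(real \<Rightarrow> real) \<Rightarrow> (real \<Rightarrow> real) \<Rightarrow> (real \<Rightarrow> real) \<Rightarrow> bool" where
  "shear_invariant \<phi> h f \<longleftrightarrow> isCont f 0 \<and> f 0 = 0 \<and> (\<forall>\<^sub>F x in nhds 0. f (\<phi> x) = f x + h x)"

text \<open>The square has the multiplier \<open>(deriv \<phi> 0)\<^sup>2 > 0\<close> and leaves the
  same graph invariant. If \<open>\<psi>\<close> were the identity near 0, the equation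
  \<open>f (\<psi> x) = f x + k x\<close> would force \<open>k = 0\<close> and the shear would be an
  involution.\<close>

lemma shear_squared:
  assumes sd: "shear_data \<phi> h"
    and noninv: "\<not> (\<forall>\<^sub>F p in nhds 0. shear \<phi> h (shear \<phi> h p) = p)"
    and inv: "shear_invariant \<phi> h f"
  defines "\<psi> \<equiv> \<lambda>x. \<phi> (\<phi> x)" and "k \<equiv> \<lambda>x. h x + h (\<phi> x)"
  shows "real_analytic_at \<psi> 0" "\<psi> 0 = 0" "deriv \<psi> 0 > 0" "\<not> (\<forall>\<^sub>F x in nhds 0. \<psi> x = x)"
    "real_analytic_at k 0" "k 0 = 0" "\<forall>\<^sub>F x in nhds 0. f (\<psi> x) = f x + k x"
proof -
  have \<phi>: "real_analytic_at \<phi> 0" "\<phi> 0 = 0" "deriv \<phi> 0 \<noteq> 0"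
    using sd by (auto simp: shear_data_def analytic_diffeo1_def)
  have sd2: "shear_data \<psi> k"
    using shear_data_comp[OF sd sd] by (simp add: \<psi>_def k_def)
  then show "real_analytic_at \<psi> 0" "\<psi> 0 = 0" "real_analytic_at k 0" "k 0 = 0"
    by (auto simp: shear_data_def analytic_diffeo1_def)
  have "deriv \<psi> 0 = (deriv \<phi> 0)\<^sup>2"
    unfolding \<psi>_def using deriv_comp_0[OF \<phi>(1,1,2)] by (simp add: power2_eq_square)
  then show "deriv \<psi> 0 > 0" using \<phi>(3) by simp
  have lim: "filterlim \<phi> (nhds 0) (nhds 0)"
    using isCont_tendsto_nhds[OF real_analytic_at_isCont[OF \<phi>(1)]] \<phi>(2) by simp
  have inv': "\<forall>\<^sub>F x in nhds 0. f (\<phi> x) = f x + h x"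
    using inv by (simp add: shear_invariant_def)
  then have "\<forall>\<^sub>F x in nhds 0. f (\<phi> (\<phi> x)) = f (\<phi> x) + h (\<phi> x)"
    by (rule eventually_compose_filterlim[OF _ lim])
  with inv' show eq: "\<forall>\<^sub>F x in nhds 0. f (\<psi> x) = f x + k x"
    unfolding \<psi>_def k_def by eventually_elim simp
  show "\<not> (\<forall>\<^sub>F x in nhds 0. \<psi> x = x)"
  proof
    assume "\<forall>\<^sub>F x in nhds 0. \<psi> x = x"
    with eq have "\<forall>\<^sub>F x in nhds 0. \<psi> x = x \<and> k x = 0"
      by eventually_elim simp
    then have "\<forall>\<^sub>F p in nhds (0 :: real \<times> real). \<psi> (fst p) = fst p \<and> k (fst p) = 0"
      by (rule eventually_compose_filterlim[OF _ fst_tendsto_0])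
    then have "\<forall>\<^sub>F p in nhds 0. shear \<phi> h (shear \<phi> h p) = p"
      by eventually_elim (auto simp: shear_def \<psi>_def k_def split: prod.splits)
    with noninv show False by simp
  qed
qed

lemma shear_invariant_real_analytic:
  assumes "shear_data \<phi> h" "\<not> (\<forall>\<^sub>F p in nhds 0. shear \<phi> h (shear \<phi> h p) = p)"
    and inv: "shear_invariant \<phi> h f"
  shows "\<forall>\<^sub>F x in at 0. real_analytic_at f x"
  using real_analytic_cohomological[OF shear_squared[OF assms]] inv
  by (simp add: shear_invariant_def)

text \<open>In the difference of two solutions the term \<open>k\<close> cancels, leaving a
  continuous function that is invariant under the non-trivial germ
  \<open>\<phi> \<circ> \<phi>\<close> and vanishes at 0.\<close>

lemma shear_invariant_unique:
  assumes "shear_data \<phi> h" "\<not> (\<forall>\<^sub>F p in nhds 0. shear \<phi> h (shear \<phi> h p) = p)"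
    and f: "shear_invariant \<phi> h f" and g: "shear_invariant \<phi> h g"
  shows "\<forall>\<^sub>F x in nhds 0. f x = g x"
proof -
  have "\<forall>\<^sub>F x in nhds 0. f x - g x = 0"
  proof (rule invariant_continuous_germ_zero[OF shear_squared(1-4)[OF assms(1-3)]])
    show "\<forall>\<^sub>F x in nhds 0. f (\<phi> (\<phi> x)) - g (\<phi> (\<phi> x)) = f x - g x"
      using shear_squared(7)[OF assms(1-3)] shear_squared(7)[OF assms(1,2) g]
      by eventually_elim simp
  qed (use f g in \<open>auto simp: shear_invariant_def intro!: continuous_intros\<close>)
  then show ?thesis by eventually_elim simp
qed

section \<open>Invariant graphs with vertical tangent\<close>

text \<open>With \<open>x' = x * (1 + t)\<close> and \<open>\<bar>t\<bar> \<le> 1 / 2\<close> one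
  has \<open>\<bar>ln (1 + t)\<bar> \<le> \<bar>t\<bar> + 2 * t\<^sup>2 \<le> 2 *
  \<bar>t\<bar>\<close>.\<close>

lemma abs_ln_ratio_le:
  fixes x x' :: real
  assumes "x \<noteq> 0" "\<bar>x' - x\<bar> \<le> c * \<bar>x\<bar>" "0 \<le> c" "c \<le> 1 / 2"
  shows "x' \<noteq> 0" "sgn x' = sgn x" "\<bar>ln \<bar>x'\<bar> - ln \<bar>x\<bar>\<bar> \<le> 2 * c"
proof -
  define t where "t = (x' - x) / x"
  have t: "\<bar>t\<bar> \<le> c" using assms(1,2) by (simp add: t_def divide_le_eq)
  have x': "x' = x * (1 + t)" using assms(1) by (simp add: t_def field_simps)
  have pos: "1 + t > 0" using t assms(4) by (simp add: abs_le_iff)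
  show "x' \<noteq> 0" "sgn x' = sgn x" using assms(1) pos by (simp_all add: x' sgn_mult)
  have "ln \<bar>x'\<bar> - ln \<bar>x\<bar> = ln (1 + t)"
    using assms(1) pos by (simp add: x' abs_mult ln_mult)
  moreover have "\<bar>ln (1 + t) - t\<bar> \<le> 2 * t\<^sup>2"
    using t assms(4) by (intro abs_ln_one_plus_x_minus_x_bound) simp
  moreover have "2 * t\<^sup>2 \<le> \<bar>t\<bar>"
    using mult_right_mono[of "2 * \<bar>t\<bar>" 1 "\<bar>t\<bar>"] t assms(4)
    by (simp add: power2_eq_square abs_mult_self_eq flip: abs_mult)
  ultimately show "\<bar>ln \<bar>x'\<bar> - ln \<bar>x\<bar>\<bar> \<le> 2 * c" using t by arith
qed

text \<open>Otherwise an orbit on the curve \<open>x = u y\<close> starts at a very small height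
  with \<open>x \<noteq> 0\<close>. The variation of \<open>ln \<bar>x\<bar>\<close> is at most
  \<open>2 * K\<close> times that of the height, so \<open>\<bar>x\<bar>\<close> stays comparable to
  its initial value below the height \<open>y1\<close>. An orbit staying below \<open>y1\<close>
  would converge to a point of the curve with \<open>x = 0\<close>, and one that leaves would make
  \<open>u y1\<close> too small.\<close>

lemma vertical_graph_zero_right:
  fixes u \<phi> h \<sigma> :: "real \<Rightarrow> real"
  assumes pos: "\<delta> > 0" "K \<ge> 0" "C \<ge> 0"
    and pK: "\<And>x. \<bar>x\<bar> < \<delta> \<Longrightarrow> \<bar>\<phi> x - x\<bar> \<le> K * \<bar>h x\<bar> * \<bar>x\<bar>"
    and hC: "\<And>x. \<bar>x\<bar> < \<delta> \<Longrightarrow> \<bar>h x\<bar> \<le> C * \<bar>x\<bar>"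
    and hK: "\<And>x. \<bar>x\<bar> < \<delta> \<Longrightarrow> K * \<bar>h x\<bar> \<le> 1 / 2"
    and hcont: "\<And>x. \<bar>x\<bar> < \<delta> \<Longrightarrow> isCont h x"
    and hnz: "\<And>x. \<bar>x\<bar> < \<delta> \<Longrightarrow> x \<noteq> 0 \<Longrightarrow> h x \<noteq> 0"
    and h\<sigma>: "\<And>x. \<bar>x\<bar> < \<delta> \<Longrightarrow> x \<noteq> 0 \<Longrightarrow> \<bar>h x\<bar> = \<sigma> (sgn x) * h x"
    and u0: "u 0 = 0"
    and lip: "\<And>y y'. \<bar>y\<bar> < \<delta> \<Longrightarrow> \<bar>y'\<bar> < \<delta> \<Longrightarrow> \<bar>u y - u y'\<bar> \<le> \<bar>y - y'\<bar>"
    and hu: "\<And>y. \<bar>y\<bar> < \<delta> \<Longrightarrow> \<bar>h (u y)\<bar> \<le> \<bar>y\<bar> / 2"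
    and inv: "\<And>y. \<bar>y\<bar> < \<delta> \<Longrightarrow> u (y + h (u y)) = \<phi> (u y)"
  shows "\<exists>\<eta>>0. \<forall>y. 0 < y \<and> y < \<eta> \<longrightarrow> u y = 0"
proof (rule ccontr)
  assume "\<not> ?thesis"
  then have nz: "\<exists>y. 0 < y \<and> y < \<eta> \<and> u y \<noteq> 0" if "\<eta> > 0" for \<eta>
    using that by blast
  have uy: "\<bar>u y\<bar> \<le> \<bar>y\<bar>" if "\<bar>y\<bar> < \<delta>" for y
    using lip[of y 0] that pos(1) u0 by simp
  have ucont: "isCont u y" if "\<bar>y\<bar> < \<delta>" for y
    unfolding continuous_at_eps_delta
  proof (intro allI impI)
    fix e :: real assume e: "e > 0"
    have "dist (u z) (u y) < e" if "dist z y < min e (\<delta> - \<bar>y\<bar>)" for z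
    proof -
      have "\<bar>z\<bar> < \<delta>" "\<bar>z - y\<bar> < e" using that unfolding dist_real_def by arith+
      then show ?thesis using lip[of z y] \<open>\<bar>y\<bar> < \<delta>\<close> unfolding dist_real_def by simp
    qed
    then show "\<exists>d>0. \<forall>z. dist z y < d \<longrightarrow> dist (u z) (u y) < e"
      using e \<open>\<bar>y\<bar> < \<delta>\<close> by (intro exI[of _ "min e (\<delta> - \<bar>y\<bar>)"]) auto
  qed
  obtain y1 where y1: "0 < y1" "y1 < \<delta> / 2" "u y1 \<noteq> 0"
    using nz[of "\<delta> / 2"] pos(1) by auto
  \<comment> \<open>The largest factor by which \<open>\<bar>x\<bar>\<close> can change while the
    height stays between 0 and \<open>y1\<close>. The choice of \<open>y0\<close> below makes
    \<open>(1 + C) * c * y0 < \<bar>u y1\<bar>\<close>, the final contradiction.\<close>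
  define c where "c = exp (2 * K * \<delta>)"
  have c: "c > 0" by (simp add: c_def)
  obtain y0 where y0: "0 < y0" "y0 < min y1 (\<bar>u y1\<bar> / ((1 + C) * c))" "u y0 \<noteq> 0"
    using nz[of "min y1 (\<bar>u y1\<bar> / ((1 + C) * c))"] y1 c pos(3) by auto
  \<comment> \<open>\<open>Y\<close> lists the heights of the orbit and \<open>X\<close> the
    abscissas; by invariance of the curve \<open>X (Suc n) = \<phi> (X n)\<close> while the heights
    are small.\<close>
  define Y where "Y n = ((\<lambda>y. y + h (u y)) ^^ n) y0" for n
  define X where "X n = u (Y n)" for n
  have Y0: "Y 0 = y0" and YS: "Y (Suc n) = Y n + h (X n)" for n
    by (simp_all add: Y_def X_def)
  \<comment> \<open>The new height stays positive because \<open>hu\<close> bounds the increment by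
    half of the old height.\<close>
  have step: "u (y + h (u y)) \<noteq> 0 \<and> sgn (u (y + h (u y))) = sgn (u y) \<and>
      \<bar>ln \<bar>u (y + h (u y))\<bar> - ln \<bar>u y\<bar>\<bar> \<le> 2 * K * \<bar>h (u y)\<bar> \<and> 0 < y + h (u y)"
    if y: "0 < y" "y < \<delta>" "u y \<noteq> 0" for y
  proof -
    have "\<bar>u y\<bar> < \<delta>" using uy[of y] y by simp
    then show ?thesis
      using abs_ln_ratio_le[OF y(3), of "\<phi> (u y)" "K * \<bar>h (u y)\<bar>"] pK[of "u y"] hK[of "u y"]
        inv[of y] hu[of y] y pos(2) by (auto simp: abs_le_iff)
  qed
  define s where "s = \<sigma> (sgn (X 0))"
  have X0: "X 0 \<noteq> 0" "\<bar>X 0\<bar> \<le> y0" "\<bar>X 0\<bar> < \<delta>"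
    using y0 y1 uy[of y0] by (auto simp: X_def Y0)
  \<comment> \<open>The function \<open>\<sigma>\<close> is not assumed to take the values 1 and -1;
    here this follows from \<open>h (X 0) \<noteq> 0\<close>.\<close>
  have s: "s = 1 \<or> s = -1"
  proof -
    have "s * h (X 0) = 1 * h (X 0) \<or> s * h (X 0) = - 1 * h (X 0)"
      using h\<sigma>[OF X0(3,1)] unfolding s_def by (auto simp: abs_if split: if_splits)
    then show ?thesis using hnz[OF X0(3,1)] mult_right_cancel by blast
  qed
  \<comment> \<open>The abscissas keep their side of 0, where \<open>h\<close> has the constant sign
    \<open>s\<close>; hence the sizes of the increments of \<open>Y\<close> add up to
    \<open>s * (Y n - Y 0)\<close>. Only the heights before index \<open>n\<close> have to be below
    \<open>y1\<close>.\<close>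
  have orbit: "X n \<noteq> 0 \<and> sgn (X n) = sgn (X 0) \<and> \<bar>ln \<bar>X n\<bar> - ln \<bar>X 0\<bar>\<bar> \<le> 2 * K * (s * (Y n - Y 0)) \<and> 0 < Y n"
    if "\<And>j. j < n \<Longrightarrow> Y j < y1" for n
    using that
  proof (induction n)
    case 0
    then show ?case using X0 y0 by (simp add: Y0)
  next
    case (Suc n)
    then have IH: "X n \<noteq> 0" "sgn (X n) = sgn (X 0)"
      "\<bar>ln \<bar>X n\<bar> - ln \<bar>X 0\<bar>\<bar> \<le> 2 * K * (s * (Y n - Y 0))" "0 < Y n" by auto
    have Yn: "Y n < y1" using Suc.prems by simp
    have st: "X (Suc n) \<noteq> 0" "sgn (X (Suc n)) = sgn (X n)"
      "\<bar>ln \<bar>X (Suc n)\<bar> - ln \<bar>X n\<bar>\<bar> \<le> 2 * K * \<bar>h (X n)\<bar>" "0 < Y (Suc n)"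
      using step[of "Y n"] IH Yn y1 by (auto simp: X_def YS)
    have "\<bar>X n\<bar> < \<delta>" using uy[of "Y n"] IH(4) Yn y1 by (simp add: X_def)
    then have "\<bar>h (X n)\<bar> = s * (Y (Suc n) - Y n)"
      using h\<sigma>[of "X n"] IH(1,2) by (simp add: s_def YS)
    then have "2 * K * (s * (Y (Suc n) - Y 0)) = 2 * K * (s * (Y n - Y 0)) + 2 * K * \<bar>h (X n)\<bar>"
      by (simp only:) (simp add: algebra_simps)
    moreover have "\<bar>ln \<bar>X (Suc n)\<bar> - ln \<bar>X 0\<bar>\<bar> \<le>
        \<bar>ln \<bar>X (Suc n)\<bar> - ln \<bar>X n\<bar>\<bar> + \<bar>ln \<bar>X n\<bar> - ln \<bar>X 0\<bar>\<bar>"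
      by arith
    ultimately show ?case using st IH by simp
  qed
  have range: "\<bar>X 0\<bar> / c \<le> \<bar>X n\<bar> \<and> \<bar>X n\<bar> \<le> c * \<bar>X 0\<bar>"
    if "\<And>j. j \<le> n \<Longrightarrow> Y j < y1" for n
  proof -
    have o: "X n \<noteq> 0" "\<bar>ln \<bar>X n\<bar> - ln \<bar>X 0\<bar>\<bar> \<le> 2 * K * (s * (Y n - Y 0))" "0 < Y n"
      using orbit[of n] that by auto
    have "Y n < y1" using that by simp
    then have "s * (Y n - Y 0) \<le> \<delta>" using s o(3) y0 y1 Y0 by auto
    then have "2 * K * (s * (Y n - Y 0)) \<le> 2 * K * \<delta>" using pos(2) by (intro mult_left_mono) auto
    then have "\<bar>ln \<bar>X n\<bar> - ln \<bar>X 0\<bar>\<bar> \<le> ln c" using o(2) by (simp add: c_def)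
    then have "ln \<bar>X 0\<bar> - ln c \<le> ln \<bar>X n\<bar>" "ln \<bar>X n\<bar> \<le> ln c + ln \<bar>X 0\<bar>" by arith+
    then have "ln (\<bar>X 0\<bar> / c) \<le> ln \<bar>X n\<bar>" "ln \<bar>X n\<bar> \<le> ln (c * \<bar>X 0\<bar>)"
      using c X0 by (simp_all add: ln_div ln_mult)
    then show ?thesis using c X0 o(1) by simp
  qed
  show False
  proof (cases "\<forall>n. Y n < y1")
    case True
    have Ypos: "0 < Y n" for n using orbit True by blast
    have XX: "\<bar>X n\<bar> < \<delta>" for n
      using uy[of "Y n"] Ypos[of n] True[rule_format, of n] y1(1,2) by (simp add: X_def)
    have inc: "s * Y n \<le> s * Y (Suc n)" for n
    proof -
      have "\<bar>h (X n)\<bar> = s * h (X n)"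
        using h\<sigma>[OF XX[of n]] orbit[of n] True by (simp add: s_def)
      then show ?thesis by (simp add: YS algebra_simps)
    qed
    \<comment> \<open>The heights are monotone and bounded, so they converge. At the limit
      \<open>h (u y) = 0\<close>, hence \<open>u y = 0\<close>, against the lower bound of
      \<open>\<bar>X n\<bar>\<close>.\<close>
    have "incseq (\<lambda>n. s * Y n)" using inc by (rule incseq_SucI)
    moreover have "\<forall>n. s * Y n \<le> y1"
    proof
      fix n show "s * Y n \<le> y1"
        using s Ypos[of n] True[rule_format, of n] y1(1) by auto
    qed
    ultimately obtain l where l: "(\<lambda>n. s * Y n) \<longlonglongrightarrow> l"
      by (rule incseq_convergent)
    have "(\<lambda>n. s * (s * Y n)) \<longlonglongrightarrow> s * l"
      using l by (intro tendsto_intros)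
    moreover have "s * (s * y) = y" for y using s by auto
    ultimately have Yl: "Y \<longlonglongrightarrow> s * l" by simp
    have l': "0 \<le> s * l" "s * l \<le> y1"
      using LIMSEQ_le_const[OF Yl] LIMSEQ_le_const2[OF Yl] Ypos True less_imp_le by blast+
    then have sl: "\<bar>s * l\<bar> < \<delta>" using y1 by simp
    have Xl: "X \<longlonglongrightarrow> u (s * l)"
      unfolding X_def using isCont_tendsto_compose[OF ucont[OF sl] Yl] .
    have ul: "\<bar>u (s * l)\<bar> < \<delta>" using uy[OF sl] sl by simp
    have "(\<lambda>n. h (X n)) \<longlonglongrightarrow> h (u (s * l))"
      using isCont_tendsto_compose[OF hcont[OF ul] Xl] .
    moreover have "(\<lambda>n. Y (Suc n) - Y n) \<longlonglongrightarrow> s * l - s * l"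
      using Yl by (intro tendsto_diff LIMSEQ_Suc)
    ultimately have "h (u (s * l)) = 0"
      using LIMSEQ_unique by (fastforce simp: YS)
    then have "u (s * l) = 0" using hnz[OF ul] by blast
    moreover have "\<bar>X 0\<bar> / c \<le> \<bar>u (s * l)\<bar>"
      using LIMSEQ_le_const[OF tendsto_rabs[OF Xl]] range True by blast
    ultimately show False using X0(1) c by (simp add: divide_le_0_iff)
  next
    case False
    \<comment> \<open>The first height that is not below \<open>y1\<close>. The point just before it
      is within \<open>\<bar>h (X m)\<bar> \<le> C * \<bar>X m\<bar>\<close> of the height
      \<open>y1\<close>, and the Lipschitz bound carries the smallness of \<open>X m\<close> over to
      \<open>u y1\<close>.\<close>
    define n where "n = (LEAST n. \<not> Y n < y1)"
    have n: "\<not> Y n < y1" "\<And>j. j < n \<Longrightarrow> Y j < y1"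
      using False LeastI_ex[of "\<lambda>n. \<not> Y n < y1"] not_less_Least[of _ "\<lambda>n. \<not> Y n < y1"]
      unfolding n_def by blast+
    have "n \<noteq> 0" using n(1) y0 Y0 by (cases n) auto
    then obtain m where m: "n = Suc m" using not0_implies_Suc by blast
    have Ym: "0 < Y m" "Y m < y1" using orbit[of m] n(2) m by auto
    have Xm: "\<bar>X m\<bar> \<le> c * \<bar>X 0\<bar>" using range[of m] n(2) m by auto
    have "\<bar>X m\<bar> < \<delta>" using uy[of "Y m"] Ym y1 by (simp add: X_def)
    then have "\<bar>h (X m)\<bar> \<le> C * \<bar>X m\<bar>" by (rule hC)
    moreover have "y1 - Y m \<le> \<bar>h (X m)\<bar>" using n(1) m by (simp add: YS)
    moreover have "\<bar>u y1\<bar> \<le> \<bar>X m\<bar> + (y1 - Y m)"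
      using lip[of y1 "Y m"] Ym y1 by (simp add: X_def)
    ultimately have "\<bar>u y1\<bar> \<le> (1 + C) * \<bar>X m\<bar>" by (simp add: algebra_simps)
    also have "\<dots> \<le> (1 + C) * (c * y0)"
      using Xm X0(2) c pos(3) by (intro mult_left_mono) (auto intro: order_trans mult_left_mono)
    also have "\<dots> < \<bar>u y1\<bar>"
      using y0(2) c pos(3) by (simp add: less_divide_eq mult_ac)
    finally show False by simp
  qed
qed

text \<open>The orders of vanishing are compared: \<open>k \<le> m\<close> gives the lower bound,
  and \<open>k > m\<close> leaves a spare factor \<open>\<bar>x\<bar>\<close> for the upper one. A
  zero germ \<open>p\<close> goes to the upper case with \<open>K = 0\<close>, a zero germ
  \<open>h\<close> to the lower case.\<close>

lemma germ_comparison: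
  assumes p: "real_analytic_at p 0" and h: "real_analytic_at h 0"
    and nontriv: "\<not> (\<forall>\<^sub>F x in nhds 0. p x = 0 \<and> h x = 0)"
  obtains (lower) c r where "c > 0" "r > 0" "\<And>x. \<bar>x\<bar> < r \<Longrightarrow> c * \<bar>h x\<bar> \<le> \<bar>p x\<bar>"
      "\<And>x. \<bar>x\<bar> < r \<Longrightarrow> x \<noteq> 0 \<Longrightarrow> p x \<noteq> 0"
  | (upper) K r where "K \<ge> 0" "r > 0" "\<And>x. \<bar>x\<bar> < r \<Longrightarrow> \<bar>p x\<bar> \<le> K * \<bar>h x\<bar> * \<bar>x\<bar>"
      "\<And>x. \<bar>x\<bar> < r \<Longrightarrow> x \<noteq> 0 \<Longrightarrow> h x \<noteq> 0"
proof -
  have bounds: "\<exists>r>0. \<forall>x. \<bar>x\<bar> < r \<longrightarrow> r \<le> 1 \<and> f x = x ^ n * g x \<and> \<bar>g 0\<bar> / 2 \<le> \<bar>g x\<bar> \<and> \<bar>g x\<bar> \<le> 2 * \<bar>g 0\<bar>"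
    if g: "real_analytic_at g 0" "g 0 \<noteq> 0" and f: "\<forall>\<^sub>F x in nhds 0. f x = x ^ n * g x"
    for f g :: "real \<Rightarrow> real" and n :: nat
  proof -
    have "\<forall>\<^sub>F x in nhds 0. dist (g x) (g 0) < \<bar>g 0\<bar> / 2"
      using isCont_tendsto_nhds[OF real_analytic_at_isCont[OF g(1)]] g(2) by (intro tendstoD) auto
    with f have "\<forall>\<^sub>F x in nhds 0. f x = x ^ n * g x \<and> \<bar>g 0\<bar> / 2 \<le> \<bar>g x\<bar> \<and> \<bar>g x\<bar> \<le> 2 * \<bar>g 0\<bar>"
    proof eventually_elim
      case (elim x)
      then have "\<bar>g x - g 0\<bar> < \<bar>g 0\<bar> / 2" by (simp add: dist_real_def)
      then have "\<bar>g 0\<bar> / 2 \<le> \<bar>g x\<bar>" "\<bar>g x\<bar> \<le> 2 * \<bar>g 0\<bar>" by arith+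
      with elim show ?case by blast
    qed
    then obtain d where "d > 0" "\<And>x. \<bar>x\<bar> < d \<Longrightarrow>
        f x = x ^ n * g x \<and> \<bar>g 0\<bar> / 2 \<le> \<bar>g x\<bar> \<and> \<bar>g x\<bar> \<le> 2 * \<bar>g 0\<bar>"
      unfolding eventually_nhds_metric dist_real_def by auto
    then show ?thesis by (intro exI[of _ "min d 1"]) auto
  qed
  show ?thesis
    using p
  proof (cases rule: real_analytic_at_0_cases)
    case p0: zero
    then obtain d where d: "d > 0" "\<And>x. \<bar>x\<bar> < d \<Longrightarrow> p x = 0"
      unfolding eventually_nhds_metric dist_real_def by auto
    from h show ?thesis
    proof (cases rule: real_analytic_at_0_cases)
      case zero
      with p0 have "\<forall>\<^sub>F x in nhds 0. p x = 0 \<and> h x = 0" by eventually_elim simp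
      then show ?thesis using nontriv by simp
    next
      case (factor m b)
      obtain e where e: "e > 0" "\<forall>x. \<bar>x\<bar> < e \<longrightarrow> e \<le> 1 \<and> h x = x ^ m * b x \<and> \<bar>b 0\<bar> / 2 \<le> \<bar>b x\<bar> \<and> \<bar>b x\<bar> \<le> 2 * \<bar>b 0\<bar>"
        using bounds[OF factor] by blast
      show ?thesis
      proof (rule upper[of 0 "min d e"])
        show "h x \<noteq> 0" if "\<bar>x\<bar> < min d e" "x \<noteq> 0" for x
          using e(2)[rule_format, of x] that factor(2) by auto
      qed (use d e in auto)
    qed
  next
    case pw: (factor k w)
    obtain d where d: "d > 0" "\<forall>x. \<bar>x\<bar> < d \<longrightarrow> d \<le> 1 \<and> p x = x ^ k * w x \<and> \<bar>w 0\<bar> / 2 \<le> \<bar>w x\<bar> \<and> \<bar>w x\<bar> \<le> 2 * \<bar>w 0\<bar>"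
      using bounds[OF pw] by blast
    have pnz: "p x \<noteq> 0" if "\<bar>x\<bar> < d" "x \<noteq> 0" for x
      using d(2)[rule_format, of x] that pw(2) by auto
    from h show ?thesis
    proof (cases rule: real_analytic_at_0_cases)
      case zero
      then obtain e where e: "e > 0" "\<And>x. \<bar>x\<bar> < e \<Longrightarrow> h x = 0"
        unfolding eventually_nhds_metric dist_real_def by auto
      show ?thesis
        by (rule lower[of 1 "min d e"]) (use d e pnz in auto)
    next
      case (factor m b)
      obtain e where e: "e > 0" "\<forall>x. \<bar>x\<bar> < e \<longrightarrow> e \<le> 1 \<and> h x = x ^ m * b x \<and> \<bar>b 0\<bar> / 2 \<le> \<bar>b x\<bar> \<and> \<bar>b x\<bar> \<le> 2 * \<bar>b 0\<bar>"
        using bounds[OF factor] by blast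
      show ?thesis
      proof (cases "k \<le> m")
        case True
        show ?thesis
        \<comment> \<open>The constant is the lower bound \<open>\<bar>w 0\<bar> / 2\<close> of one
          cofactor over the upper bound \<open>2 * \<bar>b 0\<bar>\<close> of the other; the upper
          case takes the analogous quotient.\<close>
        proof (rule lower[of "\<bar>w 0\<bar> / (4 * \<bar>b 0\<bar>)" "min d e"])
          fix x assume x: "\<bar>x\<bar> < min d e"
          have "\<bar>x\<bar> ^ m \<le> \<bar>x\<bar> ^ k"
            using True d(2)[rule_format, of x] x by (intro power_decreasing) auto
          then have "\<bar>h x\<bar> \<le> \<bar>x\<bar> ^ k * (2 * \<bar>b 0\<bar>)"
            using e(2)[rule_format, of x] x by (auto simp: abs_mult power_abs intro!: mult_mono)
          then have "\<bar>w 0\<bar> / (4 * \<bar>b 0\<bar>) * \<bar>h x\<bar> \<le> \<bar>w 0\<bar> / (4 * \<bar>b 0\<bar>) * (\<bar>x\<bar> ^ k * (2 * \<bar>b 0\<bar>))"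
            by (intro mult_left_mono) auto
          also have "\<dots> = \<bar>x\<bar> ^ k * (\<bar>w 0\<bar> / 2)" using factor(2) by simp
          also have "\<dots> \<le> \<bar>x\<bar> ^ k * \<bar>w x\<bar>"
            using d(2)[rule_format, of x] x by (intro mult_left_mono) auto
          also have "\<dots> = \<bar>p x\<bar>"
            using d(2)[rule_format, of x] x by (simp add: abs_mult power_abs)
          finally show "\<bar>w 0\<bar> / (4 * \<bar>b 0\<bar>) * \<bar>h x\<bar> \<le> \<bar>p x\<bar>" .
        qed (use d e pnz pw(2) factor(2) in auto)
      next
        case False
        show ?thesis
        proof (rule upper[of "4 * \<bar>w 0\<bar> / \<bar>b 0\<bar>" "min d e"])
          fix x assume x: "\<bar>x\<bar> < min d e"
          have "\<bar>x\<bar> ^ k \<le> \<bar>x\<bar> ^ Suc m"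
            using False d(2)[rule_format, of x] x by (intro power_decreasing) auto
          then have "\<bar>p x\<bar> \<le> \<bar>x\<bar> ^ Suc m * (2 * \<bar>w 0\<bar>)"
            using d(2)[rule_format, of x] x by (auto simp: abs_mult power_abs intro!: mult_mono)
          also have "\<dots> = 4 * \<bar>w 0\<bar> / \<bar>b 0\<bar> * (\<bar>x\<bar> ^ m * (\<bar>b 0\<bar> / 2)) * \<bar>x\<bar>"
            using factor(2) by simp
          also have "\<dots> \<le> 4 * \<bar>w 0\<bar> / \<bar>b 0\<bar> * (\<bar>x\<bar> ^ m * \<bar>b x\<bar>) * \<bar>x\<bar>"
            using e(2)[rule_format, of x] x by (intro mult_right_mono mult_left_mono) auto
          also have "\<bar>x\<bar> ^ m * \<bar>b x\<bar> = \<bar>h x\<bar>"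
            using e(2)[rule_format, of x] x by (simp add: abs_mult power_abs)
          finally show "\<bar>p x\<bar> \<le> 4 * \<bar>w 0\<bar> / \<bar>b 0\<bar> * \<bar>h x\<bar> * \<bar>x\<bar>" .
        next
          show "h x \<noteq> 0" if "\<bar>x\<bar> < min d e" "x \<noteq> 0" for x
            using e(2)[rule_format, of x] that factor(2) by auto
        qed (use d e in auto)
      qed
    qed
  qed
qed

lemma real_analytic_sign_bound:
  assumes "real_analytic_at h 0" "h 0 = 0"
  obtains r L \<sigma> where "r > 0" "L \<ge> 0" "\<And>x. 0 < x \<Longrightarrow> x < r \<Longrightarrow> \<bar>h x\<bar> = \<sigma> * h x"
    "\<And>x. \<bar>x\<bar> < r \<Longrightarrow> \<bar>h x\<bar> \<le> L * \<bar>x\<bar>"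
proof -
  obtain H r C L \<sigma> where H: "r > 0" "H holomorphic_on ball 0 r" "C \<ge> 0" "L \<ge> 0"
    "\<And>x. \<bar>x\<bar> < r \<Longrightarrow> H (of_real x) = of_real (h x)"
    "\<And>x z. 0 < x \<Longrightarrow> x < r \<Longrightarrow> norm z \<le> 2 * x \<Longrightarrow> norm z < r \<Longrightarrow> norm (H z) \<le> C * \<bar>h x\<bar>"
    "\<And>z. norm z < r \<Longrightarrow> norm (H z) \<le> L * norm z"
    "\<And>x. 0 < x \<Longrightarrow> x < r \<Longrightarrow> \<bar>h x\<bar> = \<sigma> * h x"
    using real_analytic_extension_bounds[OF assms] by metis
  have "\<bar>h x\<bar> \<le> L * \<bar>x\<bar>" if "\<bar>x\<bar> < r" for x
    using H(5)[OF that] H(7)[of "of_real x"] that by simp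
  then show ?thesis using that[of r L \<sigma>] H(1,4,8) by simp
qed

text \<open>The hypothesis \<open>lip\<close> expresses that the curve is continuously tangent to
  the vertical axis. If \<open>\<phi> x - x\<close> dominates \<open>h\<close>, small Lipschitz
  constants already exclude \<open>u y \<noteq> 0\<close>; otherwise the orbit argument applies, on
  both sides of height 0.\<close>

lemma vertical_graph_zero:
  fixes u \<phi> h :: "real \<Rightarrow> real"
  assumes sd: "shear_data \<phi> h"
    and nontriv: "\<not> (\<forall>\<^sub>F x in nhds 0. \<phi> x = x \<and> h x = 0)"
    and u0: "u 0 = 0"
    and lip: "\<And>\<epsilon>. \<epsilon> > 0 \<Longrightarrow> \<exists>d>0. \<forall>y y'. \<bar>y\<bar> < d \<and> \<bar>y'\<bar> < d \<longrightarrow> \<bar>u y - u y'\<bar> \<le> \<epsilon> * \<bar>y - y'\<bar>"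
    and inv: "\<forall>\<^sub>F y in nhds 0. u (y + h (u y)) = \<phi> (u y)"
  shows "\<forall>\<^sub>F y in nhds 0. u y = 0"
proof -
  have \<phi>: "real_analytic_at \<phi> 0" and h: "real_analytic_at h 0" "h 0 = 0"
    using sd by (auto simp: shear_data_def analytic_diffeo1_def)
  have h': "real_analytic_at (\<lambda>x. h (- x)) 0" "h (- 0) = 0"
    using h real_analytic_at_compose[OF real_analytic_at_uminus[OF real_analytic_at_ident]] by auto
  obtain r1 L \<sigma>1 where r1: "r1 > 0" "L \<ge> 0"
    "\<And>x. 0 < x \<Longrightarrow> x < r1 \<Longrightarrow> \<bar>h x\<bar> = \<sigma>1 * h x" "\<And>x. \<bar>x\<bar> < r1 \<Longrightarrow> \<bar>h x\<bar> \<le> L * \<bar>x\<bar>"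
    using real_analytic_sign_bound[OF h] by metis
  obtain r2 \<sigma>2 where r2: "r2 > 0" "\<And>x. 0 < x \<Longrightarrow> x < r2 \<Longrightarrow> \<bar>h (- x)\<bar> = \<sigma>2 * h (- x)"
    using real_analytic_sign_bound[OF h'] by metis
  have "\<forall>\<^sub>F x in nhds 0. isCont h x"
    using real_analytic_at_eventually[OF h(1)] by eventually_elim (rule real_analytic_at_isCont)
  then obtain r3 where r3: "r3 > 0" "\<And>x. \<bar>x\<bar> < r3 \<Longrightarrow> isCont h x"
    unfolding eventually_nhds_metric dist_real_def by auto
  obtain r4 where r4: "r4 > 0" "\<And>y. \<bar>y\<bar> < r4 \<Longrightarrow> u (y + h (u y)) = \<phi> (u y)"
    using inv unfolding eventually_nhds_metric dist_real_def by auto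
  \<comment> \<open>Chosen so that \<open>L * \<epsilon>0 \<le> 1 / 2\<close>, which gives
    \<open>\<bar>h (u y)\<bar> \<le> \<bar>y\<bar> / 2\<close>.\<close>
  define \<epsilon>0 where "\<epsilon>0 = 1 / (2 * (L + 1))"
  have \<epsilon>0: "\<epsilon>0 > 0" "\<epsilon>0 \<le> 1" "L * \<epsilon>0 \<le> 1 / 2"
    using r1(2) by (auto simp: \<epsilon>0_def field_simps)
  have p: "real_analytic_at (\<lambda>x. \<phi> x - x) 0"
    by (intro real_analytic_at_diff \<phi>) simp
  have nontriv':  "\<not> (\<forall>\<^sub>F x in nhds 0. \<phi> x - x = 0 \<and> h x = 0)"
    using nontriv by simp
  from p h(1) nontriv' show ?thesis
  proof (cases rule: germ_comparison)
    case (lower c r)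
    define \<epsilon> where "\<epsilon> = min \<epsilon>0 (c / 2)"
    have \<epsilon>: "\<epsilon> > 0" "\<epsilon> \<le> \<epsilon>0" "\<epsilon> \<le> c / 2" using \<epsilon>0(1) lower(1) by (auto simp: \<epsilon>_def)
    obtain d where d: "d > 0" "\<And>y y'. \<bar>y\<bar> < d \<Longrightarrow> \<bar>y'\<bar> < d \<Longrightarrow> \<bar>u y - u y'\<bar> \<le> \<epsilon> * \<bar>y - y'\<bar>"
      using lip[OF \<epsilon>(1)] by blast
    have "u y = 0" if y: "\<bar>y\<bar> < Min {r, r1, r4, d / 2}" for y
    proof (rule ccontr)
      assume nz: "u y \<noteq> 0"
      have uy: "\<bar>u y\<bar> \<le> \<epsilon> * \<bar>y\<bar>" using d(2)[of y 0] y d(1) u0 by simp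
      also have "\<dots> \<le> 1 * \<bar>y\<bar>" using \<epsilon>(2) \<epsilon>0(2) by (intro mult_right_mono) auto
      finally have uy': "\<bar>u y\<bar> \<le> \<bar>y\<bar>" by simp
      have "\<bar>h (u y)\<bar> \<le> L * \<bar>u y\<bar>" using uy' y by (intro r1(4)) auto
      also have "\<dots> \<le> L * (\<epsilon>0 * \<bar>y\<bar>)"
        using uy \<epsilon>(2) r1(2) by (intro mult_left_mono order_trans[OF uy] mult_right_mono) auto
      also have "\<dots> \<le> 1 / 2 * \<bar>y\<bar>" using mult_right_mono[OF \<epsilon>0(3), of "\<bar>y\<bar>"] by simp
      finally have "\<bar>y + h (u y)\<bar> < d" using y by auto
      \<comment> \<open>By invariance the left-hand side is the increment of \<open>u\<close> from
        \<open>y\<close> to \<open>y + h (u y)\<close>. Combined with the lower bound it is at most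
        half of itself, hence zero.\<close>
      then have "\<bar>\<phi> (u y) - u y\<bar> \<le> \<epsilon> * \<bar>h (u y)\<bar>"
        using d(2)[of "y + h (u y)" y] r4(2)[of y] y d(1) by simp
      also have "\<dots> \<le> c / 2 * \<bar>h (u y)\<bar>" using \<epsilon>(3) by (intro mult_right_mono) auto
      also have "\<dots> \<le> \<bar>\<phi> (u y) - u y\<bar> / 2" using lower(3)[of "u y"] uy' y by simp
      finally have "\<phi> (u y) - u y = 0" by simp
      then show False using lower(4)[of "u y"] uy' y nz by simp
    qed
    moreover have "Min {r, r1, r4, d / 2} > 0" using lower(2) r1(1) r4(1) d(1) by simp
    ultimately show ?thesis
      unfolding eventually_nhds_metric dist_real_def by (metis diff_zero)
  next
    case (upper K r)
    obtain d where d: "d > 0" "\<And>y y'. \<bar>y\<bar> < d \<Longrightarrow> \<bar>y'\<bar> < d \<Longrightarrow> \<bar>u y - u y'\<bar> \<le> \<epsilon>0 * \<bar>y - y'\<bar>"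
      using lip[OF \<epsilon>0(1)] by blast
    \<comment> \<open>Below \<open>\<kappa>\<close> one has
      \<open>K * \<bar>h x\<bar> \<le> K * L * \<kappa> \<le> 1 / 2\<close>, the smallness needed
      for the logarithmic estimate.\<close>
    define \<kappa> where "\<kappa> = 1 / (2 * (K * L + 1))"
    define \<delta> where "\<delta> = Min {r, r1, r2, r3, r4, d, \<kappa>}"
    have KL: "0 \<le> K * L" using upper(1) r1(2) by simp
    then have "0 < \<kappa>" by (simp add: \<kappa>_def)
    then have \<delta>: "\<delta> > 0" "\<delta> \<le> r" "\<delta> \<le> r1" "\<delta> \<le> r2" "\<delta> \<le> r3" "\<delta> \<le> r4" "\<delta> \<le> d" "\<delta> \<le> \<kappa>"
    proof -
      show "\<delta> > 0"
        unfolding \<delta>_def using upper(2) r1(1) r2(1) r3(1) r4(1) d(1) \<open>0 < \<kappa>\<close>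
        by (subst Min_gr_iff) auto
      have "\<delta> \<le> z" if "z \<in> {r, r1, r2, r3, r4, d, \<kappa>}" for z
        unfolding \<delta>_def using that by (intro Min_le) auto
      then show "\<delta> \<le> r" "\<delta> \<le> r1" "\<delta> \<le> r2" "\<delta> \<le> r3" "\<delta> \<le> r4" "\<delta> \<le> d" "\<delta> \<le> \<kappa>"
        by blast+
    qed
    have pK: "\<bar>\<phi> x - x\<bar> \<le> K * \<bar>h x\<bar> * \<bar>x\<bar>" if "\<bar>x\<bar> < \<delta>" for x
      using upper(3) that \<delta> by simp
    have hL: "\<bar>h x\<bar> \<le> L * \<bar>x\<bar>" if "\<bar>x\<bar> < \<delta>" for x
      using r1(4) that \<delta> by simp
    have hK: "K * \<bar>h x\<bar> \<le> 1 / 2" if x: "\<bar>x\<bar> < \<delta>" for x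
    proof -
      have "K * \<bar>h x\<bar> \<le> K * (L * \<bar>x\<bar>)" using hL[OF x] upper(1) by (intro mult_left_mono)
      also have "\<dots> \<le> K * L * \<kappa>"
        using x \<delta>(8) mult_left_mono[OF _ KL, of "\<bar>x\<bar>" \<kappa>] by (simp add: mult.assoc)
      also have "\<dots> \<le> 1 / 2" using KL by (simp add: \<kappa>_def field_simps)
      finally show ?thesis .
    qed
    have hcont: "isCont h x" if "\<bar>x\<bar> < \<delta>" for x using r3(2) that \<delta> by simp
    have hnz: "h x \<noteq> 0" if "\<bar>x\<bar> < \<delta>" "x \<noteq> 0" for x using upper(4) that \<delta> by simp
    define \<sigma> where "\<sigma> t = (if t = (1 :: real) then \<sigma>1 else \<sigma>2)" for t
    have h\<sigma>: "\<bar>h x\<bar> = \<sigma> (sgn x) * h x" if "\<bar>x\<bar> < \<delta>" "x \<noteq> 0" for x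
      using r1(3)[of x] r2(2)[of "- x"] that \<delta> by (cases "x > 0") (auto simp: \<sigma>_def)
    have lip1: "\<bar>u y - u y'\<bar> \<le> \<bar>y - y'\<bar>" if "\<bar>y\<bar> < \<delta>" "\<bar>y'\<bar> < \<delta>" for y y'
    proof -
      have "\<bar>u y - u y'\<bar> \<le> \<epsilon>0 * \<bar>y - y'\<bar>" using d(2) that \<delta> by simp
      also have "\<dots> \<le> 1 * \<bar>y - y'\<bar>" using \<epsilon>0 by (intro mult_right_mono) auto
      finally show ?thesis by simp
    qed
    have hu: "\<bar>h (u y)\<bar> \<le> \<bar>y\<bar> / 2" if y: "\<bar>y\<bar> < \<delta>" for y
    proof -
      have uy: "\<bar>u y\<bar> \<le> \<epsilon>0 * \<bar>y\<bar>" using d(2)[of y 0] d(1) y \<delta> u0 by simp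
      have "\<bar>u y\<bar> < \<delta>" using lip1[OF y, of 0] \<delta>(1) u0 y by simp
      then have "\<bar>h (u y)\<bar> \<le> L * \<bar>u y\<bar>" by (rule hL)
      also have "\<dots> \<le> L * (\<epsilon>0 * \<bar>y\<bar>)" using uy r1(2) by (rule mult_left_mono)
      also have "\<dots> \<le> 1 / 2 * \<bar>y\<bar>" using mult_right_mono[OF \<epsilon>0(3), of "\<bar>y\<bar>"] by simp
      finally show ?thesis by simp
    qed
    have inv': "u (y + h (u y)) = \<phi> (u y)" if "\<bar>y\<bar> < \<delta>" for y using r4(2) that \<delta> by simp
    obtain \<eta>1 where \<eta>1: "\<eta>1 > 0" "\<And>y. 0 < y \<Longrightarrow> y < \<eta>1 \<Longrightarrow> u y = 0"
      using vertical_graph_zero_right[of \<delta> K L \<phi> h \<sigma> u,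
          OF \<delta>(1) upper(1) r1(2) pK hL hK hcont hnz h\<sigma> u0 lip1 hu inv'] by blast
    \<comment> \<open>The reflection \<open>(x, y) \<mapsto> (x, - y)\<close> turns the shear into
      the one with \<open>- h\<close> and the curve into \<open>x = u (- y)\<close>.\<close>
    have "\<exists>\<eta>>0. \<forall>y. 0 < y \<and> y < \<eta> \<longrightarrow> u (- y) = 0"
    proof (rule vertical_graph_zero_right[of \<delta> K L \<phi> "\<lambda>x. - h x" "\<lambda>t. - \<sigma> t" "\<lambda>y. u (- y)"])
      show "isCont (\<lambda>x. - h x) x" if "\<bar>x\<bar> < \<delta>" for x
        using hcont[OF that] by (intro continuous_intros)
      show "u (- (y + - h (u (- y)))) = \<phi> (u (- y))" if "\<bar>y\<bar> < \<delta>" for y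
        using inv'[of "- y"] that by simp
      show "\<bar>u (- y) - u (- y')\<bar> \<le> \<bar>y - y'\<bar>" if "\<bar>y\<bar> < \<delta>" "\<bar>y'\<bar> < \<delta>" for y y'
        using lip1[of "- y" "- y'"] that by (simp add: abs_minus_commute)
      show "\<bar>- h (u (- y))\<bar> \<le> \<bar>y\<bar> / 2" if "\<bar>y\<bar> < \<delta>" for y
        using hu[of "- y"] that by simp
    qed (use \<delta>(1) upper(1) r1(2) pK hL hK hnz h\<sigma> u0 in auto)
    then obtain \<eta>2 where \<eta>2: "\<eta>2 > 0" "\<And>y. 0 < y \<Longrightarrow> y < \<eta>2 \<Longrightarrow> u (- y) = 0" by blast
    have "u y = 0" if "\<bar>y\<bar> < min \<eta>1 \<eta>2" for y
      using \<eta>1(2)[of y] \<eta>2(2)[of "- y"] u0 that by (cases y "0 :: real" rule: linorder_cases) auto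
    then show ?thesis
      unfolding eventually_nhds_metric dist_real_def using \<eta>1(1) \<eta>2(1)
      by (intro exI[of _ "min \<eta>1 \<eta>2"]) auto
  qed
qed

section \<open>Smooth invariant curves\<close>

lemma smooth_on_line_C1:
  assumes "smooth_on_line I p" "t \<in> I"
  shows "(p has_real_derivative deriv p t) (at t)" "isCont (deriv p) t"
proof -
  have "(deriv ^^ 0) p differentiable at t" "(deriv ^^ 1) p differentiable at t"
    using assms unfolding smooth_on_line_def by blast+
  then have "p differentiable at t" "deriv p differentiable at t" by simp_all
  then show "(p has_real_derivative deriv p t) (at t)" "isCont (deriv p) t"
    by (simp_all add: DERIV_deriv_iff_real_differentiable differentiable_imp_continuous_within)
qed

lemma smooth_on_line_mvt:
  assumes "smooth_on_line I p" "ball t0 e \<subseteq> I" "s \<in> ball t0 e" "t \<in> ball t0 e"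
  obtains z where "z \<in> ball t0 e" "p t - p s = (t - s) * deriv p z"
proof -
  have mv: "\<exists>z\<in>ball t0 e. p b - p a = (b - a) * deriv p z"
    if ab: "a < b" "a \<in> ball t0 e" "b \<in> ball t0 e" for a b
  proof -
    have sub: "x \<in> ball t0 e" if "a \<le> x" "x \<le> b" for x
      using ab that by (auto simp: dist_real_def abs_less_iff)
    have "\<exists>z. a < z \<and> z < b \<and> p b - p a = (b - a) * deriv p z"
      using smooth_on_line_C1(1)[OF assms(1)] sub assms(2) by (intro MVT2[OF ab(1)]) blast
    then show ?thesis using sub less_imp_le by meson
  qed
  show ?thesis
  proof (cases s t rule: linorder_cases)
    case less
    then show ?thesis using mv[of s t] assms(3,4) that by blast
  next
    case equal
    then show ?thesis using that[of s] assms(3) by simp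
  next
    case greater
    then obtain z where "z \<in> ball t0 e" "p s - p t = (s - t) * deriv p z"
      using mv[of t s] assms(3,4) by blast
    then show ?thesis using that[of z] by (simp add: algebra_simps)
  qed
qed

lemma smooth_on_line_near:
  assumes "smooth_on_line I p" "open I" "t0 \<in> I" "\<eta> > 0"
  obtains e where "e > 0" "ball t0 e \<subseteq> I" "\<And>t. t \<in> ball t0 e \<Longrightarrow> \<bar>deriv p t - deriv p t0\<bar> < \<eta>"
proof -
  obtain e1 where e1: "e1 > 0" "ball t0 e1 \<subseteq> I"
    using assms(2,3) open_contains_ball by blast
  obtain e2 where e2: "e2 > 0" "\<And>t. dist t t0 < e2 \<Longrightarrow> dist (deriv p t) (deriv p t0) < \<eta>"
    using smooth_on_line_C1(2)[OF assms(1,3)] assms(4) unfolding continuous_at_eps_delta by blast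
  show ?thesis
  proof (rule that[of "min e1 e2"])
    show "\<bar>deriv p t - deriv p t0\<bar> < \<eta>" if "t \<in> ball t0 (min e1 e2)" for t
      using e2(2)[of t] that by (simp add: dist_commute dist_real_def)
  qed (use e1 e2(1) in auto)
qed

text \<open>The projections \<open>P\<close> and \<open>Q\<close> are the two coordinates of the plane, in
  either order.\<close>

lemma curve_local_graph:
  fixes P Q :: "real \<times> real \<Rightarrow> real"
  assumes PQ: "\<And>z w. P z = P w \<Longrightarrow> Q z = Q w \<Longrightarrow> z = w"
    and P: "filterlim P (nhds 0) (nhds 0)" "P 0 = 0" "Q 0 = 0"
    and L: "0 \<in> L" "open U" "0 \<in> U" "open I"
    and hom: "homeomorphism I (L \<inter> U) c c'"
    and smooth: "smooth_on_line I (\<lambda>t. P (c t))" "smooth_on_line I (\<lambda>t. Q (c t))"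
    and dP: "deriv (\<lambda>t. P (c t)) (c' 0) \<noteq> 0"
  obtains f m where "f 0 = 0" "\<forall>\<^sub>F z in nhds 0. z \<in> L \<longleftrightarrow> Q z = f (P z)" "m > 0"
    "\<And>b. b > \<bar>deriv (\<lambda>t. Q (c t)) (c' 0)\<bar> \<Longrightarrow>
       \<exists>d>0. \<forall>x x'. \<bar>x\<bar> < d \<and> \<bar>x'\<bar> < d \<longrightarrow> \<bar>f x - f x'\<bar> \<le> b / m * \<bar>x - x'\<bar>"
proof -
  define p q t0 where "p = (\<lambda>t. P (c t))" and "q = (\<lambda>t. Q (c t))" and "t0 = c' 0"
  have t0: "t0 \<in> I" "c t0 = 0"
    using hom L(1,3) unfolding t0_def homeomorphism_def by auto
  have pq: "smooth_on_line I p" "smooth_on_line I q" "p t0 = 0" "q t0 = 0"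
    using smooth P t0 by (simp_all add: p_def q_def)
  \<comment> \<open>On a small interval \<open>\<bar>deriv p t\<bar>\<close> stays above this value,
    so \<open>p\<close> expands distances at least by the factor \<open>m\<close>.\<close>
  define m where "m = \<bar>deriv p t0\<bar> / 2"
  have m: "m > 0" using dP by (simp add: m_def p_def t0_def)
  obtain e where e: "e > 0" "ball t0 e \<subseteq> I" "\<And>t. t \<in> ball t0 e \<Longrightarrow> \<bar>deriv p t - deriv p t0\<bar> < m"
    using smooth_on_line_near[OF pq(1) L(4) t0(1) m] by metis
  define J where "J = ball t0 e"
  have J: "t0 \<in> J" "J \<subseteq> I" "open J" using e by (auto simp: J_def)
  have expand: "m * \<bar>t - s\<bar> \<le> \<bar>p t - p s\<bar>" if "s \<in> J" "t \<in> J" for s t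
  proof -
    obtain z where z: "z \<in> ball t0 e" "p t - p s = (t - s) * deriv p z"
      using smooth_on_line_mvt[OF pq(1) e(2)] \<open>s \<in> J\<close> \<open>t \<in> J\<close> unfolding J_def by metis
    have "m \<le> \<bar>deriv p z\<bar>" using e(3)[OF z(1)] unfolding m_def by arith
    then show ?thesis
      using mult_right_mono[of m "\<bar>deriv p z\<bar>" "\<bar>t - s\<bar>"] by (simp add: z(2) abs_mult mult.commute)
  qed
  have inj: "inj_on p J"
    using expand m by (intro inj_onI) (fastforce simp: mult_le_0_iff)
  have "continuous_on J p"
    using smooth_on_line_C1(1)[OF pq(1)] J(2) DERIV_isCont continuous_at_imp_continuous_on by blast
  then have op: "open (p ` J)" using J(3) inj by (rule invariance_of_domain)
  have p0: "0 \<in> p ` J" using J(1) pq(3) by force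
  define \<tau> where "\<tau> = inv_into J p"
  have \<tau>: "\<tau> x \<in> J" "p (\<tau> x) = x" if "x \<in> p ` J" for x
    using that by (simp_all add: \<tau>_def inv_into_into f_inv_into_f)
  have \<tau>p: "\<tau> (p t) = t" if "t \<in> J" for t
    using that inj by (simp add: \<tau>_def)
  define f where "f x = q (\<tau> x)" for x
  have f0: "f 0 = 0" using \<tau>p[OF J(1)] pq by (simp add: f_def)
  \<comment> \<open>Since the parametrization is a homeomorphism onto its image, the arc over
    \<open>J\<close> is relatively open in \<open>L\<close>; hence no other branch of
    \<open>L\<close> comes close to 0.\<close>
  have "openin (top_of_set (L \<inter> U)) (c ` J)"
    using J by (intro homeomorphism_imp_open_map[OF hom]) (auto simp: openin_open_eq L(4))
  then obtain V where V: "open V" "c ` J = L \<inter> U \<inter> V"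
    unfolding openin_open by blast
  have "0 \<in> V" using V(2) J(1) t0(2) by force
  then have "\<forall>\<^sub>F z in nhds 0. z \<in> U \<inter> V"
    using V(1) L(2,3) by (intro eventually_nhds_in_open) auto
  moreover have "\<forall>\<^sub>F z in nhds 0. P z \<in> p ` J"
    using eventually_nhds_in_open[OF op p0] P(1) by (rule eventually_compose_filterlim)
  ultimately have graph: "\<forall>\<^sub>F z in nhds 0. z \<in> L \<longleftrightarrow> Q z = f (P z)"
  proof eventually_elim
    case (elim z)
    show ?case
    proof
      assume "z \<in> L"
      then obtain t where "t \<in> J" "z = c t" using elim(1) V(2) by blast
      then show "Q z = f (P z)" using \<tau>p[of t] by (simp add: f_def p_def q_def)
    next
      assume Q: "Q z = f (P z)"
      have "z = c (\<tau> (P z))"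
        using \<tau>(2)[OF elim(2)] Q by (intro PQ) (simp_all add: f_def p_def q_def)
      then show "z \<in> L" using \<tau>(1)[OF elim(2)] V(2) by blast
    qed
  qed
  \<comment> \<open>The bound \<open>b\<close> for the derivative of \<open>q\<close> near
    \<open>t0\<close> is multiplied by the Lipschitz constant \<open>1 / m\<close> of the inverse
    \<open>\<tau>\<close>. If the derivative of \<open>q\<close> vanishes at \<open>t0\<close>, all
    positive Lipschitz constants are reached.\<close>
  have lip: "\<exists>d>0. \<forall>x x'. \<bar>x\<bar> < d \<and> \<bar>x'\<bar> < d \<longrightarrow> \<bar>f x - f x'\<bar> \<le> b / m * \<bar>x - x'\<bar>"
    if b: "b > \<bar>deriv q t0\<bar>" for b
  proof -
    obtain e' where e': "e' > 0" "ball t0 e' \<subseteq> I"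
      "\<And>t. t \<in> ball t0 e' \<Longrightarrow> \<bar>deriv q t - deriv q t0\<bar> < b - \<bar>deriv q t0\<bar>"
      using smooth_on_line_near[OF pq(2) L(4) t0(1), of "b - \<bar>deriv q t0\<bar>"] b by auto
    obtain d1 where d1: "d1 > 0" "ball 0 d1 \<subseteq> p ` J"
      using op p0 open_contains_ball by blast
    have \<tau>J: "\<tau> x \<in> J \<and> p (\<tau> x) = x \<and> \<tau> x \<in> ball t0 e'" if x: "\<bar>x\<bar> < min d1 (m * e')" for x
    proof -
      have "x \<in> p ` J" using d1(2) x by (intro subsetD[OF d1(2)]) simp
      note \<tau>x = \<tau>[OF this]
      have "m * \<bar>\<tau> x - t0\<bar> \<le> \<bar>x\<bar>" using expand[OF J(1) \<tau>x(1)] \<tau>x(2) pq(3) by simp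
      also have "\<dots> < m * e'" using x by simp
      finally have "\<bar>\<tau> x - t0\<bar> < e'" using m by simp
      then show ?thesis using \<tau>x by (simp add: dist_real_def abs_minus_commute)
    qed
    have "\<bar>f x - f x'\<bar> \<le> b / m * \<bar>x - x'\<bar>"
      if x: "\<bar>x\<bar> < min d1 (m * e')" "\<bar>x'\<bar> < min d1 (m * e')" for x x'
    proof -
      obtain z where z: "z \<in> ball t0 e'" "q (\<tau> x) - q (\<tau> x') = (\<tau> x - \<tau> x') * deriv q z"
        using smooth_on_line_mvt[OF pq(2) e'(2)] \<tau>J x by metis
      have "\<bar>deriv q z\<bar> \<le> b" using e'(3)[OF z(1)] by arith
      then have "\<bar>f x - f x'\<bar> \<le> b * \<bar>\<tau> x - \<tau> x'\<bar>"
        using mult_right_mono[of "\<bar>deriv q z\<bar>" b "\<bar>\<tau> x - \<tau> x'\<bar>"]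
        by (simp add: f_def z(2) abs_mult mult.commute)
      also have "\<bar>\<tau> x - \<tau> x'\<bar> \<le> \<bar>x - x'\<bar> / m"
        using expand[of "\<tau> x'" "\<tau> x"] \<tau>J x m by (simp add: le_divide_eq mult.commute)
      finally show ?thesis using b by (simp add: mult_left_mono)
    qed
    then show ?thesis
      using d1(1) e'(1) m by (intro exI[of _ "min d1 (m * e')"]) auto
  qed
  show ?thesis
    using that[OF f0 graph m] lip by (simp add: q_def t0_def)
qed

lemma submanifold1_analytic_graph:
  assumes W: "open W" "S \<subseteq> W" "\<And>z. z \<in> W \<Longrightarrow> z \<in> S \<longleftrightarrow> snd z = f (fst z)"
    and f: "\<And>z. z \<in> S \<Longrightarrow> real_analytic_at f (fst z)"
  shows "submanifold1 analytic_on_line S"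
  unfolding submanifold1_def
proof
  fix z assume z: "z \<in> S"
  define x where "x = fst z"
  have zx: "z = (x, f x)" using W z by (metis prod.collapse subsetD x_def)
  have fx: "real_analytic_at f x" using f z by (simp add: x_def)
  have "((\<lambda>t. (t, f t)) \<longlongrightarrow> (x, f x)) (nhds x)"
    using isCont_tendsto_nhds[OF real_analytic_at_isCont[OF fx]] by (intro tendsto_Pair filterlim_ident)
  then have "\<forall>\<^sub>F t in nhds x. (t, f t) \<in> W"
    using W(1,2) z zx by (intro topological_tendstoD) auto
  then have "\<forall>\<^sub>F t in nhds x. (t, f t) \<in> W \<and> real_analytic_at f t"
    using real_analytic_at_eventually[OF fx] by (rule eventually_conj)
  then obtain d where d: "d > 0" "\<And>t. dist t x < d \<Longrightarrow> (t, f t) \<in> W \<and> real_analytic_at f t"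
    unfolding eventually_nhds_metric by blast
  \<comment> \<open>The equation of the graph holds only inside \<open>W\<close>, so the interval is
    so short that the graph over it remains in \<open>W\<close>.\<close>
  let ?I = "ball x d" and ?U = "W \<inter> (ball x d \<times> UNIV)"
  have I: "(t, f t) \<in> W" "real_analytic_at f t" "isCont f t" if "t \<in> ?I" for t
    using d(2)[of t] that real_analytic_at_isCont by (auto simp: dist_commute)
  have "homeomorphism ?I (S \<inter> ?U) (\<lambda>t. (t, f t)) fst"
    unfolding homeomorphism_def
  proof (intro conjI ballI)
    show "(\<lambda>t. (t, f t)) ` ?I = S \<inter> ?U"
      using I(1) W(3) by (auto simp: image_iff)
    then show "fst ` (S \<inter> ?U) = ?I" by force
    show "continuous_on ?I (\<lambda>t. (t, f t))"
      using I(3) by (intro continuous_intros continuous_at_imp_continuous_on) auto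
  qed (use W(3) in \<open>auto intro!: continuous_intros\<close>)
  moreover have "analytic_on_line ?I (\<lambda>t. fst (t, f t))" "analytic_on_line ?I (\<lambda>t. snd (t, f t))"
    using I(2) by (auto simp: analytic_on_line_def)
  moreover have "deriv (\<lambda>s. fst (s, f s)) t = 1" for t
    by (simp add: DERIV_imp_deriv)
  moreover have "open ?U" "z \<in> ?U"
    using W(1) d(1) I(1)[of x] zx by (auto intro!: open_Int open_Times)
  ultimately show "\<exists>U I c c'. open U \<and> z \<in> U \<and> open I \<and> connected I \<and>
      analytic_on_line I (\<lambda>t. fst (c t)) \<and> analytic_on_line I (\<lambda>t. snd (c t)) \<and>
      (\<forall>t\<in>I. (deriv (\<lambda>s. fst (c s)) t, deriv (\<lambda>s. snd (c s)) t) \<noteq> (0, 0)) \<and>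
      homeomorphism I (S \<inter> U) c c'"
    by (intro exI[of _ ?U] exI[of _ ?I] exI[of _ "\<lambda>t. (t, f t)"] exI[of _ fst]) auto
qed

lemma submanifold1_analytic_vertical:
  assumes W: "open W" "S \<subseteq> W" "\<And>z. z \<in> W \<Longrightarrow> z \<in> S \<longleftrightarrow> fst z = 0"
  shows "submanifold1 analytic_on_line S"
  unfolding submanifold1_def
proof
  fix z assume z: "z \<in> S"
  define y where "y = snd z"
  have zy: "z = (0, y)" using W z by (metis prod.collapse subsetD y_def)
  have "((\<lambda>t. (0, t)) \<longlongrightarrow> (0, y)) (nhds y)"
    by (intro tendsto_Pair filterlim_ident tendsto_const)
  then have "\<forall>\<^sub>F t in nhds y. (0, t) \<in> W"
    using W(1,2) z zy by (intro topological_tendstoD) auto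
  then obtain d where d: "d > 0" "\<And>t. dist t y < d \<Longrightarrow> (0, t) \<in> W"
    unfolding eventually_nhds_metric by blast
  let ?I = "ball y d" and ?U = "W \<inter> (UNIV \<times> ball y d)"
  have I: "(0, t) \<in> W" if "t \<in> ?I" for t
    using d(2)[of t] that by (simp add: dist_commute)
  have "homeomorphism ?I (S \<inter> ?U) (\<lambda>t. (0, t)) snd"
    unfolding homeomorphism_def
  proof (intro conjI ballI)
    show "(\<lambda>t. (0, t)) ` ?I = S \<inter> ?U"
      using I W(3) by (auto simp: image_iff)
    then show "snd ` (S \<inter> ?U) = ?I" by force
  qed (use W(3) in \<open>auto intro!: continuous_intros\<close>)
  moreover have "analytic_on_line ?I (\<lambda>t. fst (0 :: real, t))" "analytic_on_line ?I (\<lambda>t. snd (0 :: real, t))"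
    by (auto simp: analytic_on_line_def)
  moreover have "deriv (\<lambda>s. snd (0 :: real, s :: real)) t = 1" for t
    by (simp add: DERIV_imp_deriv)
  moreover have "open ?U" "z \<in> ?U"
    using W(1) d(1) I[of y] zy by (auto intro!: open_Int open_Times)
  ultimately show "\<exists>U I c c'. open U \<and> z \<in> U \<and> open I \<and> connected I \<and>
      analytic_on_line I (\<lambda>t. fst (c t)) \<and> analytic_on_line I (\<lambda>t. snd (c t)) \<and>
      (\<forall>t\<in>I. (deriv (\<lambda>s. fst (c s)) t, deriv (\<lambda>s. snd (c s)) t) \<noteq> (0, 0)) \<and>
      homeomorphism I (S \<inter> U) c c'"
    by (intro exI[of _ ?U] exI[of _ ?I] exI[of _ "\<lambda>t. (0, t)"] exI[of _ snd]) auto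
qed

section \<open>Invariance in terms of local equations\<close>

text \<open>Here \<open>R\<close> is a local equation of \<open>L\<close> and \<open>c\<close> a
  curve of solutions tending to 0. Because the shear is continuous at 0, the image point is also in
  the region where \<open>R\<close> describes \<open>L\<close>, and invariance becomes an equation
  in \<open>t\<close>.\<close>

lemma germ_invariant_along:
  assumes sd: "shear_data \<phi> h" and g: "\<forall>\<^sub>F p in nhds 0. g p = shear \<phi> h p"
    and inv: "germ_invariant g L" and L: "\<forall>\<^sub>F p in nhds 0. p \<in> L \<longleftrightarrow> R p"
    and c: "filterlim c (nhds 0) (nhds (0 :: real))" "\<And>t. R (c t)"
  shows "\<forall>\<^sub>F t in nhds 0. R (shear \<phi> h (c t))"
proof -
  have "\<forall>\<^sub>F p in nhds 0. R (shear \<phi> h p) \<longleftrightarrow> shear \<phi> h p \<in> L"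
    using eventually_compose_filterlim[OF L shear_tendsto_0[OF sd]] by eventually_elim simp
  with g L inv[unfolded germ_invariant_def] have "\<forall>\<^sub>F p in nhds 0. R p \<longrightarrow> R (shear \<phi> h p)"
    by eventually_elim simp
  from eventually_compose_filterlim[OF this c(1)] show ?thesis
    by eventually_elim (use c(2) in blast)
qed

lemma graph_shear_invariant:
  assumes "shear_data \<phi> h" "\<forall>\<^sub>F p in nhds 0. g p = shear \<phi> h p"
    and "germ_invariant g \<gamma>" and \<gamma>: "0 \<in> \<gamma>" "continuous_graph_germ \<gamma> f"
  shows "shear_invariant \<phi> h f"
proof -
  obtain r where "r > 0" "continuous_on {-r<..<r} f"
    using \<gamma>(2) unfolding continuous_graph_germ_def by blast
  then have cont: "isCont f 0"
    by (simp add: continuous_on_eq_continuous_at)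
  have graph: "\<forall>\<^sub>F p in nhds 0. p \<in> \<gamma> \<longleftrightarrow> snd p = f (fst p)"
    using \<gamma>(2) by (simp add: continuous_graph_germ_def)
  have f0: "f 0 = 0"
    using eventually_nhds_x_imp_x[OF graph] \<gamma>(1) by simp
  have "((\<lambda>x. (x, f x)) \<longlongrightarrow> (0, 0)) (nhds 0)"
    using isCont_tendsto_nhds[OF cont] f0 by (intro tendsto_Pair filterlim_ident) simp
  then have "\<forall>\<^sub>F x in nhds 0. snd (shear \<phi> h (x, f x)) = f (fst (shear \<phi> h (x, f x)))"
    by (intro germ_invariant_along[OF assms(1-3) graph]) (simp_all add: zero_prod_def)
  then have "\<forall>\<^sub>F x in nhds 0. f (\<phi> x) = f x + h x"
    by eventually_elim simp
  with cont f0 show ?thesis by (simp add: shear_invariant_def)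
qed

lemma open_eventually_nhds_0:
  fixes P :: "real \<times> real \<Rightarrow> bool"
  assumes "\<forall>\<^sub>F p in nhds 0. P p"
  obtains W where "open W" "0 \<in> W" "\<And>p. p \<in> W \<Longrightarrow> P p"
  using assms unfolding eventually_nhds by blast

text \<open>If the tangent at 0 is not vertical, the curve is a continuous graph and the analyticity
  result applies. If it is vertical, the curve coincides near 0 with the vertical axis.\<close>

lemma shear_invariant_curve_analytic:
  assumes sd: "shear_data \<phi> h" and g: "\<forall>\<^sub>F p in nhds 0. g p = shear \<phi> h p"
    and noninv: "\<not> (\<forall>\<^sub>F p in nhds 0. shear \<phi> h (shear \<phi> h p) = p)"
    and L: "smooth_curve_around0 L" and inv: "germ_invariant g L"
  shows "\<exists>N. open N \<and> 0 \<in> N \<and>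
    (\<forall>p \<in> L \<inter> N - {0}. \<exists>U. open U \<and> p \<in> U \<and> submanifold1 analytic_on_line (L \<inter> U))"
proof -
  have L0: "0 \<in> L" and "submanifold1 smooth_on_line L"
    using L by (auto simp: smooth_curve_around0_def)
  then obtain U I c c' where U: "open U" "0 \<in> U" "open I"
    and smooth: "smooth_on_line I (\<lambda>t. fst (c t))" "smooth_on_line I (\<lambda>t. snd (c t))"
    and reg: "\<And>t. t \<in> I \<Longrightarrow> (deriv (\<lambda>s. fst (c s)) t, deriv (\<lambda>s. snd (c s)) t) \<noteq> (0, 0)"
    and hom: "homeomorphism I (L \<inter> U) c c'"
    unfolding submanifold1_def by metis
  have t0: "c' 0 \<in> I" using hom L0 U(2) unfolding homeomorphism_def by auto
  show ?thesis
  proof (cases "deriv (\<lambda>t. fst (c t)) (c' 0) = 0")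
    case False
    obtain f m where f: "f 0 = 0" "\<forall>\<^sub>F z in nhds 0. z \<in> L \<longleftrightarrow> snd z = f (fst z)" "m > 0"
      "\<And>b. b > \<bar>deriv (\<lambda>t. snd (c t)) (c' 0)\<bar> \<Longrightarrow>
         \<exists>d>0. \<forall>x x'. \<bar>x\<bar> < d \<and> \<bar>x'\<bar> < d \<longrightarrow> \<bar>f x - f x'\<bar> \<le> b / m * \<bar>x - x'\<bar>"
      by (rule curve_local_graph[of fst snd, OF _ fst_tendsto_0 _ _ L0 U hom smooth False])
         (auto simp: prod_eq_iff)
    define b where "b = \<bar>deriv (\<lambda>t. snd (c t)) (c' 0)\<bar> + 1"
    obtain d where d: "d > 0" "\<And>x x'. \<bar>x\<bar> < d \<Longrightarrow> \<bar>x'\<bar> < d \<Longrightarrow> \<bar>f x - f x'\<bar> \<le> b / m * \<bar>x - x'\<bar>"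
      using f(4)[of b] by (auto simp: b_def)
    have "(b / m)-lipschitz_on {-d<..<d} f"
      using d f(3) by (intro lipschitz_onI) (auto simp: dist_real_def b_def)
    then have "continuous_on {-d<..<d} f" by (rule lipschitz_on_continuous_on)
    then have "continuous_graph_germ L f"
      using d(1) f(2) by (auto simp: continuous_graph_germ_def)
    then have "shear_invariant \<phi> h f"
      using graph_shear_invariant[OF sd g inv L0] by blast
    then have "\<forall>\<^sub>F x in at 0. real_analytic_at f x"
      by (rule shear_invariant_real_analytic[OF sd noninv])
    \<comment> \<open>The punctured statement is rewritten on a full neighbourhood, since
      \<open>fst\<close> may take the value 0 away from the origin.\<close>
    then have "\<forall>\<^sub>F x in nhds 0. x \<noteq> 0 \<longrightarrow> real_analytic_at f x"
      by (simp add: eventually_at_filter)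
    from eventually_compose_filterlim[OF this fst_tendsto_0] f(2)
    have "\<forall>\<^sub>F z in nhds 0. (z \<in> L \<longleftrightarrow> snd z = f (fst z)) \<and> (fst z \<noteq> 0 \<longrightarrow> real_analytic_at f (fst z))"
      by eventually_elim simp
    then obtain N where N: "open N" "0 \<in> N" "\<And>z. z \<in> N \<Longrightarrow> z \<in> L \<longleftrightarrow> snd z = f (fst z)"
      "\<And>z. z \<in> N \<Longrightarrow> fst z \<noteq> 0 \<Longrightarrow> real_analytic_at f (fst z)"
      by (rule open_eventually_nhds_0) blast
    \<comment> \<open>\<open>f\<close> may fail to be analytic at 0, so the vertical axis is
      removed; \<open>L\<close> meets it inside \<open>N\<close> only at the origin, because
      \<open>f 0 = 0\<close>.\<close>
    define W where "W = N \<inter> ((- {0}) \<times> UNIV)"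
    have W: "open W" unfolding W_def using N(1) by (intro open_Int open_Times) auto
    have "submanifold1 analytic_on_line (L \<inter> W)"
    proof (rule submanifold1_analytic_graph[OF W])
      show "z \<in> L \<inter> W \<longleftrightarrow> snd z = f (fst z)" if "z \<in> W" for z
        using that N(3)[of z] by (auto simp: W_def)
      show "real_analytic_at f (fst z)" if "z \<in> L \<inter> W" for z
      proof (rule N(4))
        show "z \<in> N" "fst z \<noteq> 0" using that by (auto simp: W_def)
      qed
    qed simp
    moreover have "p \<in> W" if "p \<in> L \<inter> N - {0}" for p
      using that N(3)[of p] f(1) by (auto simp: W_def prod_eq_iff mem_Times_iff)
    ultimately show ?thesis using N(1,2) W by blast
  next
    case True
    then have dQ: "deriv (\<lambda>t. snd (c t)) (c' 0) \<noteq> 0" using reg[OF t0] by simp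
    obtain u m where u: "u 0 = 0" "\<forall>\<^sub>F z in nhds 0. z \<in> L \<longleftrightarrow> fst z = u (snd z)" "m > 0"
      "\<And>b. b > \<bar>deriv (\<lambda>t. fst (c t)) (c' 0)\<bar> \<Longrightarrow>
         \<exists>d>0. \<forall>x x'. \<bar>x\<bar> < d \<and> \<bar>x'\<bar> < d \<longrightarrow> \<bar>u x - u x'\<bar> \<le> b / m * \<bar>x - x'\<bar>"
      by (rule curve_local_graph[of snd fst, OF _ snd_tendsto_0 _ _ L0 U hom smooth(2,1) dQ])
         (auto simp: prod_eq_iff)
    have lip: "\<exists>d>0. \<forall>y y'. \<bar>y\<bar> < d \<and> \<bar>y'\<bar> < d \<longrightarrow> \<bar>u y - u y'\<bar> \<le> \<epsilon> * \<bar>y - y'\<bar>" if "\<epsilon> > 0" for \<epsilon>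
      using u(4)[of "\<epsilon> * m"] that u(3) True by simp
    have "isCont u 0"
    proof -
      obtain d where d: "d > 0" "\<And>y. \<bar>y\<bar> < d \<Longrightarrow> \<bar>u y\<bar> \<le> \<bar>y\<bar>"
        using lip[of 1] u(1) by (metis abs_zero diff_zero mult_1 zero_less_one)
      have "\<forall>\<^sub>F y in at 0. norm (u y) \<le> \<bar>y\<bar>"
        unfolding eventually_at using d by (auto simp: dist_real_def)
      moreover have "((\<lambda>y :: real. \<bar>y\<bar>) \<longlongrightarrow> 0) (at 0)"
        by (intro tendsto_rabs_zero tendsto_ident_at)
      ultimately show ?thesis unfolding isCont_def u(1) by (rule Lim_null_comparison)
    qed
    then have "((\<lambda>y. (u y, y)) \<longlongrightarrow> (0, 0)) (nhds 0)"
      using isCont_tendsto_nhds[of 0 u] u(1) by (intro tendsto_Pair filterlim_ident) simp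
    then have "\<forall>\<^sub>F y in nhds 0. fst (shear \<phi> h (u y, y)) = u (snd (shear \<phi> h (u y, y)))"
      by (intro germ_invariant_along[OF sd g inv u(2)]) (simp_all add: zero_prod_def)
    then have inv_u: "\<forall>\<^sub>F y in nhds 0. u (y + h (u y)) = \<phi> (u y)"
      by eventually_elim simp
    \<comment> \<open>Otherwise the shear would be the identity near 0, and so would its
      square.\<close>
    have nontriv: "\<not> (\<forall>\<^sub>F x in nhds 0. \<phi> x = x \<and> h x = 0)"
    proof
      assume "\<forall>\<^sub>F x in nhds 0. \<phi> x = x \<and> h x = 0"
      from eventually_compose_filterlim[OF this fst_tendsto_0]
      have "\<forall>\<^sub>F p in nhds 0. shear \<phi> h (shear \<phi> h p) = p"
        by eventually_elim (auto simp: shear_def split: prod.splits)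
      with noninv show False by simp
    qed
    have "\<forall>\<^sub>F y in nhds 0. u y = 0"
      using vertical_graph_zero[OF sd nontriv u(1) lip inv_u] .
    from eventually_compose_filterlim[OF this snd_tendsto_0] u(2)
    have "\<forall>\<^sub>F z in nhds 0. z \<in> L \<longleftrightarrow> fst z = 0" by eventually_elim simp
    then obtain N where N: "open N" "0 \<in> N" "\<And>z. z \<in> N \<Longrightarrow> z \<in> L \<longleftrightarrow> fst z = 0"
      by (rule open_eventually_nhds_0) blast
    have "submanifold1 analytic_on_line (L \<inter> N)"
      by (rule submanifold1_analytic_vertical[OF N(1)]) (use N in auto)
    then show ?thesis using N(1,2) by blast
  qed
qed

section \<open>From shears to arbitrary representatives\<close>

lemma noninvolutive_shear_germ:
  assumes "germ0 g \<in> Shr2" "germ0 (g \<circ> g) \<noteq> germ0 id"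
  obtains \<phi> h where "shear_data \<phi> h" "\<forall>\<^sub>F p in nhds 0. g p = shear \<phi> h p"
    "\<not> (\<forall>\<^sub>F p in nhds 0. shear \<phi> h (shear \<phi> h p) = p)"
proof -
  obtain \<phi> h where sd: "shear_data \<phi> h" "germ0 g = germ0 (shear \<phi> h)"
    using assms(1) by (auto simp: Shr2_iff)
  have "g \<in> germ0 (shear \<phi> h)" using sd(2) germ0_self by metis
  then have "germ0 (g \<circ> g) = germ0 (shear \<phi> h \<circ> shear \<phi> h)"
    by (intro germ0_comp shear_tendsto_0[OF sd(1)])
  with assms(2) have "germ0 (shear \<phi> h \<circ> shear \<phi> h) \<noteq> germ0 id"
    by simp
  then have "\<not> (\<forall>\<^sub>F p in nhds 0. shear \<phi> h (shear \<phi> h p) = p)"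
    by (simp add: germ0_eq_iff)
  then show ?thesis using that sd by (simp add: germ0_eq_iff)
qed

theorem lemma1p5:
  shows "ICP Shr2 \<and>
    (\<forall>\<phi>. germ0 \<phi> \<in> Shr2 \<and> germ0 (\<phi> \<circ> \<phi>) \<noteq> germ0 id \<longrightarrow>
      (\<forall>\<gamma> f. 0 \<in> \<gamma> \<and> continuous_graph_germ \<gamma> f \<and> germ_invariant \<phi> \<gamma> \<longrightarrow>
         (\<forall>\<^sub>F x in at 0. real_analytic_at f x)) \<and>
      (\<forall>\<gamma>\<^sub>1 \<gamma>\<^sub>2 f\<^sub>1 f\<^sub>2.
         0 \<in> \<gamma>\<^sub>1 \<and> continuous_graph_germ \<gamma>\<^sub>1 f\<^sub>1 \<and> germ_invariant \<phi> \<gamma>\<^sub>1 \<and>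
         0 \<in> \<gamma>\<^sub>2 \<and> continuous_graph_germ \<gamma>\<^sub>2 f\<^sub>2 \<and> germ_invariant \<phi> \<gamma>\<^sub>2 \<longrightarrow>
         (\<forall>\<^sub>F p in nhds 0. p \<in> \<gamma>\<^sub>1 \<longleftrightarrow> p \<in> \<gamma>\<^sub>2)))"
proof (intro conjI allI impI)
  show "ICP Shr2"
    unfolding ICP_def
  proof (intro conjI allI impI)
    show "subgroup Shr2 Diff2" by (rule subgroup_Shr2)
  next
    fix g L
    assume *: "germ0 g \<in> Shr2 \<and> germ0 (g \<circ> g) \<noteq> germ0 id \<and> smooth_curve_around0 L \<and> germ_invariant g L"
    then have g: "germ0 g \<in> Shr2" "germ0 (g \<circ> g) \<noteq> germ0 id" by auto
    obtain \<phi> h where "shear_data \<phi> h" "\<forall>\<^sub>F p in nhds 0. g p = shear \<phi> h p"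
      "\<not> (\<forall>\<^sub>F p in nhds 0. shear \<phi> h (shear \<phi> h p) = p)"
      by (rule noninvolutive_shear_germ[OF g])
    then show "\<exists>N. open N \<and> 0 \<in> N \<and>
        (\<forall>p \<in> L \<inter> N - {0}. \<exists>U. open U \<and> p \<in> U \<and> submanifold1 analytic_on_line (L \<inter> U))"
      using * by (intro shear_invariant_curve_analytic) auto
  qed
next
  fix g :: "real \<times> real \<Rightarrow> real \<times> real" and \<gamma> f
  assume "germ0 g \<in> Shr2 \<and> germ0 (g \<circ> g) \<noteq> germ0 id"
    and *: "0 \<in> \<gamma> \<and> continuous_graph_germ \<gamma> f \<and> germ_invariant g \<gamma>"
  then have g: "germ0 g \<in> Shr2" "germ0 (g \<circ> g) \<noteq> germ0 id" by auto
  obtain \<phi> h where "shear_data \<phi> h" "\<forall>\<^sub>F p in nhds 0. g p = shear \<phi> h p"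
    "\<not> (\<forall>\<^sub>F p in nhds 0. shear \<phi> h (shear \<phi> h p) = p)"
    by (rule noninvolutive_shear_germ[OF g])
  then show "\<forall>\<^sub>F x in at 0. real_analytic_at f x"
    using * shear_invariant_real_analytic graph_shear_invariant by blast
next
  fix g :: "real \<times> real \<Rightarrow> real \<times> real" and \<gamma>\<^sub>1 \<gamma>\<^sub>2 f\<^sub>1 f\<^sub>2
  assume "germ0 g \<in> Shr2 \<and> germ0 (g \<circ> g) \<noteq> germ0 id"
    and *: "0 \<in> \<gamma>\<^sub>1 \<and> continuous_graph_germ \<gamma>\<^sub>1 f\<^sub>1 \<and> germ_invariant g \<gamma>\<^sub>1 \<and>
      0 \<in> \<gamma>\<^sub>2 \<and> continuous_graph_germ \<gamma>\<^sub>2 f\<^sub>2 \<and> germ_invariant g \<gamma>\<^sub>2"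
  then have g: "germ0 g \<in> Shr2" "germ0 (g \<circ> g) \<noteq> germ0 id" by auto
  obtain \<phi> h where \<phi>: "shear_data \<phi> h" "\<forall>\<^sub>F p in nhds 0. g p = shear \<phi> h p"
    "\<not> (\<forall>\<^sub>F p in nhds 0. shear \<phi> h (shear \<phi> h p) = p)"
    by (rule noninvolutive_shear_germ[OF g])
  \<comment> \<open>Both graph functions solve the same functional equation and hence agree near 0;
    the two sets are then compared through their local equations.\<close>
  have "shear_invariant \<phi> h f\<^sub>1" "shear_invariant \<phi> h f\<^sub>2"
    using * graph_shear_invariant[OF \<phi>(1,2)] by blast+
  then have "\<forall>\<^sub>F x in nhds 0. f\<^sub>1 x = f\<^sub>2 x"
    by (rule shear_invariant_unique[OF \<phi>(1,3)])
  then have "\<forall>\<^sub>F p in nhds (0 :: real \<times> real). f\<^sub>1 (fst p) = f\<^sub>2 (fst p)"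
    by (rule eventually_compose_filterlim[OF _ fst_tendsto_0])
  moreover have "\<forall>\<^sub>F p in nhds 0. p \<in> \<gamma>\<^sub>1 \<longleftrightarrow> snd p = f\<^sub>1 (fst p)"
    "\<forall>\<^sub>F p in nhds 0. p \<in> \<gamma>\<^sub>2 \<longleftrightarrow> snd p = f\<^sub>2 (fst p)"
    using * by (auto simp: continuous_graph_germ_def)
  ultimately show "\<forall>\<^sub>F p in nhds 0. p \<in> \<gamma>\<^sub>1 \<longleftrightarrow> p \<in> \<gamma>\<^sub>2"
    by eventually_elim simp
qed

end
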